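(* Let $\mathcal H,\mathcal K$ be separable complex Hilbert spaces and assume: (i) $H_0$ is a densely defined closed linear operator in $\mathcal H$ with $\rho(H_0)\neq\emptyset$; $A\colon\operatorname{dom}(A)\to\mathcal K$ and $B\colon\operatorname{dom}(B)\to\mathcal K$, with $\operatorname{dom}(A),\operatorname{dom}(B)\subseteq\mathcal H$, are densely defined closed linear operators such that $\operatorname{dom}(A)\supseteq\operatorname{dom}(H_0)$ and $\operatorname{dom}(B)\supseteq\operatorname{dom}(H_0^* )$; (ii) for some (and hence all) $z\in\rho(H_0)$ the operator $-AR_0(z)B^*$, defined on $\operatorname{dom}(B^* )$, has a bounded extension $K(z)=-\overline{AR_0(z)B^*}\in\mathcal B(\mathcal K)$; (iii) $1\in\rho(K(z_0))$ for some $z_0\in\rho(H_0)$; (iv) $K(z)$ is compact for all $z\in\rho(H_0)$. Let $H$ be the operator in $\mathcal H$ described in the context. In addition, assume that each connected component of $\widetilde\rho(H_0)$ contains a point of $\rho(H)$, and each connected component of $\widetilde\rho(H)$ contains a point of $\rho(H_0)$. Then $$\widetilde\sigma_{\rm e}(H)=\widetilde\sigma_{\rm e}(H_0).$$ In addition, let $\lambda_0\in\mathbb C\setminus\widetilde\sigma_{\rm e}(H_0)$. Then there exist a neighborhood $U(\lambda_0)$ of $\lambda_0$ and a function $\Delta(\cdot)$ meromorphic on $U(\lambda_0)$, which does not vanish identically, such that $$m(z,H)=m(z,H_0)+m(z;\Delta),\quad z\in U(\lambda_0).$$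
   Context: Notation: $\rho(T),\sigma(T)$ are the resolvent set and spectrum of a closed operator $T$, $\overline{S}$ the closure of a closable operator $S$, and $R_0(z)=(H_0-zI_{\mathcal H})^{-1}$ for $z\in\rho(H_0)$. One has $AR_0(z)\in\mathcal B(\mathcal H,\mathcal K)$ and $\overline{R_0(z)B^*}=[B(H_0^*-\overline z)^{-1}]^*\in\mathcal B(\mathcal K,\mathcal H)$. Definition of $H$: for $z\in\rho(H_0)$ with $1\in\rho(K(z))$ put $R(z)=R_0(z)-\overline{R_0(z)B^*}\,[I_{\mathcal K}-K(z)]^{-1}AR_0(z)$. Under (i)–(iii), there is a unique densely defined closed linear operator $H$ in $\mathcal H$, independent of $z$, such that $R(z)=(H-zI_{\mathcal H})^{-1}$ for all such $z$. For a densely defined closed operator $T$ in $\mathcal H$, an "isolated eigenvalue" of $T$ is an isolated point of $\sigma(T)$ that is an eigenvalue of $T$. For an isolated point $\lambda_0$ of $\sigma(T)$ the Riesz projection is $P(\lambda_0,T)=-\frac1{2\pi i}\oint_{C(\lambda_0;\varepsilon)}d\zeta\,(T-\zeta I_{\mathcal H})^{-1}$, where $C(\lambda_0;\varepsilon)$ is a counterclockwise oriented circle centered at $\lambda_0$ of sufficiently small radius $\varepsilon>0$ (excluding the rest of $\sigma(T)$); the algebraic multiplicity of $\lambda_0$ is $\dim(\operatorname{ran}P(\lambda_0,T))$. Define $$\widetilde\sigma_{\rm e}(T)=\{\lambda\in\sigma(T)\mid\lambda\text{ is not an isolated eigenvalue of }T\text{ of finite algebraic multiplicity}\},\qquad \widetilde\rho(T)=\mathbb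 C\setminus\widetilde\sigma_{\rm e}(T).$$ The multiplicity function $m(\cdot,T)$ on $\mathbb C$ is: $m(z,T)=0$ if $z\in\rho(T)$; $m(z,T)=\dim(\operatorname{ran}(P(z,T)))$ if $z$ is an isolated eigenvalue of $T$ of finite algebraic multiplicity; $m(z,T)=+\infty$ otherwise. For a meromorphic function $f$, not identically vanishing, on an open connected set $\Omega\subseteq\mathbb C$, and $z\in\Omega$: $m(z;f)=k$ if $z$ is a zero of $f$ of order $k$, $m(z;f)=-k$ if $z$ is a pole of order $k$, and $m(z;f)=0$ otherwise. *)

theory Defs
  imports "HOL-Complex_Analysis.Complex_Analysis"
begin

section \<open>Complex Hilbert spaces\<close>

text \<open>The inner product is antilinear in the first and linear in the second argument.\<close>

class complex_inner = real_normed_vector +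
  fixes scaleC :: "complex \<Rightarrow> 'a \<Rightarrow> 'a" (infixr \<open>*\<^sub>C\<close> 75)
    and cinner :: "'a \<Rightarrow> 'a \<Rightarrow> complex"
  assumes scaleR_scaleC: "r *\<^sub>R x = complex_of_real r *\<^sub>C x"
    and scaleC_add_right: "a *\<^sub>C (x + y) = a *\<^sub>C x + a *\<^sub>C y"
    and scaleC_add_left: "(a + b) *\<^sub>C x = a *\<^sub>C x + b *\<^sub>C x"
    and scaleC_scaleC: "a *\<^sub>C b *\<^sub>C x = (a * b) *\<^sub>C x"
    and scaleC_one: "1 *\<^sub>C x = x"
    and cinner_commute: "cinner x y = cnj (cinner y x)"
    and cinner_add_right: "cinner x (y + z) = cinner x y + cinner x z"
    and cinner_scaleC_right: "cinner x (a *\<^sub>C y) = a * cinner x y"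
    and cinner_self: "cinner x x = complex_of_real ((norm x)\<^sup>2)"

class complex_hilbert = complex_inner + complete_space

subclass (in complex_hilbert) banach ..

instantiation complex :: complex_hilbert
begin

definition scaleC_complex :: "complex \<Rightarrow> complex \<Rightarrow> complex"
  where "scaleC_complex a x = a * x"

definition cinner_complex :: "complex \<Rightarrow> complex \<Rightarrow> complex"
  where "cinner_complex x y = cnj x * y"

instance
proof
  fix x :: complex
  show "cinner x x = complex_of_real ((norm x)\<^sup>2)"
    by (metis cinner_complex_def complex_norm_square mult.commute of_real_power)
qed (auto simp: scaleC_complex_def cinner_complex_def scaleR_conv_of_real algebra_simps)

end

global_interpretation cvec: vector_space "scaleC :: complex \<Rightarrow> 'a \<Rightarrow> 'a::complex_inner"
  by unfold_locales (simp_all add: scaleC_add_right scaleC_add_left scaleC_scaleC scaleC_one)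

section \<open>Linear operators\<close>

text \<open>
  An operator with domain in \<open>'a\<close> and values in \<open>'b\<close> is identified with its graph. Thus
  \<^const>\<open>Domain\<close> is the domain, \<^const>\<open>converse\<close> the inverse, \<open>\<subseteq>\<close> the extension
  relation, and the closure of a closable operator is the topological \<^const>\<open>closure\<close>
  of the graph in the product space.
\<close>

definition linear_op :: "('a::complex_inner \<times> 'b::complex_inner) set \<Rightarrow> bool" where
  "linear_op T \<longleftrightarrow> single_valued T \<and> (0, 0) \<in> T
     \<and> (\<forall>x y x' y'. (x, y) \<in> T \<longrightarrow> (x', y') \<in> T \<longrightarrow> (x + x', y + y') \<in> T)
     \<and> (\<forall>c x y. (x, y) \<in> T \<longrightarrow> (c *\<^sub>C x, c *\<^sub>C y) \<in> T)"

definition closed_op :: "('a::complex_inner \<times> 'b::complex_inner) set \<Rightarrow> bool" where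
  "closed_op T \<longleftrightarrow> linear_op T \<and> closed T"

definition densely_defined :: "('a::complex_inner \<times> 'b::complex_inner) set \<Rightarrow> bool" where
  "densely_defined T \<longleftrightarrow> closure (Domain T) = UNIV"

definition adj_op :: "('a::complex_inner \<times> 'b::complex_inner) set \<Rightarrow> ('b \<times> 'a) set" where
  "adj_op T = {(y, z). \<forall>(x, w)\<in>T. cinner y w = cinner z x}"

definition scalar_op :: "complex \<Rightarrow> ('a::complex_inner \<times> 'a) set" where
  "scalar_op z = {(x, y). y = z *\<^sub>C x}"

definition uminus_op :: "('a::complex_inner \<times> 'b::complex_inner) set \<Rightarrow> ('a \<times> 'b) set" where
  "uminus_op T = {(x, - y) | x y. (x, y) \<in> T}"

definition minus_op ::
    "('a::complex_inner \<times> 'b::complex_inner) set \<Rightarrow> ('a \<times> 'b) set \<Rightarrow> ('a \<times> 'b) set"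
    (infixl \<open>-\<^sub>o\<close> 65) where
  "S -\<^sub>o T = {(x, y - y') | x y y'. (x, y) \<in> S \<and> (x, y') \<in> T}"

text \<open>Operator product: relational composition in the usual order, \<open>T\<close> acting first.\<close>

abbreviation comp_op :: "('b \<times> 'c) set \<Rightarrow> ('a \<times> 'b) set \<Rightarrow> ('a \<times> 'c) set"
    (infixr \<open>\<circ>\<^sub>o\<close> 75) where
  "S \<circ>\<^sub>o T \<equiv> T O S"

definition graph_of :: "('a::complex_inner \<Rightarrow>\<^sub>L 'b::complex_inner) \<Rightarrow> ('a \<times> 'b) set" where
  "graph_of F = range (\<lambda>x. (x, blinfun_apply F x))"

text \<open>
  Membership in $\mathcal B(\mathcal H,\mathcal K)$. The elements of \<open>\<Rightarrow>\<^sub>L\<close> are only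
  real-linear; complex linearity comes from \<^const>\<open>linear_op\<close>.
\<close>

definition bounded_op :: "('a::complex_inner \<times> 'b::complex_inner) set \<Rightarrow> bool" where
  "bounded_op T \<longleftrightarrow> linear_op T \<and> (\<exists>F. T = graph_of F)"

definition compact_op :: "('a::complex_inner \<times> 'b::complex_inner) set \<Rightarrow> bool" where
  "compact_op T \<longleftrightarrow> bounded_op T \<and> (\<forall>S. bounded S \<longrightarrow> compact (closure (T `` S)))"

section \<open>Spectrum, Riesz projections and multiplicities\<close>

definition resolvent_op :: "('a::complex_inner \<times> 'a) set \<Rightarrow> complex \<Rightarrow> ('a \<times> 'a) set" where
  "resolvent_op T z = (T -\<^sub>o scalar_op z)\<inverse>"

definition resolvent_set :: "('a::complex_inner \<times> 'a) set \<Rightarrow> complex set" where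
  "resolvent_set T = {z. bounded_op (resolvent_op T z)}"

definition spectrum_op :: "('a::complex_inner \<times> 'a) set \<Rightarrow> complex set" where
  "spectrum_op T = - resolvent_set T"

definition eigenvalue_op :: "('a::complex_inner \<times> 'a) set \<Rightarrow> complex \<Rightarrow> bool" where
  "eigenvalue_op T z \<longleftrightarrow> (\<exists>x. x \<noteq> 0 \<and> (x, z *\<^sub>C x) \<in> T)"

text \<open>The resolvent at a point of the resolvent set as an element of a Banach space.\<close>

definition resolvent_blinfun ::
    "('a::complex_inner \<times> 'a) set \<Rightarrow> complex \<Rightarrow> 'a \<Rightarrow>\<^sub>L 'a" where
  "resolvent_blinfun T z = (THE F. graph_of F = resolvent_op T z)"

definition scaleC_blinfun ::
    "complex \<Rightarrow> ('a::complex_inner \<Rightarrow>\<^sub>L 'b::complex_inner) \<Rightarrow> 'a \<Rightarrow>\<^sub>L 'b" where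
  "scaleC_blinfun c F = Blinfun (\<lambda>x. c *\<^sub>C blinfun_apply F x)"

text \<open>
  Operator-norm convergent analogue of \<^const>\<open>contour_integral\<close>.
\<close>

definition op_contour_integral ::
    "(real \<Rightarrow> complex) \<Rightarrow> (complex \<Rightarrow> 'a::complex_inner \<Rightarrow>\<^sub>L 'b::complex_inner) \<Rightarrow> 'a \<Rightarrow>\<^sub>L 'b" where
  "op_contour_integral g F = integral {0..1}
     (\<lambda>t. scaleC_blinfun (vector_derivative g (at t within {0..1})) (F (g t)))"

text \<open>
  For an isolated point of the spectrum the integral does not depend on the radius once
  the latter is small enough; the projection is this eventually constant value.
\<close>

definition riesz_projection ::
    "('a::complex_hilbert \<times> 'a) set \<Rightarrow> complex \<Rightarrow> 'a \<Rightarrow>\<^sub>L 'a" where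
  "riesz_projection T z = (THE P. \<forall>\<^sub>F r in at_right 0.
     P = scaleC_blinfun (- (1 / (2 * of_real pi * \<i>)))
           (op_contour_integral (circlepath z r) (resolvent_blinfun T)))"

text \<open>
  Complex dimension with value \<open>\<infinity>\<close> for infinite-dimensional spaces, on which
  \<^const>\<open>cvec.dim\<close> is \<open>0\<close>.
\<close>

definition cdim_ext :: "'a::complex_inner set \<Rightarrow> enat" where
  "cdim_ext V = (if \<exists>S. finite S \<and> V \<subseteq> cvec.span S then enat (cvec.dim V) else \<infinity>)"

definition alg_mult :: "('a::complex_hilbert \<times> 'a) set \<Rightarrow> complex \<Rightarrow> enat" where
  "alg_mult T z = cdim_ext (range (blinfun_apply (riesz_projection T z)))"

definition isolated_eigenvalue_fin :: "('a::complex_hilbert \<times> 'a) set \<Rightarrow> complex \<Rightarrow> bool" where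
  "isolated_eigenvalue_fin T z \<longleftrightarrow>
     z isolated_in spectrum_op T \<and> eigenvalue_op T z \<and> alg_mult T z \<noteq> \<infinity>"

definition ess_spectrum :: "('a::complex_hilbert \<times> 'a) set \<Rightarrow> complex set" where
  "ess_spectrum T = {z \<in> spectrum_op T. \<not> isolated_eigenvalue_fin T z}"

definition ext_resolvent_set :: "('a::complex_hilbert \<times> 'a) set \<Rightarrow> complex set" where
  "ext_resolvent_set T = - ess_spectrum T"

definition mult_op :: "complex \<Rightarrow> ('a::complex_hilbert \<times> 'a) set \<Rightarrow> enat" where
  "mult_op z T =
     (if z \<in> resolvent_set T then 0
      else if isolated_eigenvalue_fin T z then alg_mult T z
      else \<infinity>)"

text \<open>
  \<^const>\<open>zorder\<close> is \<open>k\<close> at a zero of order \<open>k\<close> and \<open>- k\<close> at a pole of order \<open>k\<close>.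
  The definition is meant for functions that are \<^const>\<open>nicely_meromorphic_on\<close> a domain
  and do not vanish identically there.
\<close>

definition mult_fun :: "complex \<Rightarrow> (complex \<Rightarrow> complex) \<Rightarrow> int" where
  "mult_fun z f = (if f z = 0 \<or> is_pole f z then zorder f z else 0)"

section \<open>The perturbed operator\<close>

text \<open>\<open>bs_op H0 A B z\<close> is the Birman--Schwinger operator \<open>K(z)\<close>.\<close>

definition bs_op ::
    "('h::complex_hilbert \<times> 'h) set \<Rightarrow> ('h \<times> 'k::complex_hilbert) set \<Rightarrow> ('h \<times> 'k) set
      \<Rightarrow> complex \<Rightarrow> ('k \<times> 'k) set" where
  "bs_op H0 A B z = uminus_op (closure (A \<circ>\<^sub>o resolvent_op H0 z \<circ>\<^sub>o adj_op B))"

definition perturbed_resolvent ::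
    "('h::complex_hilbert \<times> 'h) set \<Rightarrow> ('h \<times> 'k::complex_hilbert) set \<Rightarrow> ('h \<times> 'k) set
      \<Rightarrow> complex \<Rightarrow> ('h \<times> 'h) set" where
  "perturbed_resolvent H0 A B z =
     resolvent_op H0 z -\<^sub>o
       closure (resolvent_op H0 z \<circ>\<^sub>o adj_op B) \<circ>\<^sub>o (scalar_op 1 -\<^sub>o bs_op H0 A B z)\<inverse>
         \<circ>\<^sub>o A \<circ>\<^sub>o resolvent_op H0 z"

text \<open>
  The defining property of \<open>H\<close>. It determines \<open>H\<close> uniquely as soon as some \<open>z\<close>
  satisfies the two conditions.
\<close>

definition is_perturbed_op ::
    "('h::complex_hilbert \<times> 'h) set \<Rightarrow> ('h \<times> 'k::complex_hilbert) set \<Rightarrow> ('h \<times> 'k) set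
      \<Rightarrow> ('h \<times> 'h) set \<Rightarrow> bool" where
  "is_perturbed_op H0 A B H \<longleftrightarrow> densely_defined H \<and> closed_op H
     \<and> (\<forall>z \<in> resolvent_set H0. 1 \<in> resolvent_set (bs_op H0 A B z)
          \<longrightarrow> perturbed_resolvent H0 A B z = resolvent_op H z)"

end

theory Submission
  imports Defs "Jordan_Normal_Form.Determinant"
begin

text \<open>
  Fix \<open>z\<^sub>1 \<in> \<rho>(H\<^sub>0)\<close> with \<open>1 \<in> \<rho>(K(z\<^sub>1))\<close> and put \<open>T\<^sub>0 = R\<^sub>0(z\<^sub>1)\<close>, \<open>F = A T\<^sub>0\<close>, \<open>G = closure(T\<^sub>0 B\<^sup>*)\<close>,
  \<open>L = 1 - K(z\<^sub>1)\<close> and \<open>T = R(z\<^sub>1) = T\<^sub>0 - G L\<^sup>-\<^sup>1 F\<close>, all of them bounded. Then \<open>z \<in> \<rho>(H)\<close> iff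
  \<open>1 - (z - z\<^sub>1) T\<close> is invertible, likewise for \<open>H\<^sub>0\<close> and \<open>T\<^sub>0\<close>, and
  \<open>1 - K(z) = L + (z - z\<^sub>1) F (1 - (z - z\<^sub>1) T\<^sub>0)\<^sup>-\<^sup>1 G\<close>.
  A point \<open>z\<^sub>0\<close> in the closure of \<open>\<rho>(H)\<close> lies outside the essential spectrum iff
  \<open>1 - (z\<^sub>0 - z\<^sub>1) T\<close> is invertible modulo finite rank operators: one direction inverts it up to the
  Riesz projection, the other is the analytic Fredholm theorem, which reduces to the zeros of a
  holomorphic determinant. Modulo finite rank operators, \<open>1 - K\<close> makes sense at \<open>z\<^sub>0\<close> as well and
  is \<open>1\<close> plus a compact operator there, so that the Fredholm property passes from \<open>T\<^sub>0\<close> to \<open>T\<close>. In a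
  component of the complement of the essential spectrum of \<open>H\<^sub>0\<close>, the closure of \<open>\<rho>(H)\<close> is thus
  open and closed. Exchanging the roles of \<open>H\<^sub>0\<close> and \<open>H\<close> replaces \<open>1 - K\<close> by its inverse.
  Given equality of the essential spectra, a power of \<open>z - z\<^sub>0\<close> is an admissible \<open>\<Delta>\<close>.
\<close>

section \<open>Bounded complex-linear operators\<close>

text \<open>The obstacle is that at a discrete eigenvalue \<open>z0\<close> of \<open>H0\<close>
  neither the resolvent nor K(z0) exists, yet this is the point to be examined. For X with resolvent
  T at \<open>z1\<close>, (X - z) T = 1 - (z - z1) T is bounded and affine in z, and a parametrix of
  it at \<open>z0\<close> can stand in for the missing inverse. At nearby points this changes K by a
  finite rank operator only, and the changed family is continuous at \<open>z0\<close>, so that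
  compactness reaches \<open>z0\<close> as a norm limit. Fredholmness alone would permit a nonzero
  index and a whole neighbourhood of spectrum. Regular points arbitrarily close to \<open>z0\<close>
  exclude this, and the hypotheses on connected components serve to produce them. Parametrices are
  taken modulo finite rank rather than compact operators: singular behaviour is then carried by a
  matrix of scalar functions. Operator-valued holomorphy and contour integrals are likewise
  evaluated through scalar functions f (R(z) x). Equality of the essential spectra comes before the
  multiplicity formula because it makes both multiplicities at \<open>z0\<close> finite, so that
  their difference makes sense.\<close>

lemma norm_scaleC: "norm (a *\<^sub>C (x::'a::complex_inner)) = cmod a * norm x"
proof -
  have "cinner (a *\<^sub>C x) (a *\<^sub>C x) = a * cnj (cinner x (a *\<^sub>C x))"
    by (metis cinner_commute cinner_scaleC_right)
  also have "\<dots> = a * cnj a * cnj (cinner x x)"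
    by (simp add: cinner_scaleC_right)
  also have "\<dots> = complex_of_real ((cmod a * norm x)\<^sup>2)"
    by (simp add: cinner_self complex_norm_square[symmetric] power_mult_distrib
        flip: of_real_mult of_real_power)
  finally have "(norm (a *\<^sub>C x))\<^sup>2 = (cmod a * norm x)\<^sup>2"
    by (simp only: cinner_self of_real_eq_iff)
  then show ?thesis
    by (simp add: power2_eq_iff_nonneg)
qed

lemma cinner_add_left: "cinner (x + y) z = cinner x z + cinner y (z::'a::complex_inner)"
  by (metis cinner_add_right cinner_commute complex_cnj_add)

lemma cinner_scaleC_left: "cinner (a *\<^sub>C x) y = cnj a * cinner x (y::'a::complex_inner)"
  by (metis cinner_commute cinner_scaleC_right complex_cnj_mult)

lemma cinner_zero_right [simp]: "cinner (x::'a::complex_inner) 0 = 0"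
  using cinner_add_right[of x 0 0] by simp

lemma cinner_zero_left [simp]: "cinner 0 (x::'a::complex_inner) = 0"
  using cinner_add_left[of 0 0 x] by simp

lemma cinner_minus_right: "cinner x (- y) = - cinner x (y::'a::complex_inner)"
  using cinner_add_right[of x y "-y"] by (simp add: eq_neg_iff_add_eq_0 add.commute)

lemma cinner_minus_left: "cinner (- x) y = - cinner x (y::'a::complex_inner)"
  using cinner_add_left[of x "-x" y] by (simp add: eq_neg_iff_add_eq_0 add.commute)

lemma cinner_diff_right: "cinner x (y - z) = cinner x y - cinner x (z::'a::complex_inner)"
  using cinner_add_right[of x y "-z"] by (simp add: cinner_minus_right)

lemma cinner_diff_left: "cinner (x - y) z = cinner x z - cinner y (z::'a::complex_inner)"
  using cinner_add_left[of x "-y" z] by (simp add: cinner_minus_left)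

lemmas cinner_simps = cinner_add_left cinner_add_right cinner_diff_left cinner_diff_right
  cinner_minus_left cinner_minus_right cinner_scaleC_left cinner_scaleC_right

lemma cinner_eq_zero_iff: "cinner x x = 0 \<longleftrightarrow> x = (0::'a::complex_inner)"
  by (simp add: cinner_self)

lemma eq_if_cinner_eq:
  assumes "\<And>y. cinner y x = cinner y (x'::'a::complex_inner)"
  shows "x = x'"
  using assms[of "x - x'"] cinner_eq_zero_iff[of "x - x'"] by (simp add: cinner_diff_right)

lemma norm_diff_cinner:
  "(norm (x - y))\<^sup>2 = (norm x)\<^sup>2 - 2 * Re (cinner y x) + (norm (y::'a::complex_inner))\<^sup>2"
proof -
  have "complex_of_real ((norm (x - y))\<^sup>2) = cinner x x - (cinner y x + cnj (cinner y x)) + cinner y y"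
    unfolding cinner_self[symmetric]
    by (simp add: cinner_simps flip: cinner_commute)
  also have "\<dots> = complex_of_real ((norm x)\<^sup>2 - 2 * Re (cinner y x) + (norm y)\<^sup>2)"
    by (simp add: cinner_self complex_add_cnj)
  finally show ?thesis by (simp only: of_real_eq_iff)
qed

lemma cinner_Cauchy_Schwarz: "cmod (cinner x y) \<le> norm x * norm (y::'a::complex_inner)"
proof (cases "x = 0")
  case False
  \<comment> \<open>\<open>c *\<^sub>C x\<close> is the orthogonal projection of \<open>y\<close>
    onto the line through \<open>x\<close>; the inequality says that the remainder has nonnegative
    squared norm.\<close>
  define c where "c = cinner x y / complex_of_real ((norm x)\<^sup>2)"
  have cc: "cnj (cinner x y) * cinner x y = complex_of_real ((cmod (cinner x y))\<^sup>2)"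
    by (metis complex_norm_square mult.commute of_real_power)
  have "cinner (c *\<^sub>C x) y = complex_of_real ((cmod (cinner x y))\<^sup>2 / (norm x)\<^sup>2)"
    using cc by (simp add: c_def cinner_scaleC_left)
  moreover have "norm (c *\<^sub>C x) = cmod (cinner x y) / norm x"
    using False by (simp add: norm_scaleC c_def norm_divide norm_mult power2_eq_square)
  ultimately have "(norm (y - c *\<^sub>C x))\<^sup>2 = (norm y)\<^sup>2 - (cmod (cinner x y))\<^sup>2 / (norm x)\<^sup>2"
    by (simp add: norm_diff_cinner power_divide)
  then have "(cmod (cinner x y))\<^sup>2 / (norm x)\<^sup>2 \<le> (norm y)\<^sup>2"
    by (metis zero_le_power2 diff_ge_0_iff_ge)
  then have "(cmod (cinner x y))\<^sup>2 \<le> (norm x * norm y)\<^sup>2"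
    using False by (simp add: divide_le_eq power_mult_distrib mult.commute)
  then show ?thesis
    by (rule power2_le_imp_le) simp
qed simp

lemma bounded_bilinear_scaleC:
  "bounded_bilinear (scaleC :: complex \<Rightarrow> 'a \<Rightarrow> 'a::complex_inner)"
proof
  show "\<exists>K. \<forall>a b. norm (a *\<^sub>C (b::'a)) \<le> norm a * norm b * K"
    by (rule exI[of _ 1]) (simp add: norm_scaleC)
qed (simp_all add: scaleC_add_right scaleC_add_left scaleR_scaleC scaleC_scaleC scaleC_complex_def mult.commute)

lemma bounded_bilinear_cinner:
  "bounded_bilinear (cinner :: 'a \<Rightarrow> 'a \<Rightarrow> complex)" for dummy :: "'a::complex_inner"
proof
  show "\<exists>K. \<forall>a b. norm (cinner (a::'a) b) \<le> norm a * norm b * K"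
    by (rule exI[of _ 1]) (simp add: cinner_Cauchy_Schwarz)
qed (simp_all add: cinner_simps scaleR_scaleC scaleR_conv_of_real scaleC_complex_def)

lemmas bounded_linear_scaleC = bounded_bilinear.bounded_linear_right[OF bounded_bilinear_scaleC]
lemmas bounded_linear_cinner = bounded_bilinear.bounded_linear_right[OF bounded_bilinear_cinner]

lemma scaleC_blinfun_apply [simp]: "blinfun_apply (scaleC_blinfun c F) x = c *\<^sub>C F x"
  unfolding scaleC_blinfun_def
  by (subst bounded_linear_Blinfun_apply)
    (auto intro: bounded_linear_compose[OF bounded_linear_scaleC blinfun.bounded_linear_right])

lemma norm_scaleC_blinfun: "norm (scaleC_blinfun c F) = cmod c * norm F"
proof (cases "c = 0")
  case True
  then have "scaleC_blinfun c F = 0" by (auto intro: blinfun_eqI)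
  then show ?thesis using True by simp
next
  case False
  have le: "norm (scaleC_blinfun c F) \<le> cmod c * norm F" for c F
    by (rule norm_blinfun_bound)
      (auto simp: norm_scaleC mult.assoc intro!: mult_left_mono norm_blinfun)
  have "F = scaleC_blinfun (inverse c) (scaleC_blinfun c F)"
    using False by (auto intro!: blinfun_eqI simp: scaleC_scaleC)
  then have "norm F \<le> cmod (inverse c) * norm (scaleC_blinfun c F)"
    using le by metis
  then have "cmod c * norm F \<le> norm (scaleC_blinfun c F)"
    using False by (simp add: norm_divide field_simps)
  with le[of c F] show ?thesis by (rule antisym)
qed

lemma bounded_bilinear_scaleC_blinfun: "bounded_bilinear scaleC_blinfun"
proof
  show "\<exists>K. \<forall>a b. norm (scaleC_blinfun a b) \<le> norm a * norm b * K"
    by (rule exI[of _ 1]) (simp add: norm_scaleC_blinfun)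
qed (auto intro!: blinfun_eqI simp: blinfun.bilinear_simps scaleC_add_right scaleC_add_left
      scaleR_scaleC scaleC_scaleC scaleC_complex_def mult.commute)

lemmas continuous_on_scaleC_blinfun [continuous_intros] =
  bounded_bilinear.continuous_on[OF bounded_bilinear_scaleC_blinfun]

lemmas blinfun_ops = blinfun.bilinear_simps scaleC_add_right scaleC_add_left scaleC_scaleC
  blinfun_apply_blinfun_compose cvec.scale_right_diff_distrib cvec.scale_left_diff_distrib
  cvec.scale_minus_left cvec.scale_minus_right

text \<open>Complex homogeneity is not part of the type \<open>\<Rightarrow>\<^sub>L\<close>, so it
  has to be carried separately through inverses, limits and contour integrals.\<close>

definition clin :: "('a::complex_inner \<Rightarrow>\<^sub>L 'b::complex_inner) \<Rightarrow> bool" where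
  "clin F \<longleftrightarrow> (\<forall>c x. F (c *\<^sub>C x) = c *\<^sub>C F x)"

lemma clin_apply: "clin F \<Longrightarrow> F (c *\<^sub>C x) = c *\<^sub>C F x"
  by (simp add: clin_def)

lemma clin_id [simp]: "clin id_blinfun" by (simp add: clin_def)
lemma clin_zero [simp]: "clin 0" by (simp add: clin_def)
lemma clin_compose [simp]: "clin F \<Longrightarrow> clin G \<Longrightarrow> clin (F o\<^sub>L G)" by (simp add: clin_def)
lemma clin_add [simp]: "clin F \<Longrightarrow> clin G \<Longrightarrow> clin (F + G)" by (simp add: clin_def blinfun_ops)
lemma clin_diff [simp]: "clin F \<Longrightarrow> clin G \<Longrightarrow> clin (F - G)" by (simp add: clin_def blinfun_ops)
lemma clin_minus [simp]: "clin F \<Longrightarrow> clin (- F)" by (simp add: clin_def blinfun_ops)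
lemma clin_scaleC [simp]: "clin F \<Longrightarrow> clin (scaleC_blinfun c F)"
  by (simp add: clin_def blinfun_ops mult.commute)

text \<open>These functionals separate points: identities between operator-valued integrals are
  checked after applying them, where scalar complex analysis is available.\<close>

definition cinner_blinfun :: "'a::complex_inner \<Rightarrow> 'a \<Rightarrow>\<^sub>L complex" where
  "cinner_blinfun y = Blinfun (cinner y)"

lemma cinner_blinfun_apply [simp]: "cinner_blinfun y x = cinner y x"
  by (simp add: cinner_blinfun_def bounded_linear_Blinfun_apply[OF bounded_linear_cinner])

lemma clin_cinner_blinfun [simp]: "clin (cinner_blinfun y)"
  by (simp add: clin_def cinner_simps scaleC_complex_def)

lemma blinfun_eq_if_cinner_eq:
  fixes F G :: "'b::real_normed_vector \<Rightarrow>\<^sub>L 'a::complex_inner"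
  assumes "\<And>x y. cinner y (F x) = cinner y (G x)"
  shows "F = G"
  by (rule blinfun_eqI, rule eq_if_cinner_eq, rule assms)

section \<open>Invertible operators\<close>

definition inverse_pair :: "('a::complex_inner \<Rightarrow>\<^sub>L 'b::complex_inner) \<Rightarrow> ('b \<Rightarrow>\<^sub>L 'a) \<Rightarrow> bool" where
  "inverse_pair A B \<longleftrightarrow> clin A \<and> clin B \<and> A o\<^sub>L B = id_blinfun \<and> B o\<^sub>L A = id_blinfun"

definition invertible_blinfun :: "('a::complex_inner \<Rightarrow>\<^sub>L 'b::complex_inner) \<Rightarrow> bool" where
  "invertible_blinfun A \<longleftrightarrow> (\<exists>B. inverse_pair A B)"

definition inverse_blinfun :: "('a::complex_inner \<Rightarrow>\<^sub>L 'b::complex_inner) \<Rightarrow> 'b \<Rightarrow>\<^sub>L 'a" where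
  "inverse_blinfun A = (SOME B. inverse_pair A B)"

lemma inverse_pair_inverse_blinfun: "invertible_blinfun A \<Longrightarrow> inverse_pair A (inverse_blinfun A)"
  unfolding invertible_blinfun_def inverse_blinfun_def by (rule someI_ex)

lemma inverse_pair_apply:
  assumes "inverse_pair A B" shows "A (B x) = x" "B (A y) = y"
  using assms unfolding inverse_pair_def
  by (metis blinfun_apply_blinfun_compose blinfun_apply_id_blinfun id_apply)+

lemma inverse_pairI:
  assumes "clin A" "clin B" "\<And>x. A (B x) = x" "\<And>x. B (A x) = x"
  shows "inverse_pair A B"
  using assms by (auto simp: inverse_pair_def intro!: blinfun_eqI)

lemma inverse_pair_unique: "inverse_pair A B \<Longrightarrow> inverse_pair A C \<Longrightarrow> B = C"
  by (rule blinfun_eqI) (metis inverse_pair_apply)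

lemma inverse_blinfun_eqI: "inverse_pair A B \<Longrightarrow> inverse_blinfun A = B"
  using inverse_pair_inverse_blinfun inverse_pair_unique invertible_blinfun_def by blast

lemma inverse_blinfun_apply:
  assumes "invertible_blinfun A"
  shows "A (inverse_blinfun A x) = x" "inverse_blinfun A (A y) = y"
  using inverse_pair_apply[OF inverse_pair_inverse_blinfun[OF assms]] by auto

lemma clin_invertible: "invertible_blinfun A \<Longrightarrow> clin A"
  and clin_inverse_blinfun: "invertible_blinfun A \<Longrightarrow> clin (inverse_blinfun A)"
  using inverse_pair_inverse_blinfun inverse_pair_def by blast+

lemma invertible_inverse_blinfun: "invertible_blinfun A \<Longrightarrow> invertible_blinfun (inverse_blinfun A)"
  using inverse_pair_inverse_blinfun unfolding invertible_blinfun_def inverse_pair_def by blast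

lemma inverse_pair_compose:
  "inverse_pair A B \<Longrightarrow> inverse_pair C D \<Longrightarrow> inverse_pair (A o\<^sub>L C) (D o\<^sub>L B)"
  by (rule inverse_pairI) (auto simp: inverse_pair_apply inverse_pair_def[of A] inverse_pair_def[of C])

lemma invertible_compose:
  "invertible_blinfun A \<Longrightarrow> invertible_blinfun C \<Longrightarrow> invertible_blinfun (A o\<^sub>L C)"
  using inverse_pair_compose unfolding invertible_blinfun_def by blast

text \<open>The lower bound gives injectivity, and applied to preimages it bounds the inverse; an a
  priori estimate thus takes the place of the open mapping theorem.\<close>

lemma invertible_blinfun_if_bounded_below:
  fixes A :: "'a::complex_inner \<Rightarrow>\<^sub>L 'b::complex_inner"
  assumes "clin A" and surj: "\<And>y. \<exists>x. A x = y" and below: "\<And>x. norm x \<le> c * norm (A x)"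
    and "c \<ge> 0"
  shows "invertible_blinfun A" "norm (inverse_blinfun A) \<le> c"
proof -
  have inj: "x = y" if "A x = A y" for x y
    using below[of "x - y"] that by (simp add: blinfun_ops)
  define g where "g y = (SOME x. A x = y)" for y
  have Ag: "A (g y) = y" for y
    unfolding g_def by (rule someI_ex) (rule surj)
  have gA: "g (A x) = x" for x using inj Ag by blast
  have bl: "bounded_linear g"
  proof (rule bounded_linear_intro[where K=c])
    show "g (x + y) = g x + g y" for x y by (rule inj) (simp add: blinfun_ops Ag)
    show "g (r *\<^sub>R x) = r *\<^sub>R g x" for r x by (rule inj) (simp add: blinfun_ops Ag)
    show "norm (g x) \<le> norm x * c" for x using below[of "g x"] by (simp add: Ag mult.commute)
  qed
  have [simp]: "blinfun_apply (Blinfun g) = g"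
    by (rule bounded_linear_Blinfun_apply[OF bl])
  have "clin (Blinfun g)"
    unfolding clin_def using \<open>clin A\<close> by (auto intro!: inj simp: Ag clin_apply)
  then have pair: "inverse_pair A (Blinfun g)"
    using \<open>clin A\<close> by (intro inverse_pairI) (auto simp: Ag gA)
  then show "invertible_blinfun A" by (auto simp: invertible_blinfun_def)
  show "norm (inverse_blinfun A) \<le> c"
    unfolding inverse_blinfun_eqI[OF pair]
    using \<open>c \<ge> 0\<close> below[of "g x" for x] by (intro norm_blinfun_bound) (auto simp: Ag)
qed

text \<open>Solving \<open>(id_blinfun - Q) x = y\<close> means finding a fixed point of the
  contraction \<open>\<lambda>x. y + Q x\<close>; the triangle inequality supplies the lower
  bound.\<close>

lemma invertible_id_minus:
  fixes Q :: "'a::complex_hilbert \<Rightarrow>\<^sub>L 'a"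
  assumes "clin Q" "norm Q < 1"
  shows "invertible_blinfun (id_blinfun - Q)"
    and "norm (inverse_blinfun (id_blinfun - Q)) \<le> 1 / (1 - norm Q)"
proof -
  have below: "norm x \<le> 1 / (1 - norm Q) * norm ((id_blinfun - Q) x)" for x
  proof -
    have "norm x \<le> norm ((id_blinfun - Q) x) + norm (Q x)"
      using norm_triangle_ineq[of "x - Q x" "Q x"] by (simp add: blinfun_ops)
    also have "\<dots> \<le> norm ((id_blinfun - Q) x) + norm Q * norm x"
      by (simp add: norm_blinfun)
    finally show ?thesis using assms(2) by (simp add: field_simps)
  qed
  have surj: "\<exists>x. (id_blinfun - Q) x = y" for y
  proof -
    have "\<exists>!x. y + Q x = x"
    proof (rule banach_fix_type[of "norm Q"])
      show "\<forall>x z. dist (y + Q x) (y + Q z) \<le> norm Q * dist x z"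
        by (auto simp: dist_norm norm_blinfun simp flip: blinfun.diff_right)
    qed (use assms in auto)
    then obtain x where "y + Q x = x" by blast
    then show ?thesis by (intro exI[of _ x]) (simp add: blinfun_ops algebra_simps)
  qed
  show "invertible_blinfun (id_blinfun - Q)" "norm (inverse_blinfun (id_blinfun - Q)) \<le> 1 / (1 - norm Q)"
    using invertible_blinfun_if_bounded_below[OF _ surj below] assms by auto
qed

text \<open>A - E = A (1 - A^-1 E), and the second factor is within 1/2 of the identity, so its
  inverse has norm at most 2.\<close>

lemma invertible_perturb:
  fixes A :: "'a::complex_hilbert \<Rightarrow>\<^sub>L 'a"
  assumes A: "invertible_blinfun A" and E: "clin E" "norm E * norm (inverse_blinfun A) \<le> 1 / 2"
  shows "invertible_blinfun (A - E)"
    and "norm (inverse_blinfun (A - E)) \<le> 2 * norm (inverse_blinfun A)"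
proof -
  let ?B = "inverse_blinfun A"
  have n: "norm (?B o\<^sub>L E) \<le> 1 / 2"
    using norm_blinfun_compose[of ?B E] E(2) by (simp add: mult.commute)
  have c: "clin (?B o\<^sub>L E)" using clin_inverse_blinfun[OF A] E(1) by simp
  have eq: "A - E = A o\<^sub>L (id_blinfun - (?B o\<^sub>L E))"
    by (rule blinfun_eqI) (simp add: blinfun_ops inverse_blinfun_apply[OF A])
  note N = invertible_id_minus[OF c]
  have inv1: "invertible_blinfun (id_blinfun - (?B o\<^sub>L E))" using N(1) n by simp
  have le2: "norm (inverse_blinfun (id_blinfun - (?B o\<^sub>L E))) \<le> 2"
  proof -
    have "1 / (1 - norm (?B o\<^sub>L E)) \<le> 2" using n by (simp add: field_simps)
    then show ?thesis using N(2) n by linarith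
  qed
  show "invertible_blinfun (A - E)"
    unfolding eq by (rule invertible_compose[OF A inv1])
  have "inverse_blinfun (A - E) = inverse_blinfun (id_blinfun - (?B o\<^sub>L E)) o\<^sub>L ?B"
    unfolding eq
    by (intro inverse_blinfun_eqI inverse_pair_compose inverse_pair_inverse_blinfun A inv1)
  then show "norm (inverse_blinfun (A - E)) \<le> 2 * norm ?B"
    using norm_blinfun_compose[of "inverse_blinfun (id_blinfun - (?B o\<^sub>L E))" ?B]
      mult_right_mono[OF le2 norm_ge_zero[of ?B]] by simp
qed

section \<open>Linear operator pencils\<close>

text \<open>Both coefficients are kept arbitrary, because finite rank corrections and multiplication
  by a parametrix change them while the dependence on \<open>z\<close> stays affine.\<close>

definition pencil :: "('a::complex_inner \<Rightarrow>\<^sub>L 'a) \<Rightarrow> ('a \<Rightarrow>\<^sub>L 'a) \<Rightarrow> complex \<Rightarrow> 'a \<Rightarrow>\<^sub>L 'a" where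
  "pencil B T z = B - scaleC_blinfun z T"

definition regular_set :: "('a::complex_inner \<Rightarrow>\<^sub>L 'a) \<Rightarrow> ('a \<Rightarrow>\<^sub>L 'a) \<Rightarrow> complex set" where
  "regular_set B T = {z. invertible_blinfun (pencil B T z)}"

abbreviation pencil_inv :: "('a::complex_inner \<Rightarrow>\<^sub>L 'a) \<Rightarrow> ('a \<Rightarrow>\<^sub>L 'a) \<Rightarrow> complex \<Rightarrow> 'a \<Rightarrow>\<^sub>L 'a" where
  "pencil_inv B T z \<equiv> inverse_blinfun (pencil B T z)"

lemma pencil_apply: "pencil B T z x = B x - z *\<^sub>C T x"
  by (simp add: pencil_def blinfun_ops)

lemma clin_pencil [simp]: "clin B \<Longrightarrow> clin T \<Longrightarrow> clin (pencil B T z)"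
  by (simp add: pencil_def)

text \<open>The first resolvent identity in pencil form. It yields continuity once inverses are
  locally bounded, and it is an exact formula for the difference quotient.\<close>

lemma pencil_inv_diff:
  assumes "z \<in> regular_set B T" "z' \<in> regular_set B T"
  shows "pencil_inv B T z - pencil_inv B T z'
       = scaleC_blinfun (z - z') (pencil_inv B T z o\<^sub>L T o\<^sub>L pencil_inv B T z')"
proof (rule blinfun_eqI)
  fix x
  have i: "invertible_blinfun (pencil B T z)" "invertible_blinfun (pencil B T z')"
    using assms by (auto simp: regular_set_def)
  define u where "u = pencil_inv B T z' x"
  have "pencil B T z u = x - (z - z') *\<^sub>C T u"
    using inverse_blinfun_apply(1)[OF i(2), of x]
    by (simp add: pencil_apply blinfun_ops u_def algebra_simps)
  then have "u = pencil_inv B T z (x - (z - z') *\<^sub>C T u)"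
    using inverse_blinfun_apply(2)[OF i(1)] by metis
  then have "u = pencil_inv B T z x - (z - z') *\<^sub>C pencil_inv B T z (T u)"
    by (simp add: blinfun_ops clin_apply[OF clin_inverse_blinfun[OF i(1)]])
  then show "(pencil_inv B T z - pencil_inv B T z') x =
     scaleC_blinfun (z - z') (pencil_inv B T z o\<^sub>L T o\<^sub>L pencil_inv B T z') x"
    by (simp add: blinfun_ops u_def[symmetric] algebra_simps)
qed

lemma pencil_near_regular:
  fixes T :: "'a::complex_hilbert \<Rightarrow>\<^sub>L 'a"
  assumes "clin T" "z \<in> regular_set B T"
  shows "\<exists>d>0. \<forall>z'. cmod (z' - z) < d \<longrightarrow> z' \<in> regular_set B T
       \<and> norm (pencil_inv B T z') \<le> 2 * norm (pencil_inv B T z)"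
proof -
  let ?S = "pencil_inv B T z"
  \<comment> \<open>This radius makes \<open>norm ?E * norm ?S\<close> at most 1/2, as
    \<open>invertible_perturb\<close> requires; the summand 1 keeps the denominator
    positive.\<close>
  define d where "d = 1 / (2 * (norm T * norm ?S + 1))"
  have p: "2 * (norm T * norm ?S + 1) > 0"
    by (smt (verit) mult_nonneg_nonneg norm_ge_zero)
  have "d > 0" using p by (simp add: d_def)
  moreover have "z' \<in> regular_set B T \<and> norm (pencil_inv B T z') \<le> 2 * norm ?S"
    if "cmod (z' - z) < d" for z'
  proof -
    let ?E = "scaleC_blinfun (z' - z) T"
    have eq: "pencil B T z' = pencil B T z - ?E"
      by (rule blinfun_eqI) (simp add: pencil_apply blinfun_ops algebra_simps)
    have "norm ?E * norm ?S = cmod (z' - z) * (norm T * norm ?S)"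
      by (simp add: norm_scaleC_blinfun mult.assoc)
    also have "\<dots> \<le> d * (norm T * norm ?S + 1)"
      using that \<open>d > 0\<close> by (intro mult_mono) auto
    also have "\<dots> = 1 / 2"
      unfolding d_def using p by (simp add: field_simps)
    finally show ?thesis
      using invertible_perturb[of "pencil B T z" ?E] assms by (simp add: eq regular_set_def)
  qed
  ultimately show ?thesis by blast
qed

lemma open_regular_set:
  fixes T :: "'a::complex_hilbert \<Rightarrow>\<^sub>L 'a"
  assumes "clin T" shows "open (regular_set B T)"
  unfolding open_dist dist_norm using pencil_near_regular[OF assms] by blast

lemma continuous_on_pencil_inv:
  fixes T :: "'a::complex_hilbert \<Rightarrow>\<^sub>L 'a"
  assumes "clin T" shows "continuous_on (regular_set B T) (pencil_inv B T)"
proof (rule continuous_at_imp_continuous_on, rule ballI)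
  fix z assume z: "z \<in> regular_set B T"
  let ?S = "pencil_inv B T z"
  obtain d where d: "d > 0" and near: "\<And>z'. cmod (z' - z) < d \<Longrightarrow> z' \<in> regular_set B T"
      "\<And>z'. cmod (z' - z) < d \<Longrightarrow> norm (pencil_inv B T z') \<le> 2 * norm ?S"
    using pencil_near_regular[OF assms z] by blast
  have "((\<lambda>z'. pencil_inv B T z' - ?S) \<longlongrightarrow> 0) (at z)"
  proof (rule Lim_null_comparison)
    show "\<forall>\<^sub>F z' in at z. norm (pencil_inv B T z' - ?S)
        \<le> cmod (z' - z) * (2 * norm ?S * norm T * norm ?S)"
      unfolding eventually_at
    proof (intro exI conjI ballI impI)
      fix z' assume "z' \<noteq> z \<and> dist z' z < d"
      then have c: "cmod (z' - z) < d" by (simp add: dist_norm)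
      have "norm (pencil_inv B T z' o\<^sub>L T o\<^sub>L ?S) \<le> norm (pencil_inv B T z') * norm T * norm ?S"
        by (meson mult_right_mono norm_blinfun_compose norm_ge_zero order_trans)
      also have "\<dots> \<le> 2 * norm ?S * norm T * norm ?S"
        by (intro mult_right_mono near(2)[OF c]) auto
      finally show "norm (pencil_inv B T z' - ?S) \<le> cmod (z' - z) * (2 * norm ?S * norm T * norm ?S)"
        unfolding pencil_inv_diff[OF near(1)[OF c] z] norm_scaleC_blinfun
        by (intro mult_left_mono) auto
    qed (rule d)
    show "((\<lambda>z'. cmod (z' - z) * (2 * norm ?S * norm T * norm ?S)) \<longlongrightarrow> 0) (at z)"
      by (auto intro!: tendsto_eq_intros)
  qed
  then show "isCont (pencil_inv B T) z"
    by (simp add: isCont_def LIM_zero_cancel)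
qed

text \<open>By \<open>pencil_inv_diff\<close> the difference quotient is
  \<open>f (?S z' (T (?S z x)))\<close>, so continuity of the inverse already gives its
  limit.\<close>

lemma holomorphic_on_pencil_inv:
  fixes T :: "'a::complex_hilbert \<Rightarrow>\<^sub>L 'a"
  assumes "clin T" "clin f"
  shows "(\<lambda>z. (f (pencil_inv B T z x) :: complex)) holomorphic_on regular_set B T"
proof (rule holomorphic_onI)
  fix z assume z: "z \<in> regular_set B T"
  have op: "open (regular_set B T)" by (rule open_regular_set[OF assms(1)])
  let ?S = "pencil_inv B T"
  have lim: "((\<lambda>z'. f (?S z' (T (?S z x)))) \<longlongrightarrow> f (?S z (T (?S z x)))) (at z)"
  proof -
    have "(?S \<longlongrightarrow> ?S z) (at z)"
      using continuous_on_pencil_inv[OF assms(1), of B] z op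
      by (simp add: continuous_on_eq_continuous_at isCont_def)
    then show ?thesis by (intro tendsto_intros)
  qed
  have ev: "\<forall>\<^sub>F z' in at z. f (?S z' (T (?S z x))) = (f (?S z' x) - f (?S z x)) / (z' - z)"
  proof -
    have "\<forall>\<^sub>F z' in at z. z' \<in> regular_set B T"
      using op z by (rule eventually_at_in_open')
    moreover have "\<forall>\<^sub>F z' in at z. z' \<noteq> z" by (simp add: eventually_at_filter)
    ultimately show ?thesis
    proof eventually_elim
      case (elim z')
      have "?S z' x - ?S z x = (z' - z) *\<^sub>C ?S z' (T (?S z x))"
        using arg_cong[OF pencil_inv_diff[OF elim(1) z], of "\<lambda>F. F x"]
        by (simp add: blinfun_ops)
      then have "f (?S z' x) - f (?S z x) = (z' - z) * f (?S z' (T (?S z x)))"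
        by (metis blinfun.diff_right clin_apply[OF assms(2)] scaleC_complex_def)
      then show ?case using elim(2) by simp
    qed
  qed
  have "((\<lambda>z. f (?S z x)) has_field_derivative f (?S z (T (?S z x)))) (at z)"
    unfolding has_field_derivative_iff by (rule Lim_transform_eventually[OF lim ev])
  then show "(\<lambda>z. f (?S z x)) field_differentiable at z within regular_set B T"
    by (meson field_differentiable_at_within field_differentiable_def)
qed

section \<open>Finite rank, compact and Fredholm operators\<close>

definition finite_rank :: "('a::complex_inner \<Rightarrow>\<^sub>L 'b::complex_inner) \<Rightarrow> bool" where
  "finite_rank F \<longleftrightarrow> clin F \<and> (\<exists>S. finite S \<and> range (blinfun_apply F) \<subseteq> cvec.span S)"

lemma finite_rankI: "clin F \<Longrightarrow> finite S \<Longrightarrow> (\<And>x. F x \<in> cvec.span S) \<Longrightarrow> finite_rank F"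
  unfolding finite_rank_def by blast

lemma finite_rankE:
  assumes "finite_rank F"
  obtains S where "finite S" "\<And>x. F x \<in> cvec.span S"
  using assms unfolding finite_rank_def by blast

lemma clin_finite_rank: "finite_rank F \<Longrightarrow> clin F"
  by (simp add: finite_rank_def)

lemma finite_rank_zero [simp]: "finite_rank 0"
  by (rule finite_rankI[of _ "{}"]) auto

lemma finite_rank_add [simp]:
  assumes "finite_rank F" "finite_rank G" shows "finite_rank (F + G)"
proof -
  obtain S S' where "finite S" "\<And>x. F x \<in> cvec.span S" "finite S'" "\<And>x. G x \<in> cvec.span S'"
    by (metis finite_rankE assms)
  then show ?thesis
    by (intro finite_rankI[of _ "S \<union> S'"])
      (auto simp: assms clin_finite_rank blinfun_ops cvec.span_Un)
qed

lemma finite_rank_compose_left [simp]: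
  assumes "clin A" "finite_rank F" shows "finite_rank (A o\<^sub>L F)"
proof -
  obtain S where S: "finite S" "\<And>x. F x \<in> cvec.span S"
    by (metis finite_rankE assms(2))
  interpret A: Vector_Spaces.linear "scaleC" scaleC "blinfun_apply A"
    by unfold_locales (auto simp: blinfun_ops clin_apply[OF assms(1)])
  show ?thesis
    using S by (intro finite_rankI[of _ "A ` S"]) (auto simp: assms clin_finite_rank A.span_image)
qed

lemma finite_rank_compose_right [simp]:
  assumes "clin A" "finite_rank F" shows "finite_rank (F o\<^sub>L A)"
proof -
  obtain S where S: "finite S" "\<And>x. F x \<in> cvec.span S"
    by (metis finite_rankE assms(2))
  then show ?thesis
    by (intro finite_rankI[of _ S]) (auto simp: assms clin_finite_rank)
qed

lemma finite_rank_scaleC [simp]: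
  assumes "finite_rank F" shows "finite_rank (scaleC_blinfun c F)"
proof -
  have "scaleC_blinfun c F = scaleC_blinfun c id_blinfun o\<^sub>L F"
    by (rule blinfun_eqI) (simp add: blinfun_ops)
  then show ?thesis using assms by simp
qed

lemma finite_rank_minus [simp]:
  assumes "finite_rank F" shows "finite_rank (- F)"
proof -
  have "- F = scaleC_blinfun (- 1) F"
    by (rule blinfun_eqI) (simp add: blinfun_ops)
  then show ?thesis using assms by simp
qed

lemma finite_rank_diff [simp]:
  "finite_rank F \<Longrightarrow> finite_rank G \<Longrightarrow> finite_rank (F - G)"
  using finite_rank_add[of F "- G"] by simp

section \<open>Orthogonal projections onto finite-dimensional subspaces\<close>

definition orthonormal :: "nat \<Rightarrow> (nat \<Rightarrow> 'a::complex_inner) \<Rightarrow> bool" where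
  "orthonormal n e \<longleftrightarrow> (\<forall>i<n. \<forall>j<n. cinner (e i) (e j) = (if i = j then 1 else 0))"

definition onproj :: "nat \<Rightarrow> (nat \<Rightarrow> 'a::complex_inner) \<Rightarrow> 'a \<Rightarrow> 'a" where
  "onproj n e x = (\<Sum>i<n. cinner (e i) x *\<^sub>C e i)"

lemma cinner_sum_right: "cinner x (\<Sum>i\<in>I. f i) = (\<Sum>i\<in>I. cinner x (f i :: 'a::complex_inner))"
  by (induction I rule: infinite_finite_induct) (auto simp: cinner_simps)

lemma onproj_add: "onproj n e (x + y) = onproj n e x + onproj n e y"
  by (simp add: onproj_def cinner_simps scaleC_add_left sum.distrib)

lemma onproj_scaleC: "onproj n e (c *\<^sub>C x) = c *\<^sub>C onproj n e x"
  by (simp add: onproj_def cinner_simps cvec.scale_sum_right scaleC_scaleC)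

lemma onproj_diff: "onproj n e (x - y) = onproj n e x - onproj n e y"
  using onproj_add[of n e "x - y" y] by simp

lemma cinner_onproj:
  assumes "orthonormal n e" "j < n" shows "cinner (e j) (onproj n e x) = cinner (e j) x"
proof -
  have "cinner (e j) (onproj n e x) = (\<Sum>i<n. if i = j then cinner (e j) x else 0)"
    unfolding onproj_def cinner_sum_right
    by (rule sum.cong) (use assms in \<open>auto simp: orthonormal_def cinner_simps\<close>)
  then show ?thesis using assms(2) by simp
qed

lemma norm_onproj_le:
  assumes "orthonormal n e" shows "norm (onproj n e x) \<le> norm x"
proof -
  let ?p = "onproj n e x"
  have "cinner x ?p = cinner ?p ?p"
  proof -
    have "cinner y ?p = (\<Sum>i<n. cinner (e i) x * cinner y (e i))" for y
      by (simp add: onproj_def cinner_sum_right cinner_simps)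
    moreover have "cinner x (e i) = cinner ?p (e i)" if "i < n" for i
      using cinner_onproj[OF assms that] cinner_commute by metis
    ultimately show ?thesis by simp
  qed
  then have "(norm ?p)\<^sup>2 \<le> norm x * norm ?p"
    using cinner_Cauchy_Schwarz[of x ?p] by (simp add: cinner_self norm_power)
  then show ?thesis
    by (cases "?p = 0") (auto simp: power2_eq_square)
qed

text \<open>Gram-Schmidt; that the system spans at least \<open>S\<close> is expressed by the
  projection fixing every vector of the span.\<close>

lemma ex_orthonormal_basis:
  fixes S :: "'a::complex_inner set"
  assumes "finite S"
  shows "\<exists>n e. orthonormal n e \<and> (\<forall>x\<in>cvec.span S. onproj n e x = x)"
  using assms
proof (induction S)
  case empty
  show ?case by (rule exI[of _ 0]) (auto simp: orthonormal_def onproj_def)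
next
  case (insert v S)
  then obtain n e where on: "orthonormal n e" and fixed: "\<And>x. x \<in> cvec.span S \<Longrightarrow> onproj n e x = x"
    by blast
  \<comment> \<open>The component of \<open>v\<close> orthogonal to the current system: if it
    vanishes the old system serves, otherwise it is normalised and appended.\<close>
  define v' where "v' = v - onproj n e v"
  have red: ?case if "orthonormal m f" "onproj m f v = v"
      "\<And>x. x \<in> cvec.span S \<Longrightarrow> onproj m f x = x" for m f
  proof (intro exI conjI ballI)
    fix x assume "x \<in> cvec.span (insert v S)"
    then obtain k where "x - k *\<^sub>C v \<in> cvec.span S"
      unfolding cvec.span_breakdown_eq by blast
    from that(3)[OF this] show "onproj m f x = x"
      by (simp add: onproj_diff onproj_scaleC that(2))
  qed (rule that)
  show ?case
  proof (cases "v' = 0")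
    case True
    then show ?thesis using on fixed by (intro red[of n e]) (auto simp: v'_def)
  next
    case False
    let ?u = "complex_of_real (1 / norm v') *\<^sub>C v'"
    define f where "f = e(n := ?u)"
    have fe: "f i = e i" if "i < n" for i using that by (simp add: f_def)
    have orth: "cinner (e i) v' = 0" if "i < n" for i
      by (simp add: v'_def cinner_simps cinner_onproj[OF on that])
    have f_onproj: "onproj n f x = onproj n e x" for x
      by (simp add: onproj_def fe)
    have eu: "cinner (e i) ?u = 0" "cinner ?u (e i) = 0" if "i < n" for i
      using orth[OF that] cinner_commute[of v' "e i"] by (simp_all add: cinner_simps)
    have "norm ?u = 1"
      using False by (simp add: norm_scaleC norm_divide)
    then have uu: "cinner ?u ?u = 1"
      by (simp only: cinner_self) simp
    have onf: "orthonormal (Suc n) f"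
      using on eu uu by (auto simp: orthonormal_def f_def less_Suc_eq)
    have u0: "cinner ?u (onproj n e x) = 0" for x
      unfolding onproj_def cinner_sum_right using eu
      by (auto intro!: sum.neutral simp: cinner_scaleC_right)
    have step: "onproj (Suc n) f x = onproj n e x + cinner ?u x *\<^sub>C ?u" for x
      using f_onproj[of x] by (simp add: onproj_def f_def)
    have "cinner ?u v = cinner ?u v'"
      using u0[of v] by (simp add: v'_def cinner_diff_right)
    also have "\<dots> = complex_of_real (norm v')"
      using False by (simp add: cinner_simps cinner_self power2_eq_square)
    finally have "cinner ?u v *\<^sub>C ?u = v'"
      using False by (simp add: scaleC_scaleC scaleC_one flip: of_real_mult)
    then have "onproj (Suc n) f v = v"
      by (simp add: step v'_def)
    moreover have "onproj (Suc n) f x = x" if "x \<in> cvec.span S" for x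
      using u0[of x] by (simp add: step fixed[OF that])
    ultimately show ?thesis using onf by (intro red)
  qed
qed

text \<open>Coordinates in an orthonormal system whose span contains the range: the functionals are
  \<open>x \<mapsto> cinner (e i) (F x)\<close>.\<close>

lemma finite_rank_decomp:
  fixes F :: "'a::complex_inner \<Rightarrow>\<^sub>L 'b::complex_inner"
  assumes "finite_rank F"
  obtains n :: nat and f u where "\<And>i. clin (f i :: 'a \<Rightarrow>\<^sub>L complex)" "\<And>x. F x = (\<Sum>i<n. f i x *\<^sub>C u i)"
proof -
  obtain S where S: "finite S" "\<And>x. F x \<in> cvec.span S"
    by (metis finite_rankE assms)
  from ex_orthonormal_basis[OF S(1)] obtain n and e :: "nat \<Rightarrow> 'b" where
    e: "\<And>x. onproj n e (F x) = F x"
    using S(2) by blast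
  show thesis
  proof (rule that[of "\<lambda>i. cinner_blinfun (e i) o\<^sub>L F"])
    show "F x = (\<Sum>i<n. (cinner_blinfun (e i) o\<^sub>L F) x *\<^sub>C e i)" for x
      using e[of x] by (simp add: onproj_def)
  qed (simp add: clin_finite_rank assms)
qed

text \<open>Norm limits of finite rank operators: on Hilbert spaces these are the compact operators.\<close>

definition approx_finite_rank :: "('a::complex_inner \<Rightarrow>\<^sub>L 'b::complex_inner) \<Rightarrow> bool" where
  "approx_finite_rank K \<longleftrightarrow> clin K \<and> (\<forall>\<epsilon>>0. \<exists>F. finite_rank F \<and> norm (K - F) < \<epsilon>)"

lemma clin_approx_finite_rank: "approx_finite_rank K \<Longrightarrow> clin K"
  by (simp add: approx_finite_rank_def)

lemma approx_finite_rank_if_finite_rank: "finite_rank F \<Longrightarrow> approx_finite_rank F"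
  unfolding approx_finite_rank_def by (auto simp: clin_finite_rank intro!: exI[of _ F])

lemma approx_finite_rank_add:
  assumes "approx_finite_rank K" "approx_finite_rank K'" shows "approx_finite_rank (K + K')"
  unfolding approx_finite_rank_def
proof (intro conjI allI impI)
  fix \<epsilon> :: real assume "\<epsilon> > 0"
  then have "\<epsilon> / 2 > 0" by simp
  then obtain F F' where F: "finite_rank F" "norm (K - F) < \<epsilon> / 2" "finite_rank F'" "norm (K' - F') < \<epsilon> / 2"
    using assms unfolding approx_finite_rank_def by metis
  have "norm (K + K' - (F + F')) \<le> norm (K - F) + norm (K' - F')"
    by (metis add_diff_add norm_triangle_ineq)
  then have "norm (K + K' - (F + F')) < \<epsilon>" using F by linarith
  then show "\<exists>F. finite_rank F \<and> norm (K + K' - F) < \<epsilon>"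
    using F finite_rank_add by blast
qed (simp add: assms clin_approx_finite_rank)

lemma approx_finite_rank_compose_left:
  assumes "clin A" "approx_finite_rank K" shows "approx_finite_rank (A o\<^sub>L K)"
  unfolding approx_finite_rank_def
proof (intro conjI allI impI)
  fix \<epsilon> :: real assume "\<epsilon> > 0"
  then have "\<epsilon> / (norm A + 1) > 0" by (simp add: add_nonneg_pos)
  then obtain F where F: "finite_rank F" "norm (K - F) < \<epsilon> / (norm A + 1)"
    using assms unfolding approx_finite_rank_def by metis
  have "norm ((A o\<^sub>L K) - (A o\<^sub>L F)) = norm (A o\<^sub>L (K - F))"
    by (rule arg_cong[of _ _ norm], rule blinfun_eqI) (simp add: blinfun_ops)
  also have "\<dots> \<le> norm A * norm (K - F)" by (rule norm_blinfun_compose)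
  also have "\<dots> \<le> (norm A + 1) * norm (K - F)" by (simp add: mult_right_mono)
  also have "\<dots> < \<epsilon>"
    using F(2) by (simp add: pos_less_divide_eq add_nonneg_pos mult.commute)
  finally show "\<exists>F. finite_rank F \<and> norm ((A o\<^sub>L K) - F) < \<epsilon>"
    using F(1) assms(1) finite_rank_compose_left by blast
qed (simp add: assms clin_approx_finite_rank)

lemma approx_finite_rank_minus:
  assumes "approx_finite_rank K" shows "approx_finite_rank (- K)"
proof -
  have "- K = scaleC_blinfun (- 1) id_blinfun o\<^sub>L K"
    by (rule blinfun_eqI) (simp add: blinfun_ops)
  then show ?thesis using approx_finite_rank_compose_left[OF clin_scaleC[OF clin_id] assms] by simp
qed

lemma approx_finite_rank_limit:
  assumes "\<And>n. approx_finite_rank (K n)" "K \<longlonglongrightarrow> K'"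
  shows "approx_finite_rank K'"
  unfolding approx_finite_rank_def
proof (intro conjI allI impI)
  show "clin K'"
    unfolding clin_def
  proof (intro allI)
    fix c x
    have "(\<lambda>n. K n (c *\<^sub>C x)) \<longlonglongrightarrow> K' (c *\<^sub>C x)"
      by (intro tendsto_intros assms)
    moreover have "(\<lambda>n. c *\<^sub>C K n x) \<longlonglongrightarrow> c *\<^sub>C K' x"
      by (intro bounded_linear.tendsto[OF bounded_linear_scaleC] tendsto_intros assms)
    moreover have "K n (c *\<^sub>C x) = c *\<^sub>C K n x" for n
      by (rule clin_apply) (rule clin_approx_finite_rank[OF assms(1)])
    ultimately show "K' (c *\<^sub>C x) = c *\<^sub>C K' x"
      using LIMSEQ_unique by simp
  qed
next
  fix \<epsilon> :: real assume \<epsilon>: "\<epsilon> > 0"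
  obtain n where n: "norm (K n - K') < \<epsilon> / 2"
    using assms(2) \<epsilon> unfolding LIMSEQ_iff by (meson half_gt_zero order_refl)
  obtain F where F: "finite_rank F" "norm (K n - F) < \<epsilon> / 2"
    using assms(1)[of n] \<epsilon> unfolding approx_finite_rank_def by (meson half_gt_zero)
  have "norm (K' - F) \<le> norm (K n - K') + norm (K n - F)"
    by (metis norm_minus_commute norm_triangle_ineq diff_add_cancel add_diff_eq)
  then show "\<exists>F. finite_rank F \<and> norm (K' - F) < \<epsilon>"
    using F n by (intro exI[of _ F]) auto
qed

text \<open>Project onto the span of a finite net of the image of the unit ball. Orthogonal
  projections have norm at most 1, so each image point is moved by at most twice the mesh.\<close>

lemma approx_finite_rank_if_compact:
  fixes K :: "'a::complex_inner \<Rightarrow>\<^sub>L 'b::complex_inner"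
  assumes "clin K" "compact (closure (K ` cball 0 1))"
  shows "approx_finite_rank K"
  unfolding approx_finite_rank_def
proof (intro conjI allI impI)
  fix \<epsilon> :: real assume "\<epsilon> > 0"
  define d where "d = \<epsilon> / 4"
  have d: "d > 0" using \<open>\<epsilon> > 0\<close> by (simp add: d_def)
  obtain S where S: "finite S" "closure (K ` cball 0 1) \<subseteq> (\<Union>x\<in>S. ball x d)"
    using assms(2) d unfolding compact_eq_totally_bounded by meson
  obtain n and e :: "nat \<Rightarrow> 'b" where on: "orthonormal n e"
    and fixed: "\<And>x. x \<in> cvec.span S \<Longrightarrow> onproj n e x = x"
    using ex_orthonormal_basis[OF S(1)] by blast
  have bl: "bounded_linear (onproj n e)"
    by (rule bounded_linear_intro[where K=1])
      (auto simp: onproj_add scaleR_scaleC onproj_scaleC norm_onproj_le[OF on])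
  define P where "P = Blinfun (onproj n e)"
  have P: "P x = onproj n e x" for x
    by (simp add: P_def bounded_linear_Blinfun_apply[OF bl])
  have "finite_rank P"
  proof (rule finite_rankI)
    show "clin P" by (simp add: clin_def P onproj_scaleC)
    show "finite (e ` {..<n})" by simp
    show "P x \<in> cvec.span (e ` {..<n})" for x
      unfolding P onproj_def
      by (intro cvec.span_sum cvec.span_scale cvec.span_base) auto
  qed
  have *: "norm (K x - P (K x)) \<le> 2 * d" if "norm x \<le> 1" for x
  proof -
    have "K x \<in> closure (K ` cball 0 1)"
      using that closure_subset by fastforce
    then obtain s where s: "s \<in> S" "norm (K x - s) < d"
      using S(2) by (auto simp: dist_norm norm_minus_commute)
    have "K x - P (K x) = (K x - s) - onproj n e (K x - s)"
      using fixed[OF cvec.span_base[OF s(1)]] by (simp add: P onproj_diff)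
    also have "norm \<dots> \<le> norm (K x - s) + norm (K x - s)"
      using norm_triangle_ineq4 norm_onproj_le[OF on, of "K x - s"] by (smt (verit))
    finally show ?thesis using s(2) by simp
  qed
  have "norm (K - (P o\<^sub>L K)) \<le> 2 * d"
  proof (rule norm_blinfun_bound)
    fix x
    show "norm ((K - (P o\<^sub>L K)) x) \<le> 2 * d * norm x"
    proof (cases "x = 0")
      case False
      define y where "y = (1 / norm x) *\<^sub>R x"
      have x: "x = norm x *\<^sub>R y" "norm y = 1" using False by (auto simp: y_def)
      have "norm ((K - (P o\<^sub>L K)) x) = norm x * norm (K y - P (K y))"
        by (subst x(1)) (simp add: blinfun_ops flip: scaleR_diff_right)
      also have "\<dots> \<le> norm x * (2 * d)"
        using *[of y] x(2) by (intro mult_left_mono) auto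
      finally show ?thesis by (simp add: mult_ac)
    qed simp
  qed (use d in simp)
  also have "\<dots> < \<epsilon>" using \<open>\<epsilon> > 0\<close> by (simp add: d_def)
  finally show "\<exists>F. finite_rank F \<and> norm (K - F) < \<epsilon>"
    using \<open>finite_rank P\<close> assms(1) finite_rank_compose_right by blast
qed (rule assms)

section \<open>Parametrices and the Fredholm property\<close>

definition parametrix :: "('a::complex_inner \<Rightarrow>\<^sub>L 'a) \<Rightarrow> ('a \<Rightarrow>\<^sub>L 'a) \<Rightarrow> bool" where
  "parametrix A Y \<longleftrightarrow> clin A \<and> clin Y
     \<and> finite_rank ((A o\<^sub>L Y) - id_blinfun) \<and> finite_rank ((Y o\<^sub>L A) - id_blinfun)"

text \<open>Finite rank errors are the form that leads to finite matrices. No index is recorded;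
  index zero is obtained later from nearby regular points.\<close>

definition fredholm :: "('a::complex_inner \<Rightarrow>\<^sub>L 'a) \<Rightarrow> bool" where
  "fredholm A \<longleftrightarrow> (\<exists>Y. parametrix A Y)"

lemma parametrixI:
  assumes "clin A" "clin Y" "finite_rank Q" "finite_rank Q'"
    "\<And>x. A (Y x) = x + Q x" "\<And>x. Y (A x) = x + Q' x"
  shows "parametrix A Y"
proof -
  have "(A o\<^sub>L Y) - id_blinfun = Q" "(Y o\<^sub>L A) - id_blinfun = Q'"
    by (auto intro!: blinfun_eqI simp: blinfun_ops assms)
  then show ?thesis using assms by (simp add: parametrix_def)
qed

lemma parametrixE:
  assumes "parametrix A Y"
  obtains Q Q' where "clin A" "clin Y" "finite_rank Q" "finite_rank Q'"
    "\<And>x. A (Y x) = x + Q x" "\<And>x. Y (A x) = x + Q' x"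
  using assms that[of "(A o\<^sub>L Y) - id_blinfun" "(Y o\<^sub>L A) - id_blinfun"]
  by (simp add: parametrix_def blinfun_ops)

lemma fredholm_if_invertible: "invertible_blinfun A \<Longrightarrow> fredholm A"
  unfolding fredholm_def
  by (rule exI[of _ "inverse_blinfun A"], rule parametrixI[of _ _ 0 0])
    (auto simp: clin_invertible clin_inverse_blinfun inverse_blinfun_apply)

lemma parametrix_compose:
  assumes "parametrix A Y" "parametrix B Z"
  shows "parametrix (A o\<^sub>L B) (Z o\<^sub>L Y)"
proof -
  obtain Q Q' where Q: "clin A" "clin Y" "finite_rank Q" "finite_rank Q'"
    "\<And>x. A (Y x) = x + Q x" "\<And>x. Y (A x) = x + Q' x"
    using parametrixE[OF assms(1)] by metis
  obtain R R' where R: "clin B" "clin Z" "finite_rank R" "finite_rank R'"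
    "\<And>x. B (Z x) = x + R x" "\<And>x. Z (B x) = x + R' x"
    using parametrixE[OF assms(2)] by metis
  show ?thesis
    by (rule parametrixI[of _ _ "Q + (A o\<^sub>L R o\<^sub>L Y)" "R' + (Z o\<^sub>L Q' o\<^sub>L B)"])
      (auto simp: Q R blinfun_ops)
qed

lemma fredholm_compose: "fredholm A \<Longrightarrow> fredholm B \<Longrightarrow> fredholm (A o\<^sub>L B)"
  unfolding fredholm_def using parametrix_compose by blast

lemma fredholm_add_finite_rank:
  assumes "fredholm A" "finite_rank E" shows "fredholm (A + E)"
proof -
  obtain Y Q Q' where Q: "clin A" "clin Y" "finite_rank Q" "finite_rank Q'"
    "\<And>x. A (Y x) = x + Q x" "\<And>x. Y (A x) = x + Q' x"
    using assms(1) parametrixE unfolding fredholm_def by metis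
  have "parametrix (A + E) Y"
    by (rule parametrixI[of _ _ "Q + (E o\<^sub>L Y)" "Q' + (Y o\<^sub>L E)"])
      (auto simp: Q assms(2) blinfun_ops clin_finite_rank)
  then show ?thesis unfolding fredholm_def by blast
qed

text \<open>With a finite rank \<open>F\<close> at distance less than 1 from \<open>K\<close>, 1 + K
  = (1 - (F - K)) + F is an invertible operator plus one of finite rank.\<close>

lemma fredholm_id_plus_approx_finite_rank:
  fixes K :: "'a::complex_hilbert \<Rightarrow>\<^sub>L 'a"
  assumes "approx_finite_rank K" shows "fredholm (id_blinfun + K)"
proof -
  have "(0::real) < 1" by simp
  then obtain F where F: "finite_rank F" "norm (K - F) < 1"
    using assms unfolding approx_finite_rank_def by blast
  have "invertible_blinfun (id_blinfun - (F - K))"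
    using F clin_approx_finite_rank[OF assms]
    by (intro invertible_id_minus(1)) (auto simp: clin_finite_rank norm_minus_commute)
  then have "fredholm ((id_blinfun - (F - K)) + F)"
    using F(1) fredholm_if_invertible fredholm_add_finite_rank by blast
  then show ?thesis by (simp add: algebra_simps)
qed

text \<open>The parametrix 1 - X Z Y imitates the identity (1 + X Y)^-1 = 1 - X (1 + Y X)^-1 Y. This
  moves the Fredholm question from one Hilbert space to the other.\<close>

lemma fredholm_swap:
  fixes X :: "'b::complex_inner \<Rightarrow>\<^sub>L 'a::complex_inner" and Y :: "'a \<Rightarrow>\<^sub>L 'b"
  assumes "clin X" "clin Y" "fredholm (id_blinfun + (Y o\<^sub>L X))"
  shows "fredholm (id_blinfun + (X o\<^sub>L Y))"
proof -
  obtain Z Q Q' where Q: "clin Z" "finite_rank Q" "finite_rank Q'"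
    "\<And>x. (id_blinfun + (Y o\<^sub>L X)) (Z x) = x + Q x" "\<And>x. Z ((id_blinfun + (Y o\<^sub>L X)) x) = x + Q' x"
    using assms(3) parametrixE unfolding fredholm_def by metis
  have YXZ: "Y (X (Z x)) = x + Q x - Z x" for x
    using Q(4)[of x] by (simp add: blinfun_ops algebra_simps)
  have ZYX: "Z (Y (X x)) = x + Q' x - Z x" for x
    using Q(5)[of x] by (simp add: blinfun_ops algebra_simps)
  have "parametrix (id_blinfun + (X o\<^sub>L Y)) (id_blinfun - (X o\<^sub>L Z o\<^sub>L Y))"
    by (rule parametrixI[of _ _ "- (X o\<^sub>L Q o\<^sub>L Y)" "- (X o\<^sub>L Q' o\<^sub>L Y)"])
      (auto simp: Q(1-3) assms(1,2) blinfun_ops YXZ ZYX)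
  then show ?thesis unfolding fredholm_def by blast
qed

primrec blinfun_pow :: "('a::real_normed_vector \<Rightarrow>\<^sub>L 'a) \<Rightarrow> nat \<Rightarrow> 'a \<Rightarrow>\<^sub>L 'a" where
  "blinfun_pow A 0 = id_blinfun"
| "blinfun_pow A (Suc n) = A o\<^sub>L blinfun_pow A n"

lemma clin_blinfun_pow [simp]: "clin A \<Longrightarrow> clin (blinfun_pow A n)"
  by (induction n) auto

lemma invertible_id: "invertible_blinfun id_blinfun"
  unfolding invertible_blinfun_def by (rule exI[of _ id_blinfun]) (auto intro: inverse_pairI)

lemma fredholm_blinfun_pow: "fredholm A \<Longrightarrow> fredholm (blinfun_pow A n)"
  by (induction n) (auto intro: fredholm_compose fredholm_if_invertible invertible_id)

text \<open>On the kernel, \<open>Y (A x) = x + Q' x\<close> reads \<open>x = - Q' x\<close>, so the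
  kernel lies in the range of a finite rank operator.\<close>

lemma fredholm_kernel_finite:
  assumes "fredholm A"
  shows "\<exists>S. finite S \<and> {x. A x = 0} \<subseteq> cvec.span S"
proof -
  obtain Y Q' where "clin Y" and Q: "finite_rank Q'" "\<And>x. Y (A x) = x + Q' x"
    using assms parametrixE unfolding fredholm_def by metis
  obtain S where S: "finite S" "\<And>x. Q' x \<in> cvec.span S"
    using Q(1) finite_rankE by metis
  have "x \<in> cvec.span S" if "A x = 0" for x
  proof -
    have "x = - Q' x" using Q(2)[of x] that by (simp add: eq_neg_iff_add_eq_0)
    then show ?thesis using S(2) cvec.span_neg by metis
  qed
  then show ?thesis using S(1) by blast
qed

text \<open>Multiplication by the fixed \<open>Y\<close> gives a pencil that is the identity at
  \<open>z0\<close>, up to an error \<open>Q\<close> independent of \<open>z\<close>. If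
  \<open>Q\<close> has finite rank, \<open>Y\<close> times the inverse of the new pencil is
  therefore a right inverse modulo finite rank for all \<open>z\<close> near \<open>z0\<close>, and
  it varies continuously.\<close>

lemma pencil_parametrix_near:
  fixes T Y :: "'a::complex_hilbert \<Rightarrow>\<^sub>L 'a"
  assumes "clin T" "clin Y" and Q: "\<And>x. pencil B T z0 (Y x) = x + Q x"
  defines "C \<equiv> id_blinfun + scaleC_blinfun z0 (T o\<^sub>L Y)"
  shows "pencil C (T o\<^sub>L Y) z0 = id_blinfun" "z0 \<in> regular_set C (T o\<^sub>L Y)"
    "pencil B T z (Y x) = pencil C (T o\<^sub>L Y) z x + Q x"
proof -
  show id: "pencil C (T o\<^sub>L Y) z0 = id_blinfun"
    by (rule blinfun_eqI) (simp add: C_def pencil_apply blinfun_ops)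
  show "z0 \<in> regular_set C (T o\<^sub>L Y)"
    by (simp add: regular_set_def id invertible_id)
  have "pencil B T z (Y x) = pencil B T z0 (Y x) + (z0 - z) *\<^sub>C T (Y x)"
    by (simp add: pencil_apply blinfun_ops)
  then show "pencil B T z (Y x) = pencil C (T o\<^sub>L Y) z x + Q x"
    unfolding Q by (simp add: C_def pencil_apply blinfun_ops)
qed

text \<open>
  A Fredholm point that is approached by regular points has index zero: there the pencil is an
  invertible operator up to a finite rank correction.
\<close>

lemma fredholm_pencil_finite_rank_correction:
  fixes T B :: "'a::complex_hilbert \<Rightarrow>\<^sub>L 'a"
  assumes "clin T" "clin B" "fredholm (pencil B T z0)" "z0 \<in> closure (regular_set B T)"
  obtains E where "finite_rank E" "z0 \<in> regular_set (B - E) T"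
proof -
  obtain Y Q Q' where Q: "clin Y" "finite_rank Q" "\<And>x. pencil B T z0 (Y x) = x + Q x"
    using assms(3) parametrixE unfolding fredholm_def by metis
  define C where "C = id_blinfun + scaleC_blinfun z0 (T o\<^sub>L Y)"
  note near = pencil_parametrix_near[OF assms(1) Q(1) Q(3), folded C_def]
  have "open (regular_set C (T o\<^sub>L Y))" using assms(1) Q(1) by (intro open_regular_set) auto
  then obtain z where z: "z \<in> regular_set C (T o\<^sub>L Y)" "z \<in> regular_set B T"
    using assms(4) near(2) unfolding closure_iff_nhds_not_empty by (meson disjoint_iff open_subset order_refl)
  let ?Az = "pencil B T z0" and ?A = "pencil B T z" and ?V = "pencil C (T o\<^sub>L Y) z"
  let ?S = "inverse_blinfun ?A"
  have A: "invertible_blinfun ?A" "invertible_blinfun ?V" using z by (auto simp: regular_set_def)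
  \<comment> \<open>An invertible operator that differs from \<open>Y\<close> by finite rank: at
    \<open>z\<close> the pencil times \<open>Y\<close> is \<open>?V + Q\<close>, so that
    \<open>W = Y - ?S Q\<close>.\<close>
  define W where "W = ?S o\<^sub>L ?V"
  have W: "invertible_blinfun W"
    unfolding W_def by (intro invertible_compose invertible_inverse_blinfun A)
  define W' where "W' = inverse_blinfun W"
  have WW: "W (W' x) = x" for x
    unfolding W'_def by (rule inverse_blinfun_apply(1)[OF W])
  have cS: "clin ?S" and cW': "clin W'"
    unfolding W'_def using W A by (auto intro: clin_inverse_blinfun)
  \<comment> \<open>Chosen so that \<open>?Az W = 1 + E W\<close>; then \<open>?Az - E\<close> is
    the inverse \<open>W'\<close> of \<open>W\<close>.\<close>
  define E where "E = (Q - (?Az o\<^sub>L ?S o\<^sub>L Q)) o\<^sub>L W'"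
  have "finite_rank E"
    unfolding E_def using cW' cS assms Q by (intro finite_rank_compose_right) auto
  moreover have "pencil (B - E) T z0 = W'"
  proof (rule blinfun_eqI)
    fix x
    have Wy: "W y = Y y - ?S (Q y)" for y
    proof -
      have "Y y = ?S (?A (Y y))" by (simp add: inverse_blinfun_apply[OF A(1)])
      then show ?thesis unfolding near(3) by (simp add: W_def blinfun_ops)
    qed
    have "?Az x = ?Az (W (W' x))" by (simp add: WW)
    also have "\<dots> = W' x + E x"
      by (simp add: Wy E_def blinfun_ops Q(3))
    finally show "pencil (B - E) T z0 x = W' x"
      by (simp add: pencil_apply blinfun_ops diff_diff_eq2 algebra_simps)
  qed
  moreover have "invertible_blinfun W'"
    unfolding W'_def by (rule invertible_inverse_blinfun[OF W])
  ultimately show thesis using that by (simp add: regular_set_def)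
qed

text \<open>If \<open>T\<close> is the resolvent of X at \<open>z1\<close>, then 1 + z1 T - z T is
  (X - z) T, a bounded operator that carries the spectral information of the unbounded X at every
  z.\<close>

definition resolvent_pencil_base :: "('a::complex_inner \<Rightarrow>\<^sub>L 'a) \<Rightarrow> complex \<Rightarrow> 'a \<Rightarrow>\<^sub>L 'a" where
  "resolvent_pencil_base T z1 = id_blinfun + scaleC_blinfun z1 T"

abbreviation rpencil :: "('a::complex_inner \<Rightarrow>\<^sub>L 'a) \<Rightarrow> complex \<Rightarrow> complex \<Rightarrow> 'a \<Rightarrow>\<^sub>L 'a" where
  "rpencil T z1 z \<equiv> pencil (resolvent_pencil_base T z1) T z"

abbreviation rset :: "('a::complex_inner \<Rightarrow>\<^sub>L 'a) \<Rightarrow> complex \<Rightarrow> complex set" where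
  "rset T z1 \<equiv> regular_set (resolvent_pencil_base T z1) T"

lemma rpencil_apply: "rpencil T z1 z x = x - (z - z1) *\<^sub>C T x"
  by (simp add: resolvent_pencil_base_def pencil_apply blinfun_ops)

lemma clin_resolvent_pencil_base [simp]: "clin T \<Longrightarrow> clin (resolvent_pencil_base T z1)"
  by (simp add: resolvent_pencil_base_def)

text \<open>Modulo finite rank, the pencil of \<open>T\<close> at \<open>z0\<close> is the pencil of
  \<open>T0\<close> times 1 + X L^-1 F, where X = (z0 - z1) Y G and \<open>Y\<close> is a parametrix
  at \<open>z0\<close>. Swapping factors leads to 1 + L^-1 F X = L^-1 (1 + N z0), which is Fredholm
  once \<open>N z0\<close> is a norm limit of finite rank operators.\<close>

lemma fredholm_transfer:
  fixes T0 :: "'h::complex_hilbert \<Rightarrow>\<^sub>L 'h" and L :: "'k::complex_hilbert \<Rightarrow>\<^sub>L 'k"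
    and F :: "'h \<Rightarrow>\<^sub>L 'k" and G :: "'k \<Rightarrow>\<^sub>L 'h"
  assumes clin: "clin T0" "clin F" "clin G" and L: "invertible_blinfun L"
    and T: "T = T0 - (G o\<^sub>L inverse_blinfun L o\<^sub>L F)"
    and fred: "fredholm (rpencil T0 z1 z0)"
    and z0: "z0 \<in> closure V" and V: "V \<subseteq> rset T0 z1"
    and M: "\<And>z. z \<in> V \<Longrightarrow> approx_finite_rank
        (L + scaleC_blinfun (z - z1) (F o\<^sub>L inverse_blinfun (rpencil T0 z1 z) o\<^sub>L G) - id_blinfun)"
  shows "fredholm (rpencil T z1 z0)"
proof -
  let ?A = "rpencil T0 z1" and ?L' = "inverse_blinfun L"
  obtain Y Q Q' where Q: "clin Y" "finite_rank Q" "\<And>x. ?A z0 (Y x) = x + Q x"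
    using fred parametrixE unfolding fredholm_def by metis
  define C where "C = id_blinfun + scaleC_blinfun z0 (T0 o\<^sub>L Y)"
  note near = pencil_parametrix_near[OF clin(1) Q(1) Q(3), folded C_def]
  have cTY: "clin (T0 o\<^sub>L Y)" using clin Q by simp
  have op: "open (regular_set C (T0 o\<^sub>L Y))" by (rule open_regular_set[OF cTY])
  then have "z0 \<in> closure (regular_set C (T0 o\<^sub>L Y) \<inter> V)"
    using open_Int_closure_subset[OF op, of V] near(2) z0 by blast
  then obtain s where s: "\<And>n. s n \<in> regular_set C (T0 o\<^sub>L Y)" "\<And>n. s n \<in> V" "s \<longlonglongrightarrow> z0"
    unfolding closure_sequential by blast
  \<comment> \<open>The operator of assumption \<open>M\<close> with the inverse pencil replaced by
    \<open>Y\<close> times \<open>pencil_inv C (T0 o\<^sub>L Y) z\<close>. The replacement is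
    continuous at \<open>z0\<close>; where both are defined, they differ by finite rank.\<close>
  define N where "N z = L + scaleC_blinfun (z - z1) (F o\<^sub>L Y o\<^sub>L pencil_inv C (T0 o\<^sub>L Y) z o\<^sub>L G) - id_blinfun"
    for z
  have "approx_finite_rank (N (s n))" for n
  proof -
    let ?z = "s n" and ?V = "pencil C (T0 o\<^sub>L Y) (s n)"
    let ?S = "inverse_blinfun (?A ?z)" and ?W = "inverse_blinfun ?V"
    have A: "invertible_blinfun (?A ?z)" "invertible_blinfun ?V"
      using s V by (auto simp: regular_set_def)
    have S: "Y (?W x) = ?S x + ?S (Q (?W x))" for x
    proof -
      have "?A ?z (Y (?W x)) = x + Q (?W x)"
        using near(3) inverse_blinfun_apply(1)[OF A(2)] by metis
      then have "Y (?W x) = ?S (x + Q (?W x))"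
        using inverse_blinfun_apply(2)[OF A(1)] by metis
      then show ?thesis by (simp add: blinfun_ops)
    qed
    have "N ?z = (L + scaleC_blinfun (?z - z1) (F o\<^sub>L ?S o\<^sub>L G) - id_blinfun)
        + scaleC_blinfun (?z - z1) (F o\<^sub>L ?S o\<^sub>L Q o\<^sub>L ?W o\<^sub>L G)"
      by (rule blinfun_eqI) (simp add: N_def blinfun_ops S)
    moreover have "finite_rank (scaleC_blinfun (?z - z1) (F o\<^sub>L ?S o\<^sub>L Q o\<^sub>L ?W o\<^sub>L G))"
      using clin Q clin_inverse_blinfun[OF A(1)] clin_inverse_blinfun[OF A(2)] by simp
    ultimately show ?thesis
      using M[OF s(2)[of n]] by (simp add: approx_finite_rank_add approx_finite_rank_if_finite_rank)
  qed
  moreover have "(\<lambda>n. N (s n)) \<longlonglongrightarrow> N z0"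
  proof -
    have "continuous_on (regular_set C (T0 o\<^sub>L Y)) N"
      unfolding N_def
      by (intro continuous_on_add continuous_on_diff continuous_on_const continuous_on_id
          continuous_on_scaleC_blinfun continuous_on_pencil_inv cTY
          bounded_bilinear.continuous_on[OF bounded_bilinear_blinfun_compose])
    then show ?thesis
      using s(1,3) near(2) by (simp add: continuous_on_sequentially comp_def)
  qed
  ultimately have N0: "approx_finite_rank (N z0)"
    by (rule approx_finite_rank_limit)
  have invid: "inverse_blinfun (id_blinfun :: 'h \<Rightarrow>\<^sub>L 'h) = id_blinfun"
    by (rule inverse_blinfun_eqI) (auto intro: inverse_pairI)
  define w where "w = z0 - z1"
  define X where "X = scaleC_blinfun w (Y o\<^sub>L G)"
  have cX: "clin X" and cL': "clin ?L'"
    using clin Q clin_inverse_blinfun[OF L] by (auto simp: X_def)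
  have eqN: "id_blinfun + ((?L' o\<^sub>L F) o\<^sub>L X) = ?L' o\<^sub>L (id_blinfun + N z0)"
    by (rule blinfun_eqI)
      (simp add: N_def near(1) invid X_def w_def[symmetric] blinfun_ops inverse_blinfun_apply[OF L]
        clin_apply[OF cL'] clin_apply[OF clin(2)])
  have "fredholm (id_blinfun + ((?L' o\<^sub>L F) o\<^sub>L X))"
    unfolding eqN
    by (intro fredholm_compose fredholm_if_invertible invertible_inverse_blinfun L
        fredholm_id_plus_approx_finite_rank N0)
  then have "fredholm (id_blinfun + (X o\<^sub>L (?L' o\<^sub>L F)))"
    by (rule fredholm_swap[OF cX clin_compose[OF cL' clin(2)]])
  \<comment> \<open>The added term compensates that \<open>Y\<close> inverts the pencil at
    \<open>z0\<close> only up to \<open>Q\<close>.\<close>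
  then have "fredholm ((?A z0 o\<^sub>L (id_blinfun + (X o\<^sub>L (?L' o\<^sub>L F))))
      + - scaleC_blinfun w (Q o\<^sub>L G o\<^sub>L ?L' o\<^sub>L F))"
    using cL' clin(2,3) Q(2)
    by (intro fredholm_add_finite_rank[OF fredholm_compose[OF fred]] finite_rank_minus
        finite_rank_scaleC finite_rank_compose_right)
  also have "(?A z0 o\<^sub>L (id_blinfun + (X o\<^sub>L (?L' o\<^sub>L F)))) + - scaleC_blinfun w (Q o\<^sub>L G o\<^sub>L ?L' o\<^sub>L F)
      = rpencil T z1 z0"
  proof (rule blinfun_eqI)
    fix x
    have cA: "clin (?A z0)" using clin by simp
    have "?A z0 (X (?L' (F x))) = w *\<^sub>C (G (?L' (F x)) + Q (G (?L' (F x))))"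
      by (simp add: X_def clin_apply[OF cA] Q(3))
    then show "((?A z0 o\<^sub>L (id_blinfun + (X o\<^sub>L (?L' o\<^sub>L F)))) + - scaleC_blinfun w (Q o\<^sub>L G o\<^sub>L ?L' o\<^sub>L F)) x
        = rpencil T z1 z0 x"
      by (simp add: blinfun_ops rpencil_apply T w_def)
  qed
  finally show ?thesis .
qed

section \<open>Analytic Fredholm theorem for pencils\<close>

definition fmat :: "nat \<Rightarrow> (nat \<Rightarrow> nat \<Rightarrow> complex) \<Rightarrow> complex Matrix.mat" where
  "fmat n m = Matrix.mat n n (\<lambda>(i, j). m i j)"

lemma fmat_carrier: "fmat n m \<in> carrier_mat n n"
  by (simp add: fmat_def)

lemma fmat_index: "i < n \<Longrightarrow> j < n \<Longrightarrow> fmat n m $$ (i, j) = m i j"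
  by (simp add: fmat_def)

lemma holomorphic_on_det_fmat:
  assumes "\<And>i j. i < n \<Longrightarrow> j < n \<Longrightarrow> (\<lambda>z. m z i j) holomorphic_on U"
  shows "(\<lambda>z. Determinant.det (fmat n (m z))) holomorphic_on U"
proof -
  have "Determinant.det (fmat n (m z)) =
      (\<Sum>p\<in>{p. p permutes {0..<n}}. signof p * (\<Prod>i = 0..<n. m z i (p i)))" for z
    unfolding Determinant.det_def'[OF fmat_carrier]
    by (intro sum.cong refl arg_cong2[of _ _ _ _ "(*)"] prod.cong fmat_index)
      (auto simp: permutes_in_image)
  moreover have "(\<lambda>z. \<Sum>p\<in>{p. p permutes {0..<n}}. signof p * (\<Prod>i = 0..<n. m z i (p i)))
      holomorphic_on U"
    by (intro holomorphic_intros assms) (auto simp: permutes_in_image)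
  ultimately show ?thesis by simp
qed

lemma holomorphic_on_adj_mat_fmat:
  assumes "\<And>i j. i < n \<Longrightarrow> j < n \<Longrightarrow> (\<lambda>z. m z i j) holomorphic_on U"
    and ij: "i < n" "j < n"
  shows "(\<lambda>z. adj_mat (fmat n (m z)) $$ (i, j)) holomorphic_on U"
proof -
  \<comment> \<open>Entry (i, j) of the adjugate is the cofactor (j, i): \<open>insert_index\<close>
    skips row \<open>j\<close> and column \<open>i\<close>.\<close>
  define m' where "m' z i' j' = m z (insert_index j i') (insert_index i j')" for z i' j'
  have lt: "insert_index k l < n" if "l < n - 1" for k l
    using that by (auto simp: insert_index_def)
  have "mat_delete (fmat n (m z)) j i = fmat (n - 1) (m' z)" for z
    by (rule eq_matI)
      (auto simp: mat_delete_def m'_def insert_index_def fmat_def)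
  then have "adj_mat (fmat n (m z)) $$ (i, j) = (- 1) ^ (j + i) * Determinant.det (fmat (n - 1) (m' z))" for z
    using ij by (simp add: adj_mat_def cofactor_def fmat_def)
  moreover have "(\<lambda>z. (- 1) ^ (j + i) * Determinant.det (fmat (n - 1) (m' z))) holomorphic_on U"
    unfolding m'_def by (intro holomorphic_intros holomorphic_on_det_fmat assms(1) lt)
  ultimately show ?thesis by simp
qed

lemma fmat_mult_adj_mat:
  assumes "i < n" "j < n"
  shows "(\<Sum>k<n. m i k * adj_mat (fmat n m) $$ (k, j)) = (if i = j then Determinant.det (fmat n m) else 0)"
    "(\<Sum>k<n. adj_mat (fmat n m) $$ (i, k) * m k j) = (if i = j then Determinant.det (fmat n m) else 0)"
proof -
  let ?M = "fmat n m"
  note adj = adj_mat[OF fmat_carrier[of n m]]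
  have "(?M * adj_mat ?M) $$ (i, j) = (\<Sum>k<n. m i k * adj_mat ?M $$ (k, j))"
    using assms adj(1) fmat_carrier[of n m]
    by (auto simp: times_mat_def scalar_prod_def fmat_index lessThan_atLeast0 intro!: sum.cong)
  then show "(\<Sum>k<n. m i k * adj_mat ?M $$ (k, j)) = (if i = j then Determinant.det ?M else 0)"
    using adj(2) assms by (simp split: if_splits)
  have "(adj_mat ?M * ?M) $$ (i, j) = (\<Sum>k<n. adj_mat ?M $$ (i, k) * m k j)"
    using assms adj(1) fmat_carrier[of n m]
    by (auto simp: times_mat_def scalar_prod_def fmat_index lessThan_atLeast0 intro!: sum.cong)
  then show "(\<Sum>k<n. adj_mat ?M $$ (i, k) * m k j) = (if i = j then Determinant.det ?M else 0)"
    using adj(3) assms by (simp split: if_splits)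
qed

lemma fmat_singular_kernel:
  assumes "Determinant.det (fmat n m) = 0"
  obtains c i where "i < n" "c i \<noteq> 0" "\<And>i. i < n \<Longrightarrow> (\<Sum>j<n. m i j * c j) = 0"
proof -
  obtain v where v: "v \<in> carrier_vec n" "v \<noteq> 0\<^sub>v n" "fmat n m *\<^sub>v v = 0\<^sub>v n"
    using assms det_0_iff_vec_prod_zero_field[OF fmat_carrier] by blast
  have "(\<Sum>j<n. m i j * vec_index v j) = 0" if "i < n" for i
  proof -
    have "vec_index (fmat n m *\<^sub>v v) i = (\<Sum>j<n. m i j * vec_index v j)"
      using that v(1) fmat_carrier[of n m]
      by (auto simp: scalar_prod_def fmat_index lessThan_atLeast0 intro!: sum.cong)
    then show ?thesis using v(3) that by simp
  qed
  moreover obtain i where "i < n" "vec_index v i \<noteq> 0"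
    using v(1,2) by (metis carrier_vecD dim_vec index_zero_vec eq_vecI)
  ultimately show thesis using that[of i "\<lambda>i. vec_index v i"] by blast
qed

lemma blinfun_sum_right: "blinfun_apply F (\<Sum>i\<in>I. f i) = (\<Sum>i\<in>I. F (f i))"
  by (induction I rule: infinite_finite_induct) (auto simp: blinfun_ops)

text \<open>
  With D invertible and E of finite rank, invertibility of D + E is decided by the
  determinant of the matrix of \<open>1 + D\<inverse> E\<close> on the range of E.
\<close>

lemma finite_rank_perturbation:
  fixes D E :: "'a::complex_hilbert \<Rightarrow>\<^sub>L 'a"
    and f :: "nat \<Rightarrow> 'a \<Rightarrow>\<^sub>L complex"
  assumes D: "invertible_blinfun D" and E: "\<And>x. E x = (\<Sum>i<n. f i x *\<^sub>C u i)"
    and f: "\<And>i. clin (f i)"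
  defines "S \<equiv> inverse_blinfun D"
  defines "m \<equiv> (\<lambda>i j. (if i = j then 1 else 0) + f i (S (u j)))"
  shows "Determinant.det (fmat n m) = 0 \<Longrightarrow> \<exists>x. x \<noteq> 0 \<and> (D + E) x = 0"
    and "Determinant.det (fmat n m) \<noteq> 0 \<Longrightarrow> invertible_blinfun (D + E)"
    and "Determinant.det (fmat n m) \<noteq> 0 \<Longrightarrow> norm (inverse_blinfun (D + E)) \<le>
      norm S + (\<Sum>i<n. \<Sum>j<n. cmod (adj_mat (fmat n m) $$ (i, j)) / cmod (Determinant.det (fmat n m))
        * (norm S * norm (u i) * norm (f j) * norm S))"
proof -
  note S = inverse_blinfun_apply[OF D, folded S_def]
  have cS: "clin S" and cD: "clin D"
    unfolding S_def using D by (auto intro: clin_inverse_blinfun clin_invertible)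
  have cE: "clin E"
    by (auto simp: clin_def E clin_apply[OF f] cvec.scale_sum_right scaleC_scaleC scaleC_complex_def)
  have m_sum: "(\<Sum>j<n. m i j * c j) = c i + f i (S (\<Sum>j<n. c j *\<^sub>C u j))" if "i < n" for i c
  proof -
    have "(\<Sum>j<n. m i j * c j) = (\<Sum>j<n. (if i = j then c j else 0) + f i (S (c j *\<^sub>C u j)))"
      by (rule sum.cong) (auto simp: m_def algebra_simps clin_apply[OF f] clin_apply[OF cS] scaleC_complex_def)
    also have "\<dots> = c i + f i (S (\<Sum>j<n. c j *\<^sub>C u j))"
      using that by (simp add: sum.distrib blinfun_sum_right)
    finally show ?thesis .
  qed
  \<comment> \<open>Writing u(c) for the combination of the \<open>u i\<close> with coefficients
    \<open>c\<close>, this says that D + E maps S u(c) to u(m c): on these vectors it acts as the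
    matrix \<open>m\<close>.\<close>
  have ES: "E (S (\<Sum>j<n. c j *\<^sub>C u j)) + (\<Sum>j<n. c j *\<^sub>C u j) = (\<Sum>i<n. (\<Sum>j<n. m i j * c j) *\<^sub>C u i)" for c
    by (simp add: E m_sum scaleC_add_left sum.distrib)
  show "\<exists>x. x \<noteq> 0 \<and> (D + E) x = 0" if det: "Determinant.det (fmat n m) = 0"
  proof -
    obtain c i where c: "i < n" "c i \<noteq> 0" "\<And>i. i < n \<Longrightarrow> (\<Sum>j<n. m i j * c j) = 0"
      using fmat_singular_kernel[OF det] by blast
    let ?x = "S (\<Sum>j<n. c j *\<^sub>C u j)"
    have "(D + E) ?x = 0"
      using ES[of c] c(3) by (simp add: plus_blinfun.rep_eq S add.commute)
    moreover have "?x \<noteq> 0"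
      using m_sum[OF c(1), of c] c(1,2) c(3)[OF c(1)] by (metis add.right_neutral blinfun.zero_right)
    ultimately show ?thesis by blast
  qed
  assume d: "Determinant.det (fmat n m) \<noteq> 0"
  let ?d = "Determinant.det (fmat n m)" and ?a = "\<lambda>i j. adj_mat (fmat n m) $$ (i, j)"
  \<comment> \<open>For a kernel vector the coordinates \<open>f i x\<close> are annihilated by
    \<open>m\<close>; multiplication by the adjugate makes them vanish, and they determine
    \<open>x\<close>.\<close>
  have inj: "x = 0" if "(D + E) x = 0" for x
  proof -
    define c where "c i = f i x" for i
    have "D x = - E x" using that by (simp add: blinfun_ops eq_neg_iff_add_eq_0)
    then have x: "x = - S (\<Sum>i<n. c i *\<^sub>C u i)"
      using S(2)[of x] by (simp add: E c_def blinfun_ops)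
    have mc: "(\<Sum>j<n. m i j * c j) = 0" if "i < n" for i
      unfolding m_sum[OF that] by (subst c_def, subst x) (simp add: blinfun_ops)
    have "c i = 0" if "i < n" for i
    proof -
      have "?d * c i = (\<Sum>j<n. (\<Sum>k<n. ?a i k * m k j) * c j)"
      proof -
        have "(\<Sum>j<n. (\<Sum>k<n. ?a i k * m k j) * c j) = (\<Sum>j<n. if i = j then ?d * c i else 0)"
          by (rule sum.cong) (use that in \<open>auto simp: fmat_mult_adj_mat\<close>)
        then show ?thesis using that by simp
      qed
      also have "\<dots> = (\<Sum>k<n. ?a i k * (\<Sum>j<n. m k j * c j))"
        unfolding sum_distrib_left sum_distrib_right by (subst sum.swap) (simp add: mult.assoc)
      also have "\<dots> = 0" by (simp add: mc)
      finally show ?thesis using d by simp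
    qed
    then show ?thesis using x by simp
  qed
  have right: "\<exists>x. (D + E) x = y \<and> norm x \<le> (norm S + (\<Sum>i<n. \<Sum>j<n. cmod (?a i j) / cmod ?d
        * (norm S * norm (u i) * norm (f j) * norm S))) * norm y" for y
  proof -
    \<comment> \<open>Cramer's rule for the system with right-hand side \<open>- f i (S y)\<close>.
      The correction added to \<open>S y\<close> then cancels \<open>E (S y)\<close>, and the
      explicit coefficients give the norm bound.\<close>
    define c where "c i = - (\<Sum>j<n. ?a i j / ?d * f j (S y))" for i
    let ?x = "S y + S (\<Sum>i<n. c i *\<^sub>C u i)"
    have mc: "(\<Sum>j<n. m i j * c j) = - f i (S y)" if "i < n" for i
    proof -
      have "(\<Sum>j<n. m i j * c j) = - (\<Sum>j<n. \<Sum>k<n. m i j * ?a j k * (f k (S y) / ?d))"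
        by (simp add: c_def sum_distrib_left sum_negf mult_ac)
      also have "\<dots> = - (\<Sum>k<n. (\<Sum>j<n. m i j * ?a j k) * (f k (S y) / ?d))"
        by (subst sum.swap) (simp add: sum_distrib_right sum_divide_distrib)
      also have "\<dots> = - (\<Sum>k<n. if i = k then f i (S y) else 0)"
        by (intro arg_cong[of _ _ uminus] sum.cong)
          (use that d in \<open>auto simp: fmat_mult_adj_mat\<close>)
      finally show ?thesis using that by simp
    qed
    have "(D + E) ?x = y + E (S y) + ((\<Sum>i<n. c i *\<^sub>C u i) + E (S (\<Sum>i<n. c i *\<^sub>C u i)))"
      by (simp add: plus_blinfun.rep_eq blinfun.add_right S)
    also have "\<dots> = y + E (S y) + (\<Sum>i<n. (\<Sum>j<n. m i j * c j) *\<^sub>C u i)"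
      using ES[of c] by (simp add: add.commute)
    also have "\<dots> = y"
      by (simp add: mc E sum_negf)
    finally have sol: "(D + E) ?x = y" .
    have "norm (S (\<Sum>i<n. c i *\<^sub>C u i)) \<le> norm S * (\<Sum>i<n. cmod (c i) * norm (u i))"
      by (rule order_trans[OF norm_blinfun mult_left_mono])
        (auto intro!: order_trans[OF norm_sum] sum_mono simp: norm_scaleC)
    also have "\<dots> \<le> norm S * (\<Sum>i<n. (\<Sum>j<n. cmod (?a i j) / cmod ?d * (norm (f j) * norm S * norm y)) * norm (u i))"
    proof (intro mult_left_mono sum_mono mult_right_mono norm_ge_zero)
      fix i
      have fS: "cmod (f j (S y)) \<le> norm (f j) * norm S * norm y" for j
        using order_trans[OF norm_blinfun mult_left_mono[OF norm_blinfun norm_ge_zero]]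
        by (simp add: mult.assoc)
      show "cmod (c i) \<le> (\<Sum>j<n. cmod (?a i j) / cmod ?d * (norm (f j) * norm S * norm y))"
        unfolding c_def norm_minus_cancel
        by (rule order_trans[OF norm_sum]) (auto intro!: sum_mono mult_left_mono fS divide_right_mono simp: norm_mult norm_divide)
    qed
    also have "\<dots> = (\<Sum>i<n. \<Sum>j<n. cmod (?a i j) / cmod ?d * (norm S * norm (u i) * norm (f j) * norm S)) * norm y"
      by (simp add: sum_distrib_left sum_distrib_right mult_ac)
    finally have "norm ?x \<le> (norm S + (\<Sum>i<n. \<Sum>j<n. cmod (?a i j) / cmod ?d * (norm S * norm (u i) * norm (f j) * norm S))) * norm y"
      using norm_triangle_ineq[of "S y" "S (\<Sum>i<n. c i *\<^sub>C u i)"] norm_blinfun[of S y]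
      by (simp add: distrib_right)
    with sol show ?thesis by blast
  qed
  let ?c = "norm S + (\<Sum>i<n. \<Sum>j<n. cmod (?a i j) / cmod ?d * (norm S * norm (u i) * norm (f j) * norm S))"
  have c0: "?c \<ge> 0" by (intro add_nonneg_nonneg sum_nonneg) auto
  have below: "norm x \<le> ?c * norm ((D + E) x)" for x
  proof -
    obtain x' where x': "(D + E) x' = (D + E) x" "norm x' \<le> ?c * norm ((D + E) x)"
      using right by blast
    then have "x' = x" using inj[of "x' - x"] by (simp add: blinfun.diff_right)
    then show ?thesis using x'(2) by simp
  qed
  have surj: "\<exists>x. (D + E) x = y" for y using right by blast
  show "invertible_blinfun (D + E)" "norm (inverse_blinfun (D + E)) \<le> ?c"
    by (fact invertible_blinfun_if_bounded_below[OF clin_add[OF cD cE] surj below c0])+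
qed

lemma continuous_bounded_near:
  fixes f :: "complex \<Rightarrow> 'b::real_normed_vector"
  assumes "continuous_on (cball z0 r) f"
  shows "\<exists>C\<ge>0. \<forall>z\<in>cball z0 r. norm (f z) \<le> C"
proof -
  have "bounded (f ` cball z0 r)"
    by (intro compact_imp_bounded compact_continuous_image assms compact_cball)
  then obtain C where "\<forall>z\<in>cball z0 r. norm (f z) \<le> C"
    unfolding bounded_iff by auto
  then show ?thesis by (intro exI[of _ "max C 0"]) (auto simp: le_max_iff_disj)
qed

text \<open>A zero of finite order bounds \<open>d\<close> below by a power of the distance; if
  \<open>d z0\<close> is nonzero, \<open>k = 0\<close> works. The radius stays strictly below
  \<open>\<rho>\<close> so that closed discs remain in the domain.\<close>

lemma holomorphic_lower_bound:
  assumes "d holomorphic_on ball z0 \<rho>" "z1 \<in> ball z0 \<rho>" "d z1 \<noteq> 0"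
  shows "\<exists>k c r. c > 0 \<and> 0 < r \<and> r < \<rho> \<and> (\<forall>z. cmod (z - z0) < r \<longrightarrow> c * cmod (z - z0) ^ k \<le> cmod (d z))"
proof -
  have \<rho>: "\<rho> > 0" using assms(2) by (metis ball_eq_empty empty_iff linorder_not_le)
  show ?thesis
  proof (cases "d z0 = 0")
    case True
    obtain k n r where k: "0 < k" "0 < r" "ball z0 r \<subseteq> ball z0 \<rho>"
      "\<And>w. w \<in> ball z0 r \<Longrightarrow> k * cmod (w - z0) ^ n \<le> cmod (d w - d z0)"
      using holomorphic_lower_bound_difference[OF assms(1) open_ball _ _ assms(2)] assms(3) True \<rho>
      by (metis centre_in_ball connected_ball)
    have "c * cmod (z - z0) ^ n \<le> cmod (d z)" if "c = k" "cmod (z - z0) < min r (\<rho> / 2)" for z c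
      using k(4)[of z] that True by (simp add: dist_norm norm_minus_commute)
    then show ?thesis
      using k \<rho> by (intro exI[of _ n] exI[of _ k] exI[of _ "min r (\<rho> / 2)"]) auto
  next
    case False
    have "isCont d z0"
      using holomorphic_on_imp_continuous_on[OF assms(1)] \<rho>
      by (simp add: continuous_on_eq_continuous_at)
    then obtain r where r: "r > 0" "\<And>z. dist z z0 < r \<Longrightarrow> dist (d z) (d z0) < cmod (d z0) / 2"
      using False unfolding continuous_at_eps_delta by (meson half_gt_zero zero_less_norm_iff)
    have "cmod (d z0) / 2 * cmod (z - z0) ^ 0 \<le> cmod (d z)" if "cmod (z - z0) < min r (\<rho> / 2)" for z
    proof -
      have "cmod (d z - d z0) < cmod (d z0) / 2"
        using r(2)[of z] that by (simp add: dist_norm)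
      then show ?thesis
        using norm_triangle_ineq2[of "d z0" "d z"] by (simp add: norm_minus_commute)
    qed
    then show ?thesis
      using r(1) \<rho> False by (intro exI[of _ 0] exI[of _ "cmod (d z0) / 2"] exI[of _ "min r (\<rho> / 2)"]) auto
  qed
qed

text \<open>Removing a fixed finite rank \<open>E\<close> makes the pencil invertible near
  \<open>z0\<close>, so \<open>d\<close> is holomorphic through \<open>z0\<close>. A regular point
  close to \<open>z0\<close> shows that \<open>d\<close> is not identically zero, and Cramer's rule
  converts its order of vanishing into the power in the bound.\<close>

theorem analytic_fredholm_pencil:
  fixes T B :: "'a::complex_hilbert \<Rightarrow>\<^sub>L 'a"
  assumes "clin T" "clin B" and fred: "fredholm (pencil B T z0)" and z0: "z0 \<in> closure (regular_set B T)"
  shows "\<exists>r>0. \<exists>k C. \<forall>z. z \<noteq> z0 \<and> cmod (z - z0) < r \<longrightarrow> z \<in> regular_set B T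
           \<and> norm (pencil_inv B T z) \<le> C / cmod (z - z0) ^ k"
    and "z0 \<notin> regular_set B T \<Longrightarrow> \<exists>x. x \<noteq> 0 \<and> pencil B T z0 x = 0"
proof -
  obtain E where E: "finite_rank E" "z0 \<in> regular_set (B - E) T"
    using fredholm_pencil_finite_rank_correction[OF assms] .
  obtain n :: nat and f :: "nat \<Rightarrow> 'a \<Rightarrow>\<^sub>L complex" and u where f: "\<And>i. clin (f i)"
    and Eu: "\<And>x. E x = (\<Sum>i<n. f i x *\<^sub>C u i)"
    using finite_rank_decomp[OF E(1)] by metis
  let ?S = "pencil_inv (B - E) T"
  define m where "m z = (\<lambda>i j. (if i = j then 1 else 0) + f i (?S z (u j)))" for z
  define d where "d z = Determinant.det (fmat n (m z))" for z
  define a where "a z i j = adj_mat (fmat n (m z)) $$ (i, j)" for z i j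
  have op: "open (regular_set (B - E) T)" by (rule open_regular_set[OF assms(1)])
  then obtain \<rho> where \<rho>: "\<rho> > 0" "ball z0 \<rho> \<subseteq> regular_set (B - E) T"
    using E(2) openE by blast
  have inv: "invertible_blinfun (pencil (B - E) T z)" if "z \<in> ball z0 \<rho>" for z
    using that \<rho>(2) by (auto simp: regular_set_def)
  have eq: "pencil (B - E) T z + E = pencil B T z" for z
    by (simp add: pencil_def)
  note pert = finite_rank_perturbation[OF inv Eu f, folded m_def, folded d_def, unfolded eq]
  have reg: "z \<in> regular_set B T \<longleftrightarrow> d z \<noteq> 0" if zb: "z \<in> ball z0 \<rho>" for z
  proof
    assume z: "z \<in> regular_set B T"
    show "d z \<noteq> 0"
    proof
      assume "d z = 0"
      then obtain x where "x \<noteq> 0" "pencil B T z x = 0" using pert(1)[OF zb] by blast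
      then show False
        using z inverse_blinfun_apply(2)[of "pencil B T z" x] by (simp add: regular_set_def)
    qed
  qed (use pert(2)[OF zb] in \<open>simp add: regular_set_def\<close>)
  have hm: "(\<lambda>z. m z i j) holomorphic_on ball z0 \<rho>" for i j
    unfolding m_def using holomorphic_on_subset[OF holomorphic_on_pencil_inv[OF assms(1) f] \<rho>(2)]
    by (intro holomorphic_intros)
  have hd: "d holomorphic_on ball z0 \<rho>"
    unfolding d_def by (intro holomorphic_on_det_fmat hm)
  obtain z' where z': "z' \<in> ball z0 \<rho>" "z' \<in> regular_set B T"
    using z0 \<rho>(1) unfolding closure_approachable by (metis dist_commute mem_ball)
  obtain k c r where r: "c > 0" "0 < r" "r < \<rho>"
    "\<And>z. cmod (z - z0) < r \<Longrightarrow> c * cmod (z - z0) ^ k \<le> cmod (d z)"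
    using holomorphic_lower_bound[OF hd z'(1)] reg z' by blast
  have sub: "cball z0 (r / 2) \<subseteq> ball z0 \<rho>" using r(2,3) by (auto simp: dist_norm)
  have ca: "continuous_on (cball z0 (r / 2)) (\<lambda>z. a z i j)" if "i < n" "j < n" for i j
    unfolding a_def using sub
    by (intro holomorphic_on_imp_continuous_on holomorphic_on_adj_mat_fmat that holomorphic_on_subset[OF hm])
  have cS: "continuous_on (cball z0 (r / 2)) ?S"
    using continuous_on_subset[OF continuous_on_pencil_inv[OF assms(1)]] sub \<rho>(2) by (metis subset_trans)
  \<comment> \<open>The bound of \<open>finite_rank_perturbation\<close> multiplied by
    \<open>cmod (d z)\<close>: unlike the bound itself, it stays continuous at zeros of
    \<open>d\<close>.\<close>
  define g where "g z = norm (?S z) * cmod (d z) + (\<Sum>i<n. \<Sum>j<n. cmod (a z i j)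
      * (norm (?S z) * norm (u i) * norm (f j) * norm (?S z)))" for z
  have "continuous_on (cball z0 (r / 2)) g"
    unfolding g_def using sub
    by (intro continuous_intros cS ca holomorphic_on_imp_continuous_on holomorphic_on_subset[OF hd]) auto
  then obtain C where C: "C \<ge> 0" "\<And>z. z \<in> cball z0 (r / 2) \<Longrightarrow> norm (g z) \<le> C"
    using continuous_bounded_near by metis
  show "\<exists>r>0. \<exists>k C. \<forall>z. z \<noteq> z0 \<and> cmod (z - z0) < r \<longrightarrow> z \<in> regular_set B T
           \<and> norm (pencil_inv B T z) \<le> C / cmod (z - z0) ^ k"
  proof (rule exI[of _ "r / 2"], rule conjI, use r in simp, rule exI[of _ k], rule exI[of _ "C / c"],
      intro allI impI conjI)
    fix z assume z: "z \<noteq> z0 \<and> cmod (z - z0) < r / 2"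
    then have zr: "z \<in> cball z0 (r / 2)" by (simp add: dist_norm norm_minus_commute)
    then have zb: "z \<in> ball z0 \<rho>" using sub by blast
    have pos: "c * cmod (z - z0) ^ k > 0" using z r(1) by simp
    have low: "c * cmod (z - z0) ^ k \<le> cmod (d z)" using r z by simp
    then have d0: "d z \<noteq> 0" using pos by auto
    then show "z \<in> regular_set B T" using reg[OF zb] by simp
    have "norm (pencil_inv B T z) \<le> g z / cmod (d z)"
      using pert(3)[OF zb d0] d0
      by (simp add: g_def a_def add_divide_distrib sum_divide_distrib divide_simps)
    also have "\<dots> \<le> C / (c * cmod (z - z0) ^ k)"
      using C(2)[OF zr] low pos C(1) by (intro frac_le) auto
    finally show "norm (pencil_inv B T z) \<le> C / c / cmod (z - z0) ^ k" by simp
  qed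
  show "\<exists>x. x \<noteq> 0 \<and> pencil B T z0 x = 0" if "z0 \<notin> regular_set B T"
    using pert(1)[of z0] reg[of z0] that \<rho>(1) by simp
qed

section \<open>Resolvents and Riesz projections\<close>

lemma graph_of_iff: "(x, y) \<in> graph_of F \<longleftrightarrow> y = F x"
  by (auto simp: graph_of_def)

lemma graph_of_inject: "graph_of F = graph_of G \<longleftrightarrow> F = G"
  by (metis blinfun_eqI graph_of_iff)

lemma linear_op_graph_of: "linear_op (graph_of F) \<longleftrightarrow> clin F"
  unfolding linear_op_def clin_def single_valued_def graph_of_iff by (auto simp: blinfun_ops)

lemma bounded_op_graph_of: "bounded_op (graph_of F) \<longleftrightarrow> clin F"
  unfolding bounded_op_def using linear_op_graph_of by blast

lemma bounded_opE:
  assumes "bounded_op T" obtains F where "clin F" "T = graph_of F"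
  using assms linear_op_graph_of unfolding bounded_op_def by blast

lemma resolvent_op_iff: "(u, v) \<in> resolvent_op X z \<longleftrightarrow> (v, u + z *\<^sub>C v) \<in> X"
proof -
  have "(u, v) \<in> resolvent_op X z \<longleftrightarrow> (\<exists>y. (v, y) \<in> X \<and> u = y - z *\<^sub>C v)"
    by (auto simp: resolvent_op_def minus_op_def scalar_op_def)
  then show ?thesis by (simp add: eq_diff_eq)
qed

lemma resolvent_blinfun_eqI: "graph_of F = resolvent_op X z \<Longrightarrow> resolvent_blinfun X z = F"
  unfolding resolvent_blinfun_def by (rule the_equality) (auto simp flip: graph_of_inject)

lemma operator_iff_resolvent:
  assumes "graph_of T = resolvent_op X z1"
  shows "(v, y) \<in> X \<longleftrightarrow> T (y - z1 *\<^sub>C v) = v"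
  using graph_of_iff[of "y - z1 *\<^sub>C v" v T] resolvent_op_iff[of "y - z1 *\<^sub>C v" v X z1] assms
  by auto

text \<open>Applying \<open>T\<close> to u = (X - z) v removes the unbounded operator and leaves an
  equation between bounded ones, with no domain condition on \<open>v\<close>.\<close>

lemma resolvent_op_iff_rpencil:
  assumes "graph_of T = resolvent_op X z1" "clin T"
  shows "(u, v) \<in> resolvent_op X z \<longleftrightarrow> rpencil T z1 z v = T u"
proof -
  have "T (u + z *\<^sub>C v - z1 *\<^sub>C v) = T u + (z - z1) *\<^sub>C T v"
    by (simp add: blinfun_ops clin_apply[OF assms(2)] add_diff_eq)
  then show ?thesis
    unfolding resolvent_op_iff operator_iff_resolvent[OF assms(1)]
    by (simp add: rpencil_apply eq_diff_eq diff_eq_eq eq_commute)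
qed

lemma resolvent_op_eq_graph:
  assumes "graph_of T = resolvent_op X z1" "clin T" "z \<in> rset T z1"
  shows "graph_of (inverse_blinfun (rpencil T z1 z) o\<^sub>L T) = resolvent_op X z"
proof -
  have "invertible_blinfun (rpencil T z1 z)" using assms(3) by (simp add: regular_set_def)
  note inv = inverse_blinfun_apply[OF this]
  have "rpencil T z1 z v = T u \<longleftrightarrow> v = inverse_blinfun (rpencil T z1 z) (T u)" for u v
    using inv by metis
  then show ?thesis
    by (auto simp: graph_of_iff resolvent_op_iff_rpencil[OF assms(1,2)])
qed

lemma resolvent_blinfun_regular:
  assumes "graph_of T = resolvent_op X z1" "clin T" "z \<in> rset T z1"
  shows "resolvent_blinfun X z = inverse_blinfun (rpencil T z1 z) o\<^sub>L T"
  using resolvent_blinfun_eqI[OF resolvent_op_eq_graph[OF assms]] .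

lemma resolvent_set_eq_rset:
  assumes "graph_of T = resolvent_op X z1" "clin T"
  shows "resolvent_set X = rset T z1"
proof (intro subset_antisym subsetI)
  fix z assume "z \<in> rset T z1"
  then have "clin (inverse_blinfun (rpencil T z1 z) o\<^sub>L T)"
    using assms(2) by (simp add: regular_set_def clin_inverse_blinfun)
  then show "z \<in> resolvent_set X"
    using resolvent_op_eq_graph[OF assms \<open>z \<in> rset T z1\<close>] bounded_op_graph_of
    unfolding resolvent_set_def by (metis mem_Collect_eq)
next
  fix z assume "z \<in> resolvent_set X"
  then obtain R where R: "clin R" "resolvent_op X z = graph_of R"
    using bounded_opE unfolding resolvent_set_def by blast
  have eq: "rpencil T z1 z v = T u \<longleftrightarrow> v = R u" for u v
    using resolvent_op_iff_rpencil[OF assms, of u v z] by (simp add: R(2) graph_of_iff)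
  \<comment> \<open>If R = (X - z)^-1, then 1 + (z - z1) R = (X - z1) R inverts (X - z) T.\<close>
  let ?A = "rpencil T z1 z" and ?B = "id_blinfun + scaleC_blinfun (z - z1) R"
  have AR: "?A (R u) = T u" for u using eq by blast
  have cA: "clin ?A" using assms(2) by simp
  have AB: "?A (?B x) = x" for x
    by (simp add: blinfun_ops AR clin_apply[OF cA]) (simp add: rpencil_apply cvec.scale_left_diff_distrib)
  have inj: "v = 0" if "?A v = 0" for v
    using eq[of v 0] that by simp
  have "?B (?A x) = x" for x
    using inj[of "?B (?A x) - x"] AB[of "?A x"] by (simp add: blinfun.diff_right)
  with AB have "inverse_pair ?A ?B"
    using cA R(1) by (intro inverse_pairI) auto
  then show "z \<in> rset T z1" by (auto simp: regular_set_def invertible_blinfun_def)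
qed

lemma rpencil_split: "rpencil T z1 z0 x = rpencil T z1 z x + (z - z0) *\<^sub>C T x"
  by (simp add: rpencil_apply blinfun_ops)

section \<open>Operator-valued contour integrals over circles\<close>

lemma op_contour_integral_circlepath_apply:
  fixes F :: "complex \<Rightarrow> 'a::complex_inner \<Rightarrow>\<^sub>L 'b::complex_hilbert" and f :: "'b \<Rightarrow>\<^sub>L complex"
  assumes F: "continuous_on (sphere z0 r) F" and r: "r > 0" and f: "clin f"
  shows "f (op_contour_integral (circlepath z0 r) F x)
       = contour_integral (circlepath z0 r) (\<lambda>z. f (F z x))"
    and "(\<lambda>z. f (F z x)) contour_integrable_on (circlepath z0 r)"
proof -
  let ?g = "circlepath z0 r"
  let ?g' = "\<lambda>t. vector_derivative ?g (at t within {0..1})"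
  let ?h = "\<lambda>t. scaleC_blinfun (?g' t) (F (?g t))"
  have g': "?g' t = 2 * of_real pi * \<i> * of_real r * exp (2 * of_real pi * \<i> * of_real t)"
    if "t \<in> {0..1}" for t
    using that vector_derivative_circlepath01[of t z0 r] by simp
  have "continuous_on {0..1} (\<lambda>t. F (?g t))"
  proof (rule continuous_on_compose2[OF F])
    show "continuous_on {0..1} ?g"
      using path_circlepath by (simp add: path_def)
    show "?g ` {0..1} \<subseteq> sphere z0 r"
      using r path_image_circlepath_nonneg[of r z0] by (simp add: path_image_def)
  qed
  moreover have "continuous_on {0..1} ?g'"
    by (subst continuous_on_cong[OF refl g']) (auto intro!: continuous_intros)
  ultimately have "continuous_on {0..1} ?h"
    by (intro continuous_intros)
  then have int: "?h integrable_on {0..1}"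
    by (rule integrable_continuous_interval)
  \<comment> \<open>Evaluation at \<open>x\<close> followed by \<open>f\<close> is bounded linear,
    so it passes through the norm-convergent integral and leaves a scalar one.\<close>
  have bl: "bounded_linear (\<lambda>A. f (blinfun_apply A x))"
    by (intro bounded_linear_compose[OF blinfun.bounded_linear_right] blinfun.bounded_linear_left)
  have "f (op_contour_integral ?g F x) = integral {0..1} (\<lambda>t. f (?h t x))"
    unfolding op_contour_integral_def using integral_linear[OF int bl] by (simp add: comp_def)
  also have "\<dots> = integral {0..1} (\<lambda>t. f (F (?g t) x) * ?g' t)"
    by (simp add: clin_apply[OF f] scaleC_complex_def mult.commute)
  \<comment> \<open>\<open>op_contour_integral\<close> uses the derivative within the interval and
    \<open>contour_integral\<close> the two-sided one; for a circle they agree on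
    \<open>{0..1}\<close>.\<close>
  also have "\<dots> = integral {0..1} (\<lambda>t. f (F (?g t) x) * vector_derivative ?g (at t))"
    by (rule integral_cong) (simp add: g' vector_derivative_circlepath)
  finally show "f (op_contour_integral ?g F x) = contour_integral ?g (\<lambda>z. f (F z x))"
    unfolding contour_integral_integral .
  show "(\<lambda>z. f (F z x)) contour_integrable_on ?g"
    using r F by (intro contour_integrable_continuous_circlepath continuous_intros)
      (auto simp: path_image_circlepath_nonneg)
qed

text \<open>The integral is formed over a real interval in a real Banach space, so complex
  homogeneity is not automatic; it is verified after pairing with each \<open>y\<close>.\<close>

lemma clin_op_contour_integral:
  fixes F :: "complex \<Rightarrow> 'a::complex_inner \<Rightarrow>\<^sub>L 'b::complex_hilbert"
  assumes F: "continuous_on (sphere z0 r) F" and r: "r > 0"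
    and c: "\<And>z. z \<in> sphere z0 r \<Longrightarrow> clin (F z)"
  shows "clin (op_contour_integral (circlepath z0 r) F)"
  unfolding clin_def
proof (intro allI, rule eq_if_cinner_eq)
  fix a :: complex and x :: 'a and y :: 'b
  let ?g = "circlepath z0 r" and ?f = "cinner_blinfun y"
  note I = op_contour_integral_circlepath_apply[OF F r clin_cinner_blinfun[of y]]
  have "contour_integral ?g (\<lambda>z. ?f (F z (a *\<^sub>C x))) = contour_integral ?g (\<lambda>z. a * ?f (F z x))"
    by (rule contour_integral_eq)
      (use r in \<open>simp add: path_image_circlepath_nonneg clin_apply[OF c] cinner_simps\<close>)
  also have "\<dots> = a * contour_integral ?g (\<lambda>z. ?f (F z x))"
    by (rule contour_integral_lmul[OF I(2)])
  finally show "cinner y (op_contour_integral ?g F (a *\<^sub>C x)) = cinner y (a *\<^sub>C op_contour_integral ?g F x)"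
    unfolding I(1)[symmetric] by (simp add: cinner_simps)
qed

section \<open>Riesz projection at a point with a punctured disc of regular points\<close>

context
  fixes X :: "('a::complex_hilbert \<times> 'a) set" and T :: "'a \<Rightarrow>\<^sub>L 'a" and z0 z1 :: complex and \<rho> :: real
  assumes T: "graph_of T = resolvent_op X z1" "clin T"
    and \<rho>: "\<rho> > 0" and reg: "\<And>z. z \<noteq> z0 \<Longrightarrow> cmod (z - z0) < \<rho> \<Longrightarrow> z \<in> rset T z1"
begin

lemma punctured_sub: "ball z0 \<rho> - {z0} \<subseteq> rset T z1"
proof
  fix z assume "z \<in> ball z0 \<rho> - {z0}"
  then show "z \<in> rset T z1"
    by (intro reg) (auto simp: dist_norm norm_minus_commute)
qed

lemma sphere_sub: "0 < r \<Longrightarrow> r < \<rho> \<Longrightarrow> sphere z0 r \<subseteq> ball z0 \<rho> - {z0}"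
  by (auto simp: dist_norm)

lemma continuous_on_resolvent: "continuous_on (ball z0 \<rho> - {z0}) (resolvent_blinfun X)"
proof -
  have "continuous_on (ball z0 \<rho> - {z0}) (\<lambda>z. inverse_blinfun (rpencil T z1 z) o\<^sub>L T)"
    by (intro bounded_bilinear.continuous_on[OF bounded_bilinear_blinfun_compose] continuous_on_const
        continuous_on_subset[OF continuous_on_pencil_inv[OF T(2)] punctured_sub])
  then show ?thesis
    by (rule continuous_on_eq) (use resolvent_blinfun_regular[OF T] punctured_sub in auto)
qed

lemma clin_resolvent: "z \<in> ball z0 \<rho> - {z0} \<Longrightarrow> clin (resolvent_blinfun X z)"
  using resolvent_blinfun_regular[OF T, of z] punctured_sub T(2)
  by (auto simp: regular_set_def intro!: clin_compose clin_inverse_blinfun)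

lemma holomorphic_on_resolvent:
  assumes "clin f" shows "(\<lambda>z. f (resolvent_blinfun X z x) :: complex) holomorphic_on ball z0 \<rho> - {z0}"
proof -
  have "(\<lambda>z. f (inverse_blinfun (rpencil T z1 z) (T x))) holomorphic_on ball z0 \<rho> - {z0}"
    by (rule holomorphic_on_subset[OF holomorphic_on_pencil_inv[OF T(2) assms] punctured_sub])
  then show ?thesis
    by (rule holomorphic_transform) (use resolvent_blinfun_regular[OF T] punctured_sub in auto)
qed

text \<open>Both sides express (X - z0) T R(z) = T (1 + (z - z0) R(z)): one application of the
  pencil at \<open>z0\<close> trades a resolvent for a factor \<open>z - z0\<close>. The Laurent
  coefficient and the reduction of the pole order rest on this.\<close>

lemma rpencil_resolvent:
  assumes "z \<in> ball z0 \<rho> - {z0}"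
  shows "rpencil T z1 z0 (resolvent_blinfun X z x) = T x + (z - z0) *\<^sub>C T (resolvent_blinfun X z x)"
    and "resolvent_blinfun X z (rpencil T z1 z0 x) = T x + (z - z0) *\<^sub>C resolvent_blinfun X z (T x)"
proof -
  have z: "z \<in> rset T z1" using assms punctured_sub by blast
  then have i: "invertible_blinfun (rpencil T z1 z)" by (simp add: regular_set_def)
  have cS: "clin (inverse_blinfun (rpencil T z1 z))" by (rule clin_inverse_blinfun[OF i])
  have comm: "T (rpencil T z1 z x) = rpencil T z1 z (T x)" for x
    by (simp add: rpencil_apply blinfun_ops clin_apply[OF T(2)])
  show "rpencil T z1 z0 (resolvent_blinfun X z x) = T x + (z - z0) *\<^sub>C T (resolvent_blinfun X z x)"
    unfolding rpencil_split[of T z1 z0 _ z]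
    by (simp add: resolvent_blinfun_regular[OF T z] inverse_blinfun_apply[OF i])
  show "resolvent_blinfun X z (rpencil T z1 z0 x) = T x + (z - z0) *\<^sub>C resolvent_blinfun X z (T x)"
    unfolding rpencil_split[of T z1 z0 _ z]
    by (simp add: resolvent_blinfun_regular[OF T z] blinfun.add_right comm inverse_blinfun_apply[OF i]
        clin_apply[OF T(2)] clin_apply[OF cS])
qed

definition riesz_integral :: "real \<Rightarrow> 'a \<Rightarrow>\<^sub>L 'a" where
  "riesz_integral r = scaleC_blinfun (- (1 / (2 * of_real pi * \<i>)))
           (op_contour_integral (circlepath z0 r) (resolvent_blinfun X))"

lemma riesz_integral_apply:
  assumes "0 < r" "r < \<rho>" "clin f"
  shows "f (riesz_integral r x)
       = - (1 / (2 * of_real pi * \<i>)) * contour_integral (circlepath z0 r) (\<lambda>z. f (resolvent_blinfun X z x))"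
  using op_contour_integral_circlepath_apply(1)[OF
      continuous_on_subset[OF continuous_on_resolvent sphere_sub[OF assms(1,2)]] assms(1,3), of x]
  by (simp add: riesz_integral_def clin_apply[OF assms(3)] scaleC_complex_def blinfun_ops)

text \<open>Circles can be deformed within the punctured disc, so the value is constant for small
  radii; the limit value is unique because \<open>at_right 0\<close> is a nontrivial filter.\<close>

lemma riesz_projection_eq:
  assumes "0 < r" "r < \<rho>"
  shows "riesz_projection X z0 = riesz_integral r"
proof -
  have eq: "riesz_integral s = riesz_integral s'" if "0 < s" "s \<le> s'" "s' < \<rho>" for s s'
  proof (rule blinfun_eq_if_cinner_eq)
    fix x y
    have "contour_integral (circlepath z0 s') (\<lambda>z. cinner_blinfun y (resolvent_blinfun X z x))
        = contour_integral (circlepath z0 s) (\<lambda>z. cinner_blinfun y (resolvent_blinfun X z x))"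
      by (rule contour_integral_circlepath_eq(3)[OF open_ball holomorphic_on_resolvent])
        (use that in \<open>auto simp: dist_norm\<close>)
    then show "cinner y (riesz_integral s x) = cinner y (riesz_integral s' x)"
      using riesz_integral_apply[of s "cinner_blinfun y" x] riesz_integral_apply[of s' "cinner_blinfun y" x] that
      by simp
  qed
  have ev: "\<forall>\<^sub>F s in at_right 0. riesz_integral s = riesz_integral r"
    unfolding eventually_at_right_field
    using eq assms by (intro exI[of _ r]) auto
  show ?thesis
    unfolding riesz_projection_def riesz_integral_def[symmetric]
  proof (rule the_equality)
    show "\<forall>\<^sub>F s in at_right 0. riesz_integral r = riesz_integral s"
      using ev by eventually_elim simp
    fix P assume "\<forall>\<^sub>F s in at_right 0. P = riesz_integral s"
    with ev have "\<forall>\<^sub>F s in at_right (0::real). P = riesz_integral r"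
      by eventually_elim simp
    then show "P = riesz_integral r" by (simp add: eventually_const)
  qed
qed

lemma clin_riesz_projection: "clin (riesz_projection X z0)"
proof -
  have "clin (riesz_integral (\<rho> / 2))"
    unfolding riesz_integral_def using \<rho> sphere_sub[of "\<rho> / 2"]
    by (intro clin_scaleC clin_op_contour_integral continuous_on_subset[OF continuous_on_resolvent]
        clin_resolvent) auto
  then show ?thesis using riesz_projection_eq[of "\<rho> / 2"] \<rho> by simp
qed

text \<open>
  The constant term \<open>N\<close> of the Laurent expansion of the resolvent inverts the pencil up to
  the Riesz projection.
\<close>

lemma fredholm_if_riesz_projection_finite:
  assumes "finite_rank (riesz_projection X z0)"
  shows "fredholm (rpencil T z1 z0)"
proof -
  define r where "r = \<rho> / 2"
  have r: "0 < r" "r < \<rho>" using \<rho> by (auto simp: r_def)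
  let ?R = "resolvent_blinfun X" and ?g = "circlepath z0 r" and ?A = "rpencil T z1 z0"
  let ?P = "riesz_projection X z0"
  \<comment> \<open>Division by \<open>z - z0\<close> shifts the Laurent series, so that the residue
    of \<open>F\<close> is the constant term of the resolvent.\<close>
  define F where "F z = scaleC_blinfun (1 / (z - z0)) (?R z)" for z
  define N where "N = scaleC_blinfun (1 / (2 * of_real pi * \<i>)) (op_contour_integral ?g F)"
  have sub: "sphere z0 r \<subseteq> ball z0 \<rho> - {z0}" by (rule sphere_sub[OF r])
  have cR: "continuous_on (sphere z0 r) ?R" by (rule continuous_on_subset[OF continuous_on_resolvent sub])
  have cF: "continuous_on (sphere z0 r) F"
    unfolding F_def using sub by (intro continuous_intros cR) auto
  have clF: "clin (F z)" if "z \<in> sphere z0 r" for z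
    unfolding F_def using sub that by (intro clin_scaleC clin_resolvent) blast
  have cN: "clin N"
    unfolding N_def by (intro clin_scaleC clin_op_contour_integral cF r clF)
  have pi: "path_image ?g = sphere z0 r" using r by (simp add: path_image_circlepath_nonneg)
  have int1: "(\<lambda>z. c * (1 / (z - z0))) contour_integrable_on ?g" for c
    using r by (intro contour_integrable_continuous_circlepath continuous_intros) (auto simp: pi)
  have val1: "contour_integral ?g (\<lambda>z. c * (1 / (z - z0))) = c * (2 * of_real pi * \<i>)" for c
  proof -
    have "(\<lambda>z. 1 / (z - z0)) contour_integrable_on ?g" using int1[of 1] by simp
    from contour_integral_lmul[OF this, of c] show ?thesis
      unfolding contour_integral_circlepath[OF r(1)] .
  qed
  \<comment> \<open>After division by \<open>z - z0\<close> the first summand integrates to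
    \<open>cinner y t\<close>; the second has lost its factor and becomes the integral of the
    resolvent, which is minus the Riesz projection.\<close>
  have core: "f (N x) = cinner y t - c"
    if "clin f" "\<And>z. z \<in> sphere z0 r \<Longrightarrow> f (?R z x) = cinner y t + (z - z0) * h (?R z v)" "clin h"
      "h (?P v) = c" for f h :: "'a \<Rightarrow>\<^sub>L complex" and x v y t c
  proof -
    have "contour_integral ?g (\<lambda>z. f (F z x))
        = contour_integral ?g (\<lambda>z. cinner y t * (1 / (z - z0)) + h (?R z v))"
    proof (rule contour_integral_eq, unfold pi)
      fix z assume z: "z \<in> sphere z0 r"
      then have "z \<noteq> z0" using sub by blast
      then show "f (F z x) = cinner y t * (1 / (z - z0)) + h (?R z v)"
        by (simp add: F_def clin_apply[OF that(1)] scaleC_complex_def that(2)[OF z] field_simps)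
    qed
    also have "\<dots> = cinner y t * (2 * of_real pi * \<i>) + contour_integral ?g (\<lambda>z. h (?R z v))"
      by (subst contour_integral_add[OF int1 op_contour_integral_circlepath_apply(2)[OF cR r(1) that(3)]])
        (simp only: val1)
    finally have "f (N x) = cinner y t + contour_integral ?g (\<lambda>z. h (?R z v)) / (2 * of_real pi * \<i>)"
      by (simp add: N_def clin_apply[OF that(1)] scaleC_complex_def field_simps
          op_contour_integral_circlepath_apply(1)[OF cF r(1) that(1)])
    moreover have "c = - (contour_integral ?g (\<lambda>z. h (?R z v)) / (2 * of_real pi * \<i>))"
      using riesz_integral_apply[OF r that(3), of v] that(4) by (simp add: riesz_projection_eq[OF r])
    ultimately show ?thesis by simp
  qed
  have cA: "clin ?A" using T(2) by simp
  have R1: "?A (?R z x) = T x + (z - z0) *\<^sub>C T (?R z x)"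
    and R2: "?R z (?A x) = T x + (z - z0) *\<^sub>C ?R z (T x)" if "z \<in> sphere z0 r" for z x
    using rpencil_resolvent[of z] sub that by blast+
  have AN: "?A (N x) = T x - T (?P x)" for x
  proof (rule eq_if_cinner_eq)
    fix y
    have "(cinner_blinfun y o\<^sub>L ?A) (N x) = cinner y (T x) - cinner y (T (?P x))"
      by (rule core[of "cinner_blinfun y o\<^sub>L ?A" x y "T x" "cinner_blinfun y o\<^sub>L T" x])
        (use cA T(2) in \<open>simp_all add: R1 cinner_simps del: mem_sphere\<close>)
    then show "cinner y (?A (N x)) = cinner y (T x - T (?P x))" by (simp add: cinner_simps)
  qed
  have NA: "N (?A x) = T x - ?P (T x)" for x
  proof (rule eq_if_cinner_eq)
    fix y
    have "cinner_blinfun y (N (?A x)) = cinner y (T x) - cinner y (?P (T x))"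
      by (rule core[of "cinner_blinfun y" "?A x" y "T x" "cinner_blinfun y" "T x"])
        (simp_all add: R2 cinner_simps del: mem_sphere)
    then show "cinner y (N (?A x)) = cinner y (T x - ?P (T x))" by (simp add: cinner_simps)
  qed
  let ?w = "z0 - z1"
  \<comment> \<open>From \<open>?A N = T - T ?P\<close> and \<open>?A = 1 - ?w T\<close> follows
    \<open>?A (1 + ?w N) = 1 - ?w T ?P\<close>; the other order is analogous.\<close>
  have "parametrix ?A (id_blinfun + scaleC_blinfun ?w N)"
  proof (rule parametrixI[where Q = "- scaleC_blinfun ?w (T o\<^sub>L ?P)" and Q' = "- scaleC_blinfun ?w (?P o\<^sub>L T)"])
    show "?A ((id_blinfun + scaleC_blinfun ?w N) x) = x + (- scaleC_blinfun ?w (T o\<^sub>L ?P)) x" for x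
      by (simp add: blinfun_ops clin_apply[OF cA] AN) (simp add: rpencil_apply cvec.scale_left_diff_distrib)
    show "(id_blinfun + scaleC_blinfun ?w N) (?A x) = x + (- scaleC_blinfun ?w (?P o\<^sub>L T)) x" for x
      by (simp add: blinfun_ops NA) (simp add: rpencil_apply cvec.scale_left_diff_distrib)
  qed (use cA cN T(2) assms in auto)
  then show ?thesis unfolding fredholm_def by blast
qed

lemma blinfun_pow_commute:
  fixes A B :: "'b::real_normed_vector \<Rightarrow>\<^sub>L 'b"
  assumes "\<And>x. A (B x) = B (A x)" shows "blinfun_pow A n (B x) = B (blinfun_pow A n x)"
  by (induction n) (auto simp: assms)

text \<open>Each application of the pencil at \<open>z0\<close> lowers the exponent by one. The
  bound \<open>\<rho> \<le> 1\<close> lets the bounded remainder be absorbed into the negative power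
  that is left.\<close>

lemma resolvent_growth:
  assumes bound: "\<And>z. z \<in> ball z0 \<rho> - {z0} \<Longrightarrow> norm (resolvent_blinfun X z) \<le> C / cmod (z - z0) ^ k"
    and "\<rho> \<le> 1" "j \<le> k"
  shows "\<exists>C. \<forall>z\<in>ball z0 \<rho> - {z0}.
    norm (blinfun_pow (rpencil T z1 z0) j o\<^sub>L resolvent_blinfun X z) \<le> C / cmod (z - z0) ^ (k - j)"
  using assms(3)
proof (induction j)
  case 0
  have "id_blinfun o\<^sub>L F = F" for F :: "'a \<Rightarrow>\<^sub>L 'a" by (rule blinfun_eqI) simp
  then show ?case using bound by (intro exI[of _ C]) simp
next
  case (Suc j)
  let ?A = "rpencil T z1 z0" and ?R = "resolvent_blinfun X"
  obtain C where C: "\<And>z. z \<in> ball z0 \<rho> - {z0} \<Longrightarrow>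
      norm (blinfun_pow ?A j o\<^sub>L ?R z) \<le> C / cmod (z - z0) ^ (k - j)"
    using Suc.IH Suc.prems Suc_leD by blast
  let ?C = "norm (blinfun_pow ?A j o\<^sub>L T) + norm T * C"
  have comm: "?A (T x) = T (?A x)" for x
    by (simp add: rpencil_apply blinfun_ops clin_apply[OF T(2)])
  have cp: "clin (blinfun_pow ?A j)" using T(2) by simp
  show ?case
  proof (intro exI[of _ ?C] ballI)
    fix z assume z: "z \<in> ball z0 \<rho> - {z0}"
    define t where "t = cmod (z - z0)"
    have t: "0 < t" "t \<le> 1" using z assms(2) by (auto simp: t_def dist_norm norm_minus_commute)
    have "blinfun_pow ?A (Suc j) o\<^sub>L ?R z
        = (blinfun_pow ?A j o\<^sub>L T) + scaleC_blinfun (z - z0) (T o\<^sub>L (blinfun_pow ?A j o\<^sub>L ?R z))"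
    proof (rule blinfun_eqI)
      fix x
      have "blinfun_pow ?A (Suc j) (?R z x) = blinfun_pow ?A j (?A (?R z x))"
        by (simp add: blinfun_pow_commute)
      also have "\<dots> = blinfun_pow ?A j (T x) + (z - z0) *\<^sub>C T (blinfun_pow ?A j (?R z x))"
        by (simp add: rpencil_resolvent(1)[OF z] blinfun_ops clin_apply[OF cp] blinfun_pow_commute[OF comm])
      finally show "(blinfun_pow ?A (Suc j) o\<^sub>L ?R z) x
        = ((blinfun_pow ?A j o\<^sub>L T) + scaleC_blinfun (z - z0) (T o\<^sub>L (blinfun_pow ?A j o\<^sub>L ?R z))) x"
        by (simp add: blinfun_ops)
    qed
    then have "norm (blinfun_pow ?A (Suc j) o\<^sub>L ?R z)
        \<le> norm (blinfun_pow ?A j o\<^sub>L T) + t * norm (T o\<^sub>L (blinfun_pow ?A j o\<^sub>L ?R z))"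
      using norm_triangle_ineq by (metis norm_scaleC_blinfun t_def)
    also have "\<dots> \<le> norm (blinfun_pow ?A j o\<^sub>L T) + t * (norm T * (C / t ^ (k - j)))"
      using C[OF z] t(1)
      by (intro add_left_mono mult_left_mono order_trans[OF norm_blinfun_compose mult_left_mono])
        (auto simp: t_def)
    also have "t * (norm T * (C / t ^ (k - j))) = norm T * C / t ^ (k - Suc j)"
    proof -
      have "k - j = Suc (k - Suc j)" using Suc.prems by simp
      then show ?thesis using t(1) by simp
    qed
    also have "norm (blinfun_pow ?A j o\<^sub>L T) \<le> norm (blinfun_pow ?A j o\<^sub>L T) / t ^ (k - Suc j)"
      using t by (simp add: le_divide_eq mult_left_le power_le_one)
    finally show "norm (blinfun_pow ?A (Suc j) o\<^sub>L ?R z) \<le> ?C / cmod (z - z0) ^ (k - Suc j)"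
      by (simp add: t_def add_divide_distrib)
  qed
qed

text \<open>After \<open>k\<close> applications the resolvent is bounded near \<open>z0\<close>, so
  its integral over a circle of radius \<open>s\<close> is O(s). Being independent of
  \<open>s\<close>, the integral vanishes.\<close>

lemma riesz_projection_kernel:
  assumes bound: "\<And>z. z \<in> ball z0 \<rho> - {z0} \<Longrightarrow> norm (resolvent_blinfun X z) \<le> C / cmod (z - z0) ^ k"
    and "\<rho> \<le> 1"
  shows "blinfun_pow (rpencil T z1 z0) k (riesz_projection X z0 x) = 0"
proof -
  let ?A = "blinfun_pow (rpencil T z1 z0) k" and ?R = "resolvent_blinfun X"
  obtain C' where C': "\<And>z. z \<in> ball z0 \<rho> - {z0} \<Longrightarrow> norm (?A o\<^sub>L ?R z) \<le> C'"
    using resolvent_growth[OF assms order_refl] by (simp only: diff_self_eq_0 power_0 div_by_1) blast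
  have cA: "clin ?A" using T(2) by simp
  have "cinner y (?A (riesz_projection X z0 x)) = cinner y 0" for y
  proof -
    define c where "c = cmod (cinner y (?A (riesz_projection X z0 x)))"
    define f where "f = cinner_blinfun y o\<^sub>L ?A"
    have cf: "clin f" using cA by (simp add: f_def)
    define M where "M = norm y * (C' * norm x)"
    have "c \<le> M * s" if s: "0 < s" "s < \<rho>" for s
    proof -
      let ?I = "contour_integral (circlepath z0 s) (\<lambda>z. f (?R z x))"
      note sub = sphere_sub[OF s]
      have fR: "cmod (f (?R z x)) \<le> M" if "cmod (z - z0) = s" for z
      proof -
        have z: "z \<in> ball z0 \<rho> - {z0}" using that sub by (auto simp: dist_norm norm_minus_commute)
        have "cmod (f (?R z x)) \<le> norm y * norm ((?A o\<^sub>L ?R z) x)"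
          by (simp add: f_def cinner_Cauchy_Schwarz)
        also have "\<dots> \<le> norm y * (C' * norm x)"
          by (intro mult_left_mono order_trans[OF norm_blinfun mult_right_mono] C' z) auto
        finally show ?thesis by (simp add: M_def)
      qed
      have M0: "M \<ge> 0"
        using fR[of "z0 + of_real s"] s(1) by (simp add: order_trans[OF norm_ge_zero])
      have "(\<lambda>z. f (?R z x)) contour_integrable_on circlepath z0 s"
        by (intro op_contour_integral_circlepath_apply(2) continuous_on_subset[OF continuous_on_resolvent sub] cf s)
      then have "cmod ?I \<le> M * (2 * pi * s)"
        by (intro has_contour_integral_bound_circlepath[OF has_contour_integral_integral] M0 s(1) fR)
      moreover have "c = cmod ?I / (2 * pi)"
        using riesz_integral_apply[OF s cf, of x]
        by (simp add: c_def f_def riesz_projection_eq[OF s] norm_mult norm_divide)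
      ultimately show ?thesis by (simp add: divide_le_eq mult_ac)
    qed
    then have "\<forall>\<^sub>F s in at_right 0. c \<le> M * s"
      unfolding eventually_at_right_field using \<rho> by blast
    moreover have "((\<lambda>s. M * s) \<longlongrightarrow> M * 0) (at_right 0)" by (intro tendsto_intros)
    ultimately have "c \<le> M * 0"
      by (intro tendsto_lowerbound) auto
    then show ?thesis by (simp add: c_def)
  qed
  then show ?thesis by (rule eq_if_cinner_eq)
qed

end

text \<open>Translates the definition by isolation and Riesz projection into the Fredholm property,
  which is what can be carried from \<open>T0\<close> to \<open>T\<close>.\<close>

lemma not_ess_spectrum_near:
  fixes X :: "('a::complex_hilbert \<times> 'a) set"
  assumes T: "graph_of T = resolvent_op X z1" "clin T" and z0: "z0 \<notin> ess_spectrum X"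
  shows "\<exists>\<rho>>0. \<forall>z. z \<noteq> z0 \<and> cmod (z - z0) < \<rho> \<longrightarrow> z \<in> rset T z1" "fredholm (rpencil T z1 z0)"
proof -
  note eq = resolvent_set_eq_rset[OF T]
  have op: "open (rset T z1)" by (rule open_regular_set[OF T(2)])
  have *: "(\<exists>\<rho>>0. \<forall>z. z \<noteq> z0 \<and> cmod (z - z0) < \<rho> \<longrightarrow> z \<in> rset T z1) \<and> fredholm (rpencil T z1 z0)"
  proof (cases "z0 \<in> rset T z1")
    case True
    then show ?thesis
      using op fredholm_if_invertible unfolding open_dist dist_norm regular_set_def by blast
  next
    case False
    then have iso: "isolated_eigenvalue_fin X z0"
      using z0 unfolding ess_spectrum_def spectrum_op_def eq by blast
    then obtain U where U: "open U" "U \<inter> - rset T z1 = {z0}"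
      unfolding isolated_eigenvalue_fin_def isolated_in_def spectrum_op_def eq by blast
    then obtain \<rho> where \<rho>: "\<rho> > 0" "\<And>z. z \<noteq> z0 \<Longrightarrow> cmod (z - z0) < \<rho> \<Longrightarrow> z \<in> rset T z1"
      unfolding open_dist dist_norm by blast
    obtain S where S: "finite S" "range (blinfun_apply (riesz_projection X z0)) \<subseteq> cvec.span S"
      using iso unfolding isolated_eigenvalue_fin_def alg_mult_def cdim_ext_def by (auto split: if_splits)
    have "finite_rank (riesz_projection X z0)"
      using S clin_riesz_projection[OF T \<rho>] unfolding finite_rank_def by blast
    then show ?thesis
      using fredholm_if_riesz_projection_finite[OF T \<rho>] \<rho> by blast
  qed
  then show "\<exists>\<rho>>0. \<forall>z. z \<noteq> z0 \<and> cmod (z - z0) < \<rho> \<longrightarrow> z \<in> rset T z1" "fredholm (rpencil T z1 z0)"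
    by blast+
qed

text \<open>\<open>analytic_fredholm_pencil\<close> gives isolation and a pole bound. The latter
  puts the range of the Riesz projection into the finite-dimensional kernel of a Fredholm power; a
  kernel vector of the pencil itself is an eigenvector.\<close>

lemma not_ess_spectrum_if_fredholm:
  fixes X :: "('a::complex_hilbert \<times> 'a) set"
  assumes T: "graph_of T = resolvent_op X z1" "clin T"
    and fred: "fredholm (rpencil T z1 z0)" and z0: "z0 \<in> closure (rset T z1)"
  shows "z0 \<notin> ess_spectrum X"
proof (cases "z0 \<in> rset T z1")
  case True
  then show ?thesis by (simp add: ess_spectrum_def spectrum_op_def resolvent_set_eq_rset[OF T])
next
  case False
  note eq = resolvent_set_eq_rset[OF T]
  have cB: "clin (resolvent_pencil_base T z1)" using T(2) by simp
  note AF = analytic_fredholm_pencil[OF T(2) cB fred z0]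
  obtain r k C where r: "r > 0" and reg: "\<And>z. z \<noteq> z0 \<Longrightarrow> cmod (z - z0) < r \<Longrightarrow> z \<in> rset T z1"
    and bd: "\<And>z. z \<noteq> z0 \<Longrightarrow> cmod (z - z0) < r \<Longrightarrow>
        norm (inverse_blinfun (rpencil T z1 z)) \<le> C / cmod (z - z0) ^ k"
    using AF(1) by blast
  define \<rho> where "\<rho> = min r 1"
  have \<rho>: "\<rho> > 0" "\<rho> \<le> 1" using r by (auto simp: \<rho>_def)
  have reg': "\<And>z. z \<noteq> z0 \<Longrightarrow> cmod (z - z0) < \<rho> \<Longrightarrow> z \<in> rset T z1"
    using reg by (simp add: \<rho>_def)
  have bd': "norm (resolvent_blinfun X z) \<le> C * norm T / cmod (z - z0) ^ k" if "z \<in> ball z0 \<rho> - {z0}" for z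
  proof -
    have z: "z \<noteq> z0" "cmod (z - z0) < r" using that by (auto simp: \<rho>_def dist_norm norm_minus_commute)
    have "norm (inverse_blinfun (rpencil T z1 z) o\<^sub>L T) \<le> C / cmod (z - z0) ^ k * norm T"
      by (rule order_trans[OF norm_blinfun_compose mult_right_mono[OF bd[OF z]]]) simp
    then show ?thesis by (simp add: resolvent_blinfun_regular[OF T reg[OF z]])
  qed
  have "fredholm (blinfun_pow (rpencil T z1 z0) k)" by (rule fredholm_blinfun_pow[OF fred])
  then obtain S where "finite S" "{x. blinfun_pow (rpencil T z1 z0) k x = 0} \<subseteq> cvec.span S"
    using fredholm_kernel_finite by blast
  then have "finite S \<and> range (blinfun_apply (riesz_projection X z0)) \<subseteq> cvec.span S"
    using riesz_projection_kernel[OF T \<rho>(1) reg' bd' \<rho>(2)] by auto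
  then have "alg_mult X z0 \<noteq> \<infinity>"
    unfolding alg_mult_def cdim_ext_def by auto
  moreover have "eigenvalue_op X z0"
  proof -
    obtain x where x: "x \<noteq> 0" "rpencil T z1 z0 x = 0" using AF(2)[OF False] by blast
    then have "(x, z0 *\<^sub>C x) \<in> X"
      unfolding operator_iff_resolvent[OF T(1)]
      by (simp add: clin_apply[OF T(2)] rpencil_apply flip: cvec.scale_left_diff_distrib)
    then show ?thesis using x(1) unfolding eigenvalue_op_def by blast
  qed
  moreover have "z0 isolated_in spectrum_op X"
    unfolding isolated_in_def spectrum_op_def eq
  proof (intro conjI exI[of _ "ball z0 \<rho>"])
    show "ball z0 \<rho> \<inter> - rset T z1 = {z0}"
      using False \<rho>(1) reg' by (force simp: dist_norm norm_minus_commute)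
  qed (use False in auto)
  ultimately show ?thesis by (simp add: ess_spectrum_def isolated_eigenvalue_fin_def)
qed

section \<open>Closed graph theorem and adjoints\<close>

text \<open>Baire category: the closures of the sets where \<open>norm (f x)\<close> is at most n
  cover the space, so one contains a ball; differences move it to the origin, scaling reaches all
  radii. The estimate holds for points arbitrarily close to \<open>y\<close>, not yet for
  \<open>y\<close>.\<close>

lemma linear_almost_open:
  fixes f :: "'a::banach \<Rightarrow> 'b::banach"
  assumes "linear f"
  obtains C where "C \<ge> 0" "\<And>y \<epsilon>. \<epsilon> > 0 \<Longrightarrow> \<exists>x. norm (x - y) < \<epsilon> \<and> norm (f x) \<le> C * norm y"
proof -
  define A where "A n = closure {x. norm (f x) \<le> real n}" for n :: nat
  have U: "(\<Union>n. A n) = UNIV"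
  proof -
    have "x \<in> A (nat \<lceil>norm (f x)\<rceil>)" for x
      unfolding A_def by (rule subsetD[OF closure_subset]) (simp add: real_nat_ceiling_ge)
    then show ?thesis by blast
  qed
  have "\<exists>n. interior (A n) \<noteq> {}"
  proof (rule ccontr)
    assume "\<not> ?thesis"
    then have "(euclidean :: 'a topology) interior_of \<Union>(range A) = {}"
      using completely_metrizable_space_euclidean
      by (intro Baire_category_alt) (auto simp: A_def)
    then show False using U by simp
  qed
  then obtain n x0 where "x0 \<in> interior (A n)" by blast
  then obtain d where d: "d > 0" "ball x0 d \<subseteq> A n"
    unfolding mem_interior by blast
  have near: "\<exists>x. norm (x - y) < \<epsilon> \<and> norm (f x) \<le> 2 * real n" if y: "norm y < d" and "\<epsilon> > 0" for y \<epsilon>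
  proof -
    have "x0 + y \<in> A n" "x0 \<in> A n" using d y by (auto simp: subset_iff dist_norm)
    then obtain u v where uv: "norm (f u) \<le> n" "dist u (x0 + y) < \<epsilon> / 2"
        "norm (f v) \<le> n" "dist v x0 < \<epsilon> / 2"
      using \<open>\<epsilon> > 0\<close> unfolding A_def closure_approachable by (metis half_gt_zero mem_Collect_eq)
    have "norm (u - v - y) \<le> norm (u - (x0 + y)) + norm (v - x0)"
      using norm_triangle_ineq4[of "u - (x0 + y)" "v - x0"] by (simp add: algebra_simps)
    moreover have "norm (f (u - v)) \<le> norm (f u) + norm (f v)"
      using norm_triangle_ineq4 by (simp add: linear_diff[OF assms])
    ultimately show ?thesis using uv by (intro exI[of _ "u - v"]) (auto simp: dist_norm)
  qed
  show thesis
  proof (rule that[of "4 * real n / d"])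
    fix y :: 'a and \<epsilon> :: real assume "\<epsilon> > 0"
    show "\<exists>x. norm (x - y) < \<epsilon> \<and> norm (f x) \<le> 4 * real n / d * norm y"
    proof (cases "y = 0")
      case True
      then show ?thesis using \<open>\<epsilon> > 0\<close> by (intro exI[of _ 0]) (simp add: linear_0[OF assms])
    next
      case False
      \<comment> \<open>Scales \<open>y\<close> to norm \<open>d / 2\<close>, inside the ball;
        undoing this turns \<open>2 * n\<close> into \<open>4 * n / d * norm y\<close>.\<close>
      define s where "s = 2 * norm y / d"
      have s: "s > 0" using False d by (simp add: s_def)
      have "norm ((1 / s) *\<^sub>R y) < d" using False d by (simp add: s_def field_simps)
      then obtain x where x: "norm (x - (1 / s) *\<^sub>R y) < \<epsilon> / s" "norm (f x) \<le> 2 * real n"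
        using near \<open>\<epsilon> > 0\<close> s by (metis divide_pos_pos)
      have "s *\<^sub>R x - y = s *\<^sub>R (x - (1 / s) *\<^sub>R y)" using s by (simp add: scaleR_diff_right)
      then have "norm (s *\<^sub>R x - y) = s * norm (x - (1 / s) *\<^sub>R y)"
        using s by (metis abs_of_pos norm_scaleR)
      then have "norm (s *\<^sub>R x - y) < \<epsilon>" using x(1) s by (simp add: less_divide_eq mult.commute)
      moreover have "norm (f (s *\<^sub>R x)) \<le> s * (2 * real n)"
        using x(2) s by (simp add: linear_cmul[OF assms])
      ultimately show ?thesis by (intro exI[of _ "s *\<^sub>R x"]) (simp add: s_def mult_ac)
    qed
  qed (use d in auto)
qed

text \<open>Exhaust \<open>y\<close> by approximations with halving remainders: the images are
  dominated by a geometric series with sum \<open>2 * C * norm y\<close>, and closedness identifies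
  their sum with \<open>f y\<close>.\<close>

theorem closed_graph:
  fixes f :: "'a::banach \<Rightarrow> 'b::banach"
  assumes lin: "linear f" and graph: "closed (range (\<lambda>x. (x, f x)))"
  shows "bounded_linear f"
proof -
  obtain C where C: "C \<ge> 0" "\<And>y \<epsilon>. \<epsilon> > 0 \<Longrightarrow> \<exists>x. norm (x - y) < \<epsilon> \<and> norm (f x) \<le> C * norm y"
    using linear_almost_open[OF lin] by blast
  then have "\<forall>y. \<forall>\<epsilon>>0. \<exists>x. norm (x - y) < \<epsilon> \<and> norm (f x) \<le> C * norm y" by blast
  then obtain p where p: "\<And>y \<epsilon>. \<epsilon> > 0 \<Longrightarrow> norm (p y \<epsilon> - y) < \<epsilon>" "\<And>y \<epsilon>. \<epsilon> > 0 \<Longrightarrow> norm (f (p y \<epsilon>)) \<le> C * norm y"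
    unfolding choice_iff choice_iff' by blast
  have bound: "norm (f y) \<le> norm y * (2 * C)" for y
  proof (cases "y = 0")
    case False
    \<comment> \<open>\<open>r n\<close> is the part of \<open>y\<close> still to be approximated;
      the tolerance at each stage keeps its norm below \<open>norm y / 2 ^ n\<close>, up to equality
      at \<open>n = 0\<close>.\<close>
    define r where "r = rec_nat y (\<lambda>n v. v - p v (norm y / 2 ^ Suc n))"
    have r0: "r 0 = y" and rS: "r (Suc n) = r n - p (r n) (norm y / 2 ^ Suc n)" for n
      by (simp_all add: r_def)
    define x where "x n = p (r n) (norm y / 2 ^ Suc n)" for n
    have r_bound: "norm (r n) \<le> norm y / 2 ^ n" for n
    proof (cases n)
      case (Suc m)
      then show ?thesis
        using p(1)[of "norm y / 2 ^ Suc m" "r m"] False by (simp add: rS norm_minus_commute)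
    qed (simp add: r0)
    have "norm (f (x n)) \<le> C * (norm y / 2 ^ n)" for n
      using p(2)[of "norm y / 2 ^ Suc n" "r n"] False mult_left_mono[OF r_bound C(1)]
      unfolding x_def by (smt (verit) divide_pos_pos zero_less_norm_iff zero_less_power)
    then have fx: "norm (f (x n)) \<le> C * norm y * (1 / 2) ^ n" for n
      by (simp add: power_one_over divide_simps)
    have geo: "summable (\<lambda>n. C * norm y * (1 / 2) ^ n)"
      by (intro summable_mult summable_geometric) simp
    have summ: "summable (\<lambda>n. norm (f (x n)))"
      by (rule summable_comparison_test'[OF geo]) (use fx in simp)
    then have fsum: "(\<lambda>n. f (\<Sum>i<n. x i)) \<longlonglongrightarrow> (\<Sum>n. f (x n))"
      using summable_LIMSEQ[OF summable_norm_cancel[OF summ]] by (simp add: linear_sum[OF lin])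
    have "(\<Sum>i<n. x i) = y - r n" for n
      by (induction n) (auto simp: r0 rS x_def)
    moreover have "r \<longlonglongrightarrow> 0"
    proof (rule Lim_null_comparison)
      show "\<forall>\<^sub>F n in sequentially. norm (r n) \<le> norm y * (1 / 2) ^ n"
        using r_bound by (simp add: power_one_over)
      show "(\<lambda>n. norm y * (1 / 2) ^ n) \<longlonglongrightarrow> 0"
        by (intro tendsto_mult_right_zero LIMSEQ_realpow_zero) auto
    qed
    ultimately have xsum: "(\<lambda>n. \<Sum>i<n. x i) \<longlonglongrightarrow> y"
      using tendsto_diff[of "\<lambda>_. y" y sequentially r 0] by simp
    have "(y, \<Sum>n. f (x n)) \<in> range (\<lambda>x. (x, f x))"
      by (rule closed_sequentially[OF graph _ tendsto_Pair[OF xsum fsum]]) auto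
    then have "f y = (\<Sum>n. f (x n))" by auto
    also have "norm \<dots> \<le> (\<Sum>n. norm (f (x n)))" by (rule summable_norm[OF summ])
    also have "\<dots> \<le> (\<Sum>n. C * norm y * (1 / 2) ^ n)" by (rule suminf_le[OF fx summ geo])
    also have "\<dots> = C * norm y * 2"
      by (subst suminf_mult) (auto simp: suminf_geometric summable_geometric)
    finally show ?thesis by (simp add: mult_ac)
  qed (simp add: linear_0[OF lin])
  show ?thesis
    by (rule bounded_linear_intro[OF _ _ bound]) (auto simp: linear_add[OF lin] linear_cmul[OF lin])
qed

section \<open>Riesz representation and adjoints of bounded operators\<close>

lemma parallelogram_law:
  "(norm (x - y))\<^sup>2 + (norm (x + y))\<^sup>2 = 2 * (norm x)\<^sup>2 + 2 * (norm (y::'a::complex_inner))\<^sup>2"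
  using norm_diff_cinner[of x y] norm_diff_cinner[of x "- y"] by (simp add: cinner_simps)

text \<open>For nonzero \<open>f\<close> the representing vector is a multiple of the element of
  least norm on the affine hyperplane \<open>f x = 1\<close>.\<close>

lemma Riesz_representation:
  fixes f :: "'a::complex_hilbert \<Rightarrow>\<^sub>L complex"
  assumes "clin f"
  shows "\<exists>v. \<forall>x. f x = cinner v x"
proof (cases "f = 0")
  case True
  then show ?thesis by (intro exI[of _ 0]) simp
next
  case False
  then obtain a where a: "f a \<noteq> 0" by (metis blinfun_eqI zero_blinfun.rep_eq)
  define S where "S = {x. f x = 1}"
  have "f ((1 / f a) *\<^sub>C a) = 1" using a by (simp add: clin_apply[OF assms] scaleC_complex_def)
  then have ne: "S \<noteq> {}" by (auto simp: S_def)
  define D where "D = (INF x\<in>S. (norm x)\<^sup>2)"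
  have bdd: "bdd_below ((\<lambda>x. (norm x)\<^sup>2) ` S)" by (rule bdd_belowI2[of _ 0]) simp
  have D_le: "D \<le> (norm x)\<^sup>2" if "x \<in> S" for x
    unfolding D_def by (rule cINF_lower[OF bdd that])
  have "\<exists>x\<in>S. (norm x)\<^sup>2 < D + \<epsilon>" if "\<epsilon> > 0" for \<epsilon>
    using cINF_less_iff[OF ne bdd, of "D + \<epsilon>"] that unfolding D_def by simp
  then have "\<forall>n. \<exists>x\<in>S. (norm x)\<^sup>2 < D + 1 / (real n + 1)" by simp
  then obtain s where s: "\<And>n. s n \<in> S" "\<And>n. (norm (s n))\<^sup>2 < D + 1 / (real n + 1)" by metis
  \<comment> \<open>Midpoints of points of \<open>S\<close> stay in \<open>S\<close>, so the
    parallelogram law makes the minimising sequence Cauchy.\<close>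
  have close: "(norm (s m - s n))\<^sup>2 < 2 / (real m + 1) + 2 / (real n + 1)" for m n
  proof -
    have "(1 / 2) *\<^sub>C (s m + s n) \<in> S"
      using s(1) by (simp add: S_def clin_apply[OF assms] blinfun_ops scaleC_complex_def)
    from D_le[OF this] have "4 * D \<le> (norm (s m + s n))\<^sup>2"
      by (simp add: norm_scaleC power_divide norm_divide)
    then show ?thesis
      using parallelogram_law[of "s m" "s n"] s(2)[of m] s(2)[of n] by simp
  qed
  have "Cauchy s"
  proof (rule metric_CauchyI)
    fix e :: real assume e: "e > 0"
    obtain N :: nat where N: "4 / e\<^sup>2 < real N" using reals_Archimedean2 by blast
    have "dist (s m) (s n) < e" if "m \<ge> N" "n \<ge> N" for m n
    proof -
      have "4 < real N * e\<^sup>2" using N e by (simp add: divide_less_eq)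
      then have "4 < e\<^sup>2 * (real N + 1)" using e by (simp add: algebra_simps add_strict_increasing)
      then have *: "4 / (real N + 1) < e\<^sup>2" by (simp add: divide_less_eq)
      have "2 / (real m + 1) \<le> 2 / (real N + 1)" "2 / (real n + 1) \<le> 2 / (real N + 1)"
        using that by (auto intro!: divide_left_mono)
      then have "(norm (s m - s n))\<^sup>2 < e\<^sup>2" using close[of m n] * by simp
      then show ?thesis using e by (simp add: dist_norm power2_less_imp_less)
    qed
    then show "\<exists>M. \<forall>m\<ge>M. \<forall>n\<ge>M. dist (s m) (s n) < e" by blast
  qed
  then obtain u where u: "s \<longlonglongrightarrow> u" using Cauchy_convergent convergent_def by blast
  have fu: "f u = 1"
  proof (rule LIMSEQ_unique)
    show "(\<lambda>n. f (s n)) \<longlonglongrightarrow> f u" by (intro tendsto_intros u)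
    show "(\<lambda>n. f (s n)) \<longlonglongrightarrow> 1" using s(1) by (simp add: S_def)
  qed
  have "(norm u)\<^sup>2 \<le> D + 0"
  proof (rule LIMSEQ_le)
    show "(\<lambda>n. (norm (s n))\<^sup>2) \<longlonglongrightarrow> (norm u)\<^sup>2" by (intro tendsto_intros u)
    show "(\<lambda>n. D + 1 / (real n + 1)) \<longlonglongrightarrow> D + 0"
      using LIMSEQ_inverse_real_of_nat by (intro tendsto_add tendsto_const) (simp add: inverse_eq_divide add.commute)
    show "\<exists>N. \<forall>n\<ge>N. (norm (s n))\<^sup>2 \<le> D + 1 / (real n + 1)" using s(2) less_imp_le by blast
  qed
  then have umin: "(norm u)\<^sup>2 \<le> (norm x)\<^sup>2" if "x \<in> S" for x using D_le[OF that] by linarith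
  \<comment> \<open>Subtracting from \<open>u\<close> its projection onto \<open>h\<close> stays in
    \<open>S\<close> and would shorten \<open>u\<close> unless the projection is zero.\<close>
  have orth: "cinner u h = 0" if "f h = 0" for h
  proof (cases "h = 0")
    case False
    define c where "c = cinner h u / complex_of_real ((norm h)\<^sup>2)"
    have cc: "cnj (cinner h u) * cinner h u = complex_of_real ((cmod (cinner h u))\<^sup>2)"
      by (metis complex_norm_square mult.commute of_real_power)
    have "cinner (c *\<^sub>C h) u = complex_of_real ((cmod (cinner h u))\<^sup>2 / (norm h)\<^sup>2)"
      using cc by (simp add: c_def cinner_scaleC_left)
    moreover have "norm (c *\<^sub>C h) = cmod (cinner h u) / norm h"
      using False by (simp add: norm_scaleC c_def norm_divide norm_mult power2_eq_square)
    ultimately have "(norm (u - c *\<^sub>C h))\<^sup>2 = (norm u)\<^sup>2 - (cmod (cinner h u))\<^sup>2 / (norm h)\<^sup>2"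
      by (simp add: norm_diff_cinner power_divide)
    moreover have "(norm u)\<^sup>2 \<le> (norm (u - c *\<^sub>C h))\<^sup>2"
      using fu that by (intro umin) (simp add: S_def blinfun_ops clin_apply[OF assms])
    ultimately have "(cmod (cinner h u))\<^sup>2 / (norm h)\<^sup>2 \<le> 0" by linarith
    then have "cinner h u = 0" using False by (simp add: divide_le_0_iff)
    then show ?thesis using cinner_commute[of u h] by simp
  qed simp
  have nu: "norm u > 0" using fu by auto
  have "f x = cinner (complex_of_real (1 / (norm u)\<^sup>2) *\<^sub>C u) x" for x
  proof -
    have "cinner u (x - f x *\<^sub>C u) = 0"
      by (rule orth) (simp add: blinfun_ops clin_apply[OF assms] fu scaleC_complex_def)
    then have "cinner u x = f x * complex_of_real ((norm u)\<^sup>2)"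
      by (simp add: cinner_simps cinner_self)
    then show ?thesis using nu by (simp add: cinner_simps)
  qed
  then show ?thesis by blast
qed

lemma ex_adjoint:
  fixes T :: "'a::complex_hilbert \<Rightarrow>\<^sub>L 'b::complex_hilbert"
  assumes "clin T"
  shows "\<exists>S. clin S \<and> (\<forall>x y. cinner (blinfun_apply S y) x = cinner y (T x))"
proof -
  have "\<exists>v. \<forall>x. (cinner_blinfun y o\<^sub>L T) x = cinner v x" for y
    by (rule Riesz_representation) (simp add: assms)
  then obtain g where g: "\<And>x y. cinner (g y) x = cinner y (T x)" by simp metis
  have eqI: "u = v" if "\<And>x. cinner u x = cinner v x" for u v :: 'a
    using that by (metis cinner_commute eq_if_cinner_eq)
  have scale: "g (c *\<^sub>C x) = c *\<^sub>C g x" for c x by (rule eqI) (simp add: g cinner_simps)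
  have bl: "bounded_linear g"
  proof (rule bounded_linear_intro)
    show "g (x + y) = g x + g y" for x y by (rule eqI) (simp add: g cinner_simps)
    show "g (r *\<^sub>R x) = r *\<^sub>R g x" for r x unfolding scaleR_scaleC by (rule scale)
    show "norm (g y) \<le> norm y * norm T" for y
    proof (cases "g y = 0")
      case False
      have "(norm (g y))\<^sup>2 = cmod (cinner y (T (g y)))"
        by (simp add: g[symmetric] cinner_self norm_power)
      also have "\<dots> \<le> norm y * (norm T * norm (g y))"
        by (rule order_trans[OF cinner_Cauchy_Schwarz]) (auto intro!: mult_left_mono norm_blinfun)
      finally show ?thesis using False by (simp add: power2_eq_square mult_ac)
    qed simp
  qed
  show ?thesis
    by (rule exI[of _ "Blinfun g"])
      (simp add: clin_def bounded_linear_Blinfun_apply[OF bl] scale g)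
qed

section \<open>Factorized perturbations\<close>

text \<open>The product of \<open>A\<close> and \<open>R\<close> is everywhere defined, and its
  graph is closed because \<open>A\<close> is closed and \<open>R\<close> continuous; the closed
  graph theorem applies.\<close>

lemma closed_op_compose_bounded:
  fixes A :: "('b::complex_hilbert \<times> 'c::complex_hilbert) set" and R :: "'a::complex_hilbert \<Rightarrow>\<^sub>L 'b"
  assumes A: "closed_op A" and R: "clin R" "\<And>x. R x \<in> Domain A"
  obtains F where "clin F" "\<And>x y. (R x, y) \<in> A \<longleftrightarrow> y = blinfun_apply F x"
proof -
  have sv: "\<And>x y z. (x, y) \<in> A \<Longrightarrow> (x, z) \<in> A \<Longrightarrow> y = z"
    and add: "\<And>x y x' y'. (x, y) \<in> A \<Longrightarrow> (x', y') \<in> A \<Longrightarrow> (x + x', y + y') \<in> A"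
    and scale: "\<And>c x y. (x, y) \<in> A \<Longrightarrow> (c *\<^sub>C x, c *\<^sub>C y) \<in> A" and cl: "closed A"
    using A unfolding closed_op_def linear_op_def single_valued_def by blast+
  have "\<forall>x. \<exists>y. (R x, y) \<in> A" using R(2) by blast
  then obtain f where f: "\<And>x. (R x, f x) \<in> A" unfolding choice_iff by blast
  have iff: "(R x, y) \<in> A \<longleftrightarrow> y = f x" for x y using f sv by blast
  have f_scale: "f (c *\<^sub>C x) = c *\<^sub>C f x" for c x
    using scale[OF f, of c x] iff[of "c *\<^sub>C x" "c *\<^sub>C f x"] by (simp add: clin_apply[OF R(1)])
  have "linear f"
  proof
    show "f (x + y) = f x + f y" for x y
      using add[OF f f, of x y] iff[of "x + y"] by (simp add: blinfun.add_right)
    show "f (r *\<^sub>R x) = r *\<^sub>R f x" for r x by (simp add: scaleR_scaleC f_scale)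
  qed
  moreover have "closed (range (\<lambda>x. (x, f x)))"
    unfolding closed_sequential_limits
  proof (intro allI impI, elim conjE)
    fix s l assume s: "\<forall>n. s n \<in> range (\<lambda>x. (x, f x))" and lim: "s \<longlonglongrightarrow> l"
    have "(R (fst (s n)), snd (s n)) \<in> A" for n
      using s f by (metis (no_types, lifting) fst_conv imageE snd_conv)
    moreover have "(\<lambda>n. (R (fst (s n)), snd (s n))) \<longlonglongrightarrow> (R (fst l), snd l)"
      by (intro tendsto_intros lim)
    ultimately have "(R (fst l), snd l) \<in> A" by (rule closed_sequentially[OF cl])
    then have "snd l = f (fst l)" by (simp add: iff)
    then show "l \<in> range (\<lambda>x. (x, f x))" by (metis prod.collapse rangeI)
  qed
  ultimately have bl: "bounded_linear f" by (rule closed_graph)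
  show thesis
    by (rule that[of "Blinfun f"])
      (simp_all add: clin_def bounded_linear_Blinfun_apply[OF bl] f_scale iff)
qed

lemma closed_graph_of: "closed (graph_of F)"
proof -
  have "graph_of F = {p. snd p = F (fst p)}" by (auto simp: graph_of_def)
  then show ?thesis by (simp add: closed_Collect_eq continuous_intros)
qed

lemma closure_subset_graph_of:
  assumes "Z \<subseteq> graph_of G" "closure (Domain Z) = UNIV"
  shows "closure Z = graph_of G"
proof
  show "closure Z \<subseteq> graph_of G" by (rule closure_minimal[OF assms(1) closed_graph_of])
  show "graph_of G \<subseteq> closure Z"
  proof
    fix p assume "p \<in> graph_of G"
    then obtain x where p: "p = (x, G x)" by (auto simp: graph_of_def)
    obtain s where s: "\<And>n. s n \<in> Domain Z" "s \<longlonglongrightarrow> x"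
      using assms(2) by (metis UNIV_I closure_sequential)
    have "(s n, G (s n)) \<in> Z" for n
      using s(1)[of n] assms(1) by (metis DomainE graph_of_iff subsetD)
    moreover have "(\<lambda>n. (s n, G (s n))) \<longlonglongrightarrow> p" unfolding p by (intro tendsto_intros s)
    ultimately show "p \<in> closure Z"
      unfolding closure_sequential by (intro exI[of _ "\<lambda>n. (s n, G (s n))"]) auto
  qed
qed

lemma blinfun_eq_on_dense:
  assumes "closure D = UNIV" "\<And>x. x \<in> D \<Longrightarrow> blinfun_apply F x = blinfun_apply G x" shows "F = G"
proof (rule blinfun_eqI)
  fix x
  obtain s where s: "\<And>n. s n \<in> D" "s \<longlonglongrightarrow> x"
    using assms(1) by (metis UNIV_I closure_sequential)
  have "(\<lambda>n. F (s n)) \<longlonglongrightarrow> F x" "(\<lambda>n. G (s n)) \<longlonglongrightarrow> G x" by (intro tendsto_intros s)+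
  then show "F x = G x" using assms(2)[OF s(1)] LIMSEQ_unique by simp
qed

lemma uminus_op_iff: "(x, y) \<in> uminus_op T \<longleftrightarrow> (x, - y) \<in> T"
  by (force simp: uminus_op_def)

lemma minus_op_graph_of: "graph_of F -\<^sub>o graph_of G = graph_of (F - G)"
  by (auto simp: minus_op_def graph_of_iff blinfun_ops)

lemma comp_op_graph_of: "graph_of F \<circ>\<^sub>o graph_of G = graph_of (F o\<^sub>L G)"
  by (auto simp: graph_of_iff)

text \<open>The domain of \<open>B\<^sup>*\<close> is dense because \<open>K(z)\<close> is everywhere defined.\<close>

lemma bs_op_bounded:
  fixes H0 :: "('h::complex_hilbert \<times> 'h) set" and A B :: "('h \<times> 'k::complex_hilbert) set"
  assumes "closed_op A" and dom: "Domain H0 \<subseteq> Domain A"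
    and R: "graph_of R = resolvent_op H0 z" "clin R"
    and K: "compact_op (bs_op H0 A B z)"
  obtains F K where "clin F" "A \<circ>\<^sub>o resolvent_op H0 z = graph_of F" "\<And>x y. (R x, y) \<in> A \<longleftrightarrow> y = blinfun_apply F x"
    "clin K" "bs_op H0 A B z = graph_of K" "approx_finite_rank K"
    "\<And>y w. (y, w) \<in> adj_op B \<Longrightarrow> F w = - K y" "closure (Domain (adj_op B)) = UNIV"
proof -
  have "R x \<in> Domain A" for x
    using resolvent_op_iff[of x "R x" H0 z] R(1) graph_of_iff[of x "R x" R] dom by blast
  then obtain F where F: "clin F" "\<And>x y. (R x, y) \<in> A \<longleftrightarrow> y = blinfun_apply F x"
    using closed_op_compose_bounded[OF assms(1) R(2)] by metis
  have AR: "A \<circ>\<^sub>o resolvent_op H0 z = graph_of F"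
    unfolding R(1)[symmetric] by (auto simp: graph_of_iff F(2))
  obtain K' where K': "clin K'" "bs_op H0 A B z = graph_of K'"
    using K bounded_opE unfolding compact_op_def by blast
  define Z where "Z = A \<circ>\<^sub>o resolvent_op H0 z \<circ>\<^sub>o adj_op B"
  have Z: "Z = graph_of F \<circ>\<^sub>o adj_op B" unfolding Z_def AR[symmetric] by (simp add: O_assoc)
  have clZ: "(y, t) \<in> closure Z \<longleftrightarrow> t = - K' y" for y t
  proof -
    have "(y, t) \<in> closure Z \<longleftrightarrow> (y, - t) \<in> graph_of K'"
      unfolding K'(2)[symmetric] bs_op_def Z_def uminus_op_iff by simp
    then show ?thesis unfolding graph_of_iff by (metis minus_minus)
  qed
  have Fw: "F w = - K' y" if "(y, w) \<in> adj_op B" for y w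
  proof -
    have "(y, F w) \<in> Z" using that by (auto simp: Z graph_of_iff)
    then show ?thesis using clZ closure_subset by blast
  qed
  have dense: "closure (Domain (adj_op B)) = UNIV"
  proof -
    have "y \<in> closure (Domain (adj_op B))" for y
    proof -
      obtain s where s: "\<And>n. s n \<in> Z" "s \<longlonglongrightarrow> (y, - K' y)"
        using clZ[of y "- K' y"] by (metis closure_sequential)
      have "fst (s n) \<in> Domain (adj_op B)" for n
        using s(1)[of n] unfolding Z by (cases "s n") auto
      moreover have "(\<lambda>n. fst (s n)) \<longlonglongrightarrow> y" using tendsto_fst[OF s(2)] by simp
      ultimately show ?thesis
        unfolding closure_sequential by (intro exI[of _ "\<lambda>n. fst (s n)"]) auto
    qed
    then show ?thesis by blast
  qed
  have "bs_op H0 A B z `` cball 0 1 = K' ` cball 0 1"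
    unfolding K'(2) by (auto simp: graph_of_iff Image_def)
  then have "compact (closure (K' ` cball 0 1))"
    using K bounded_cball unfolding compact_op_def by metis
  then have "approx_finite_rank K'"
    by (rule approx_finite_rank_if_compact[OF K'(1)])
  then show thesis using that[OF F(1) AR F(2) K' _ Fw dense] by blast
qed

text \<open>\<open>G\<close> is the adjoint of \<open>B (H\<^sub>0\<^sup>* - cnj z)\<^sup>-\<^sup>1\<close>.\<close>

lemma closure_resolvent_adj_bounded:
  fixes H0 :: "('h::complex_hilbert \<times> 'h) set" and B :: "('h \<times> 'k::complex_hilbert) set"
  assumes "closed_op B" and dom: "Domain (adj_op H0) \<subseteq> Domain B"
    and R: "graph_of R = resolvent_op H0 z" "clin R"
    and dense: "closure (Domain (adj_op B)) = UNIV"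
  obtains G where "clin G" "closure (resolvent_op H0 z \<circ>\<^sub>o adj_op B) = graph_of G"
    "\<And>y w. (y, w) \<in> adj_op B \<Longrightarrow> R w = blinfun_apply G y"
proof -
  obtain S where S: "clin S" "\<And>x y. cinner (blinfun_apply S y) x = cinner y (R x)"
    using ex_adjoint[OF R(2)] by blast
  have "S y \<in> Domain B" for y
  proof -
    \<comment> \<open>This is (H0^* - cnj z) S y = y in weak form: the adjoint of the resolvent maps
      into the domain of \<open>adj_op H0\<close>, hence into that of \<open>B\<close>.\<close>
    have "cinner (S y) w = cinner (y + cnj z *\<^sub>C S y) x" if "(x, w) \<in> H0" for x w
    proof -
      have "R (w - z *\<^sub>C x) = x" using that operator_iff_resolvent[OF R(1)] by blast
      then show ?thesis using S(2)[of y "w - z *\<^sub>C x"] by (simp add: cinner_simps algebra_simps)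
    qed
    then have "(S y, y + cnj z *\<^sub>C S y) \<in> adj_op H0" by (auto simp: adj_op_def)
    then show ?thesis using dom by blast
  qed
  then obtain F where F: "clin F" "\<And>x y. (S x, y) \<in> B \<longleftrightarrow> y = blinfun_apply F x"
    using closed_op_compose_bounded[OF assms(1) S(1)] by metis
  obtain G where G: "clin G" "\<And>x y. cinner (blinfun_apply G y) x = cinner y (F x)"
    using ex_adjoint[OF F(1)] by blast
  have RG: "R w = G y" if "(y, w) \<in> adj_op B" for y w
  proof (rule eq_if_cinner_eq)
    fix x
    have "cinner y (F x) = cinner w (S x)"
      using that F(2)[of x "F x"] by (auto simp: adj_op_def)
    then have "cinner (G y) x = cnj (cinner x (R w))"
      using G(2) S(2) cinner_commute by metis
    then show "cinner x (R w) = cinner x (G y)" using cinner_commute by metis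
  qed
  have "closure (resolvent_op H0 z \<circ>\<^sub>o adj_op B) = graph_of G"
  proof (rule closure_subset_graph_of)
    show "resolvent_op H0 z \<circ>\<^sub>o adj_op B \<subseteq> graph_of G"
      unfolding R(1)[symmetric] using RG by (auto simp: graph_of_iff)
    have "Domain (resolvent_op H0 z \<circ>\<^sub>o adj_op B) = Domain (adj_op B)"
      unfolding R(1)[symmetric] by (force simp: graph_of_def)
    then show "closure (Domain (resolvent_op H0 z \<circ>\<^sub>o adj_op B)) = UNIV" using dense by simp
  qed
  then show thesis using that[OF G(1) _ RG] by blast
qed

section \<open>Comparison of the essential spectra\<close>

text \<open>\<open>M\<close> belongs to the reverse perturbation: L becomes L^-1, F becomes L^-1 F
  and G becomes -G L^-1, with \<open>T\<close> in the role of \<open>T0\<close>. A left inverse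
  suffices, since M (1 + N) = 1 gives M - 1 = - M N.\<close>

lemma perturbation_inverse:
  fixes T0 T :: "'h::complex_hilbert \<Rightarrow>\<^sub>L 'h" and L :: "'k::complex_hilbert \<Rightarrow>\<^sub>L 'k"
    and F :: "'h \<Rightarrow>\<^sub>L 'k" and G :: "'k \<Rightarrow>\<^sub>L 'h"
  assumes clin: "clin T0" "clin F" "clin G" and L: "invertible_blinfun L"
    and T: "T = T0 - (G o\<^sub>L inverse_blinfun L o\<^sub>L F)"
    and z: "z \<in> rset T0 z1" "z \<in> rset T z1"
  defines "M0 \<equiv> L + scaleC_blinfun (z - z1) (F o\<^sub>L inverse_blinfun (rpencil T0 z1 z) o\<^sub>L G)"
    and "M \<equiv> inverse_blinfun L + scaleC_blinfun (z - z1) ((inverse_blinfun L o\<^sub>L F)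
        o\<^sub>L inverse_blinfun (rpencil T z1 z) o\<^sub>L - (G o\<^sub>L inverse_blinfun L))"
  shows "M o\<^sub>L M0 = id_blinfun"
proof (rule blinfun_eqI)
  fix x
  let ?L' = "inverse_blinfun L" and ?w = "z - z1"
  let ?R = "inverse_blinfun (rpencil T0 z1 z)" and ?S = "inverse_blinfun (rpencil T z1 z)"
  have i: "invertible_blinfun (rpencil T0 z1 z)" "invertible_blinfun (rpencil T z1 z)"
    using z by (auto simp: regular_set_def)
  note L_inv = inverse_blinfun_apply[OF L]
  have cL: "clin L" "clin ?L'" and cS: "clin ?S"
    using L i by (auto intro: clin_invertible clin_inverse_blinfun)
  \<comment> \<open>The second resolvent identity for the two pencils, whose difference is
    \<open>?w\<close> times \<open>G ?L' F\<close>.\<close>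
  have R: "?R y = ?S y + ?w *\<^sub>C ?S (G (?L' (F (?R y))))" for y
  proof -
    have "rpencil T z1 z (?R y) = rpencil T0 z1 z (?R y) + ?w *\<^sub>C G (?L' (F (?R y)))"
      by (simp add: rpencil_apply T blinfun_ops)
    then have "rpencil T z1 z (?R y) = y + ?w *\<^sub>C G (?L' (F (?R y)))"
      by (simp add: inverse_blinfun_apply[OF i(1)])
    then have "?R y = ?S (y + ?w *\<^sub>C G (?L' (F (?R y))))"
      using inverse_blinfun_apply(2)[OF i(2)] by metis
    then show ?thesis by (simp add: blinfun_ops clin_apply[OF cS])
  qed
  let ?r = "F (?R (G x))"
  have r: "?r = F (?S (G x)) + ?w *\<^sub>C F (?S (G (?L' ?r)))"
    using arg_cong[OF R[of "G x"], of F] by (simp add: blinfun_ops clin_apply[OF clin(2)])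
  have "M y = ?L' (y - ?w *\<^sub>C F (?S (G (?L' y))))" for y
    by (simp add: M_def blinfun_ops clin_apply[OF cL(2)])
  then have "M (M0 x) = ?L' (M0 x - ?w *\<^sub>C F (?S (G (?L' (M0 x)))))" .
  also have "?L' (M0 x) = x + ?w *\<^sub>C ?L' ?r"
    by (simp add: M0_def blinfun_ops L_inv clin_apply[OF cL(2)])
  also have "F (?S (G (x + ?w *\<^sub>C ?L' ?r))) = ?r"
    by (subst (2) r) (simp add: blinfun_ops clin_apply[OF clin(2)] clin_apply[OF cS] clin_apply[OF clin(3)])
  also have "M0 x - ?w *\<^sub>C ?r = L x" by (simp add: M0_def blinfun_ops)
  finally show "(M o\<^sub>L M0) x = id_blinfun x" by (simp add: L_inv)
qed

text \<open>The perturbation enters only through \<open>F\<close>, \<open>G\<close> and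
  \<open>L\<close>, so the lemma can be used again with the operators exchanged. Assumption
  \<open>M\<close> is restricted to common regular points because the reverse data are controlled
  only there.\<close>

lemma ess_spectrum_subset:
  fixes X0 X :: "('h::complex_hilbert \<times> 'h) set" and T0 T :: "'h \<Rightarrow>\<^sub>L 'h"
    and L :: "'k::complex_hilbert \<Rightarrow>\<^sub>L 'k" and F :: "'h \<Rightarrow>\<^sub>L 'k" and G :: "'k \<Rightarrow>\<^sub>L 'h"
  assumes X0: "graph_of T0 = resolvent_op X0 z1" "clin T0"
    and X: "graph_of T = resolvent_op X z1" "clin T"
    and clin: "clin F" "clin G" and L: "invertible_blinfun L"
    and T: "T = T0 - (G o\<^sub>L inverse_blinfun L o\<^sub>L F)"
    and M: "\<And>z. z \<in> rset T0 z1 \<Longrightarrow> z \<in> rset T z1 \<Longrightarrow> approx_finite_rank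
        (L + scaleC_blinfun (z - z1) (F o\<^sub>L inverse_blinfun (rpencil T0 z1 z) o\<^sub>L G) - id_blinfun)"
    and comp: "\<forall>C \<in> components (ext_resolvent_set X0). C \<inter> resolvent_set X \<noteq> {}"
  shows "ess_spectrum X \<subseteq> ess_spectrum X0"
proof
  fix z0 assume z0X: "z0 \<in> ess_spectrum X"
  show "z0 \<in> ess_spectrum X0"
  proof (rule ccontr)
    assume z0: "z0 \<notin> ess_spectrum X0"
    let ?\<Omega> = "ext_resolvent_set X0" and ?U = "rset T z1"
    have opU: "open ?U" by (rule open_regular_set[OF X(2)])
    have sub: "rset T0 z1 \<subseteq> ?\<Omega>"
      unfolding resolvent_set_eq_rset[OF X0, symmetric]
      by (auto simp: ext_resolvent_set_def ess_spectrum_def spectrum_op_def)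
    have near: "\<exists>\<rho>>0. \<forall>z'. z' \<noteq> z \<and> cmod (z' - z) < \<rho> \<longrightarrow> z' \<in> rset T0 z1"
      and fred0: "fredholm (rpencil T0 z1 z)" if "z \<in> ?\<Omega>" for z
      using not_ess_spectrum_near[OF X0, of z] that by (auto simp: ext_resolvent_set_def)
    have op\<Omega>: "open ?\<Omega>"
      unfolding open_dist dist_norm
    proof
      fix z assume z: "z \<in> ?\<Omega>"
      then show "\<exists>e>0. \<forall>y. norm (y - z) < e \<longrightarrow> y \<in> ?\<Omega>"
        using near[OF z] sub by (metis subsetD)
    qed
    define C where "C = connected_component_set ?\<Omega> z0"
    have z0\<Omega>: "z0 \<in> ?\<Omega>" using z0 by (simp add: ext_resolvent_set_def)
    have C: "open C" "connected C" "C \<subseteq> ?\<Omega>" "z0 \<in> C" "C \<in> components ?\<Omega>"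
      using op\<Omega> z0\<Omega> by (auto simp: C_def open_connected_component connected_component_subset
          connected_component_refl intro: componentsI)
    have fred: "fredholm (rpencil T z1 z)" if z: "z \<in> C" "z \<in> closure ?U" for z
    proof (rule fredholm_transfer[OF X0(2) clin L T fred0])
      show "z \<in> ?\<Omega>" using z(1) C(3) by blast
      obtain \<rho> where \<rho>: "\<rho> > 0" "\<And>z'. z' \<noteq> z \<Longrightarrow> cmod (z' - z) < \<rho> \<Longrightarrow> z' \<in> rset T0 z1"
        using near[of z] z(1) C(3) by blast
      \<comment> \<open>Near \<open>z\<close> only \<open>z\<close> itself can fail to be regular
        for \<open>T0\<close>; since the regular set of \<open>T\<close> is open, it has points
        other than \<open>z\<close> arbitrarily close to \<open>z\<close>.\<close>
      show "z \<in> closure (rset T0 z1 \<inter> ?U)"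
        unfolding closure_approachable
      proof (intro allI impI)
        fix e :: real assume "e > 0"
        then have "min e \<rho> > 0" using \<rho>(1) by simp
        then obtain y where y: "y \<in> ?U" "dist y z < min e \<rho>"
          using z(2) unfolding closure_approachable by blast
        have "open (?U \<inter> ball z (min e \<rho>))" using opU by blast
        moreover have "y \<in> ?U \<inter> ball z (min e \<rho>)" using y by (simp add: dist_commute)
        ultimately have "\<not> (?U \<inter> ball z (min e \<rho>) \<subseteq> {z})"
          by (metis empty_iff not_open_singleton subset_singletonD)
        then obtain y' where y': "y' \<in> ?U" "y' \<noteq> z" "dist z y' < min e \<rho>"
          unfolding subset_iff by auto
        then have "y' \<in> rset T0 z1 \<inter> ?U" using \<rho>(2)[of y'] by (simp add: dist_norm norm_minus_commute)
        then show "\<exists>y\<in>rset T0 z1 \<inter> ?U. dist y z < e" using y'(3) by (auto simp: dist_commute)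
      qed
    qed (use M in auto)
    have punct: "\<exists>r>0. \<forall>z'. z' \<noteq> z \<and> cmod (z' - z) < r \<longrightarrow> z' \<in> ?U" if z: "z \<in> C" "z \<in> closure ?U" for z
      using analytic_fredholm_pencil(1)[OF X(2) clin_resolvent_pencil_base[OF X(2)] fred[OF z] z(2)] by blast
    \<comment> \<open>At a point of the closure the punctured disc of regular points puts a whole
      neighbourhood into the closure, so the closure cannot end inside the component.\<close>
    have "openin (top_of_set C) (C \<inter> closure ?U)"
    proof -
      have "open (C \<inter> closure ?U)"
        unfolding open_dist dist_norm
      proof
        fix z assume z: "z \<in> C \<inter> closure ?U"
        obtain r where r: "r > 0" "\<And>z'. z' \<noteq> z \<Longrightarrow> cmod (z' - z) < r \<Longrightarrow> z' \<in> ?U"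
          using punct z by blast
        obtain s where s: "s > 0" "\<And>z'. cmod (z' - z) < s \<Longrightarrow> z' \<in> C"
          using C(1) z unfolding open_dist dist_norm by blast
        have "z' \<in> C \<inter> closure ?U" if "cmod (z' - z) < min r s" for z'
          using r(2)[of z'] s(2)[of z'] that z closure_subset[of ?U] by (cases "z' = z") auto
        then show "\<exists>e>0. \<forall>z'. cmod (z' - z) < e \<longrightarrow> z' \<in> C \<inter> closure ?U"
          using r(1) s(1) by (intro exI[of _ "min r s"]) auto
      qed
      then show ?thesis using C(1) by (simp add: openin_open_eq)
    qed
    moreover have "closedin (top_of_set C) (C \<inter> closure ?U)"
      by (auto simp: closedin_closed)
    moreover have "C \<inter> closure ?U \<noteq> {}"
      using comp C(5) closure_subset[of ?U] unfolding resolvent_set_eq_rset[OF X] by blast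
    ultimately have "C \<inter> closure ?U = C"
      using C(2) unfolding connected_clopen by blast
    then have "z0 \<in> closure ?U" using C(4) by blast
    then have "z0 \<notin> ess_spectrum X"
      using not_ess_spectrum_if_fredholm[OF X fred[OF C(4)]] by blast
    then show False using z0X by blast
  qed
qed

text \<open>Both multiplicities vanish in a punctured disc, so only the order of
  \<open>\<Delta>\<close> at \<open>z0\<close> has to be prescribed.\<close>

lemma multiplicity_relation:
  fixes H0 H :: "('h::complex_hilbert \<times> 'h) set"
  assumes X0: "graph_of T0 = resolvent_op H0 z1" "clin T0"
    and X: "graph_of T = resolvent_op H z1" "clin T"
    and z0: "z0 \<notin> ess_spectrum H0" "z0 \<notin> ess_spectrum H"
  shows "\<exists>U \<Delta>. open U \<and> connected U \<and> z0 \<in> U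
           \<and> \<Delta> nicely_meromorphic_on U \<and> (\<exists>z \<in> U. \<Delta> z \<noteq> 0)
           \<and> (\<forall>z \<in> U. ereal_of_enat (mult_op z H)
                = ereal_of_enat (mult_op z H0) + ereal (real_of_int (mult_fun z \<Delta>)))"
proof -
  have fin: "\<exists>n. mult_op z0 Y = enat n" if "z0 \<notin> ess_spectrum Y" for Y :: "('h \<times> 'h) set"
    using that by (auto simp: mult_op_def ess_spectrum_def spectrum_op_def isolated_eigenvalue_fin_def zero_enat_def)
  obtain n0 n where n: "mult_op z0 H0 = enat n0" "mult_op z0 H = enat n"
    using fin z0 by blast
  obtain r0 r where r: "r0 > 0" "\<And>z. z \<noteq> z0 \<Longrightarrow> cmod (z - z0) < r0 \<Longrightarrow> z \<in> resolvent_set H0"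
    "r > 0" "\<And>z. z \<noteq> z0 \<Longrightarrow> cmod (z - z0) < r \<Longrightarrow> z \<in> resolvent_set H"
    using not_ess_spectrum_near(1)[OF X0 z0(1)] not_ess_spectrum_near(1)[OF X z0(2)]
    unfolding resolvent_set_eq_rset[OF X0] resolvent_set_eq_rset[OF X] by blast
  define k where "k = int n - int n0"
  \<comment> \<open>For negative \<open>k\<close> the value at \<open>z0\<close> is 0 because
    \<open>0 powi k = 0\<close>, which is the value that \<open>nicely_meromorphic_on\<close>
    prescribes at a pole.\<close>
  define \<Delta> where "\<Delta> z = (z - z0) powi k" for z
  let ?U = "ball z0 (min r0 r)"
  have an: "\<Delta> analytic_on {z}" if "z \<noteq> z0" for z
    unfolding \<Delta>_def using that by (intro analytic_intros) auto
  have nice: "\<Delta> nicely_meromorphic_on ?U"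
    unfolding nicely_meromorphic_on_def
  proof (intro conjI ballI)
    show "\<Delta> meromorphic_on ?U"
      unfolding \<Delta>_def by (intro meromorphic_intros)
    fix z assume "z \<in> ?U"
    show "is_pole \<Delta> z \<and> \<Delta> z = 0 \<or> \<Delta> \<midarrow>z\<rightarrow> \<Delta> z"
    proof (cases "z = z0 \<and> k < 0")
      case True
      have "isolated_zero (\<lambda>w. w - z0) z0"
        unfolding isolated_zero_def by (auto intro!: tendsto_eq_intros simp: eventually_at_filter)
      then have "is_pole \<Delta> z0"
        unfolding \<Delta>_def using True by (intro is_pole_power_int_0 analytic_intros) auto
      then show ?thesis using True by (simp add: \<Delta>_def)
    next
      case False
      have "isCont \<Delta> z"
      proof (cases "z = z0")
        case True
        then have "\<Delta> = (\<lambda>z. (z - z0) ^ nat k)"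
          using False by (auto simp: \<Delta>_def power_int_def)
        then show ?thesis by simp
      qed (use an analytic_at_imp_isCont in blast)
      then show ?thesis by (simp add: isCont_def)
    qed
  qed
  have "ereal_of_enat (mult_op z H)
      = ereal_of_enat (mult_op z H0) + ereal (real_of_int (mult_fun z \<Delta>))" if z: "z \<in> ?U" for z
  proof (cases "z = z0")
    case True
    have "zorder \<Delta> z0 = k"
      by (rule zorder_eqI[of UNIV z0 "\<lambda>_. 1"]) (auto simp: \<Delta>_def)
    \<comment> \<open>For \<open>k = 0\<close> the function is constantly 1, as
      \<open>0 powi 0 = 1\<close>. Otherwise its value at \<open>z0\<close> is 0, at a pole too, and
      \<open>mult_fun\<close> returns \<open>zorder\<close>.\<close>
    then have "mult_fun z0 \<Delta> = k"
      by (cases "k = 0") (auto simp: mult_fun_def \<Delta>_def)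
    then show ?thesis using True n by (simp add: k_def)
  next
    case False
    have "z \<in> resolvent_set H0" "z \<in> resolvent_set H"
      using z False by (auto intro!: r simp: dist_norm norm_minus_commute)
    moreover have "\<Delta> z \<noteq> 0" "\<not> is_pole \<Delta> z"
      using False an[OF False] by (auto simp: \<Delta>_def dest: not_is_pole_holomorphic analytic_at_imp_no_pole)
    ultimately show ?thesis by (simp add: mult_op_def mult_fun_def zero_ereal_def)
  qed
  moreover have "\<exists>z\<in>?U. \<Delta> z \<noteq> 0"
    using r(1,3) by (intro bexI[of _ "z0 + of_real (min r0 r / 2)"]) (auto simp: \<Delta>_def dist_norm)
  ultimately show ?thesis
    using nice r(1,3) by (intro exI[of _ ?U] exI[of _ \<Delta>] conjI) simp_all
qed

theorem theorem4p5:
  fixes H0 H :: "('h::complex_hilbert \<times> 'h) set"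
    and A B :: "('h \<times> 'k::complex_hilbert) set"
  assumes "separable_space (euclidean :: 'h topology)"
    and "separable_space (euclidean :: 'k topology)"
    \<comment> \<open>(i)\<close>
    and "densely_defined H0" and "closed_op H0" and "resolvent_set H0 \<noteq> {}"
    and "densely_defined A" and "closed_op A"
    and "densely_defined B" and "closed_op B"
    and "Domain H0 \<subseteq> Domain A" and "Domain (adj_op H0) \<subseteq> Domain B"
    \<comment> \<open>(ii)\<close>
    and "\<exists>z \<in> resolvent_set H0. \<exists>C. bounded_op C
           \<and> uminus_op (A \<circ>\<^sub>o resolvent_op H0 z \<circ>\<^sub>o adj_op B) \<subseteq> C"
    \<comment> \<open>(iii)\<close>
    and "\<exists>z \<in> resolvent_set H0. 1 \<in> resolvent_set (bs_op H0 A B z)"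
    \<comment> \<open>(iv)\<close>
    and "\<forall>z \<in> resolvent_set H0. compact_op (bs_op H0 A B z)"
    and "is_perturbed_op H0 A B H"
    and "\<forall>C \<in> components (ext_resolvent_set H0). C \<inter> resolvent_set H \<noteq> {}"
    and "\<forall>C \<in> components (ext_resolvent_set H). C \<inter> resolvent_set H0 \<noteq> {}"
  shows "ess_spectrum H = ess_spectrum H0
    \<and> (\<forall>z0 \<in> - ess_spectrum H0. \<exists>U \<Delta>. open U \<and> connected U \<and> z0 \<in> U
           \<and> \<Delta> nicely_meromorphic_on U \<and> (\<exists>z \<in> U. \<Delta> z \<noteq> 0)
           \<and> (\<forall>z \<in> U. ereal_of_enat (mult_op z H)
                = ereal_of_enat (mult_op z H0) + ereal (real_of_int (mult_fun z \<Delta>))))"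
proof -
  note clA = assms(7) and clB = assms(9) and domA = assms(10) and domB = assms(11) and compact = assms(14)
  obtain z1 where z1: "z1 \<in> resolvent_set H0" "1 \<in> resolvent_set (bs_op H0 A B z1)"
    using assms(13) by blast
  obtain T0 where T0: "clin T0" "graph_of T0 = resolvent_op H0 z1"
    using z1(1) bounded_opE unfolding resolvent_set_def by (metis mem_Collect_eq)
  obtain F K where F: "clin F" "A \<circ>\<^sub>o resolvent_op H0 z1 = graph_of F"
      "\<And>x y. (T0 x, y) \<in> A \<longleftrightarrow> y = blinfun_apply F x"
    and K: "clin K" "bs_op H0 A B z1 = graph_of K" "approx_finite_rank K"
    and FK: "\<And>y w. (y, w) \<in> adj_op B \<Longrightarrow> F w = - K y" and dense: "closure (Domain (adj_op B)) = UNIV"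
    by (rule bs_op_bounded[OF clA domA T0(2,1) compact[rule_format, OF z1(1)]]) blast
  obtain G where G: "clin G" "closure (resolvent_op H0 z1 \<circ>\<^sub>o adj_op B) = graph_of G"
      "\<And>y w. (y, w) \<in> adj_op B \<Longrightarrow> T0 w = blinfun_apply G y"
    by (rule closure_resolvent_adj_bounded[OF clB domB T0(2,1) dense]) blast
  define L where "L = id_blinfun - K"
  have L: "invertible_blinfun L"
  proof -
    \<comment> \<open>\<open>R\<close> is the inverse of \<open>K - 1\<close>, so the inverse of
      \<open>L = 1 - K\<close> is \<open>- R\<close>.\<close>
    obtain R where R: "clin R" "resolvent_op (graph_of K) 1 = graph_of R"
      using z1(2) unfolding resolvent_set_def K(2) by (auto elim: bounded_opE)
    have eq: "v = R u \<longleftrightarrow> u = K v - v" for u v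
      using resolvent_op_iff[of u v "graph_of K" 1] R(2)
      by (simp add: graph_of_iff scaleC_one eq_diff_eq)
    have "inverse_pair L (- R)"
    proof (rule inverse_pairI)
      show "L ((- R) x) = x" for x using eq[of "R x" x] by (simp add: L_def blinfun_ops)
      show "(- R) (L x) = x" for x
        using eq[of x "K x - x"] by (simp add: L_def blinfun_ops)
    qed (use K R in \<open>auto simp: L_def\<close>)
    then show ?thesis by (auto simp: invertible_blinfun_def)
  qed
  let ?L' = "inverse_blinfun L"
  have cL': "clin ?L'" by (rule clin_inverse_blinfun[OF L])
  define T where "T = T0 - (G o\<^sub>L ?L' o\<^sub>L F)"
  have cT: "clin T" using T0 G F cL' by (simp add: T_def)
  have graphT: "graph_of T = resolvent_op H z1"
  proof -
    have inv: "(scalar_op 1 -\<^sub>o bs_op H0 A B z1)\<inverse> = graph_of ?L'"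
    proof -
      have "(u, v) \<in> (scalar_op 1 -\<^sub>o graph_of K)\<inverse> \<longleftrightarrow> u = L v" for u v
        by (auto simp: minus_op_def scalar_op_def graph_of_iff scaleC_one L_def blinfun_ops)
      then have "(u, v) \<in> (scalar_op 1 -\<^sub>o graph_of K)\<inverse> \<longleftrightarrow> v = ?L' u" for u v
        using inverse_blinfun_apply[OF L] by metis
      then show ?thesis unfolding K(2) by (auto simp: graph_of_iff)
    qed
    have "T = T0 - (G o\<^sub>L (?L' o\<^sub>L F))"
      by (rule blinfun_eqI) (simp add: T_def blinfun_ops)
    then have "perturbed_resolvent H0 A B z1 = graph_of T"
      unfolding perturbed_resolvent_def inv F(2) G(2) comp_op_graph_of
      unfolding T0(2)[symmetric] minus_op_graph_of by simp
    then show ?thesis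
      using assms(15) z1 unfolding is_perturbed_op_def by metis
  qed
  have M0: "approx_finite_rank
      (L + scaleC_blinfun (z - z1) (F o\<^sub>L inverse_blinfun (rpencil T0 z1 z) o\<^sub>L G) - id_blinfun)"
    if z: "z \<in> rset T0 z1" for z
  proof -
    let ?S = "inverse_blinfun (rpencil T0 z1 z)"
    have i: "invertible_blinfun (rpencil T0 z1 z)" using z by (simp add: regular_set_def)
    have cS: "clin ?S" by (rule clin_inverse_blinfun[OF i])
    define R where "R = ?S o\<^sub>L T0"
    have R: "graph_of R = resolvent_op H0 z" "clin R"
      using resolvent_op_eq_graph[OF T0(2,1) z] T0(1) cS by (auto simp: R_def)
    have zr: "z \<in> resolvent_set H0" using z resolvent_set_eq_rset[OF T0(2,1)] by simp
    obtain Fz Kz where Fz: "\<And>x y. (R x, y) \<in> A \<longleftrightarrow> y = blinfun_apply Fz x"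
      and Kz: "approx_finite_rank Kz" and FKz: "\<And>y w. (y, w) \<in> adj_op B \<Longrightarrow> Fz w = - blinfun_apply Kz y"
      by (rule bs_op_bounded[OF clA domA R compact[rule_format, OF zr]]) blast
    have comm: "?S (T0 x) = T0 (?S x)" for x
    proof -
      have "rpencil T0 z1 z (T0 (?S x)) = T0 (rpencil T0 z1 z (?S x))"
        by (simp add: rpencil_apply blinfun_ops clin_apply[OF T0(1)])
      then show ?thesis using inverse_blinfun_apply[OF i] by metis
    qed
    have S: "?S w = w + (z - z1) *\<^sub>C ?S (T0 w)" for w
      using inverse_blinfun_apply(2)[OF i, of w]
      by (simp add: rpencil_apply blinfun_ops clin_apply[OF cS] diff_eq_eq)
    \<comment> \<open>Compared on the dense domain of \<open>adj_op B\<close>, where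
      \<open>G\<close> and both Birman-Schwinger operators are given by the products before closure;
      continuity extends the equality.\<close>
    have "id_blinfun - Kz = L + scaleC_blinfun (z - z1) (F o\<^sub>L ?S o\<^sub>L G)"
    proof (rule blinfun_eq_on_dense[OF dense])
      fix y assume "y \<in> Domain (adj_op B)"
      then obtain w where w: "(y, w) \<in> adj_op B" by blast
      have "Fz w = F (?S w)"
        using Fz[of w "F (?S w)"] F(3)[of "?S w" "F (?S w)"] by (simp add: R_def comm)
      also have "\<dots> = F w + (z - z1) *\<^sub>C F (?S (T0 w))"
        by (subst S) (simp add: blinfun_ops clin_apply[OF F(1)])
      finally have "- Kz y = - K y + (z - z1) *\<^sub>C F (?S (G y))"
        by (simp add: FKz[OF w] FK[OF w] G(3)[OF w])
      then show "(id_blinfun - Kz) y = (L + scaleC_blinfun (z - z1) (F o\<^sub>L ?S o\<^sub>L G)) y"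
        by (simp add: L_def blinfun_ops algebra_simps)
    qed
    then have "L + scaleC_blinfun (z - z1) (F o\<^sub>L ?S o\<^sub>L G) - id_blinfun = - Kz"
      by (simp add: algebra_simps)
    then show ?thesis using approx_finite_rank_minus[OF Kz] by simp
  qed
  have sub1: "ess_spectrum H \<subseteq> ess_spectrum H0"
    by (rule ess_spectrum_subset[OF T0(2,1) graphT cT F(1) G(1) L T_def M0 assms(16)])
  have sub2: "ess_spectrum H0 \<subseteq> ess_spectrum H"
  proof (rule ess_spectrum_subset[OF graphT cT T0(2,1) _ _ _ _ _ assms(17)])
    show "clin (?L' o\<^sub>L F)" "clin (- (G o\<^sub>L ?L'))" "invertible_blinfun ?L'"
      using cL' F(1) G(1) invertible_inverse_blinfun[OF L] by auto
    have LL: "inverse_blinfun ?L' = L"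
      using inverse_pair_inverse_blinfun[OF L]
      by (intro inverse_blinfun_eqI) (simp add: inverse_pair_def)
    \<comment> \<open>The inverse of L^-1 is L, so the middle factors cancel and T0 = T + G L^-1 F
      remains.\<close>
    show "T0 = T - ((- (G o\<^sub>L ?L')) o\<^sub>L inverse_blinfun ?L' o\<^sub>L (?L' o\<^sub>L F))"
      unfolding LL by (rule blinfun_eqI) (simp add: T_def blinfun_ops inverse_blinfun_apply[OF L])
    fix z assume z: "z \<in> rset T z1" "z \<in> rset T0 z1"
    define M where "M = ?L' + scaleC_blinfun (z - z1) ((?L' o\<^sub>L F)
        o\<^sub>L inverse_blinfun (rpencil T z1 z) o\<^sub>L - (G o\<^sub>L ?L'))"
    define N where "N = L + scaleC_blinfun (z - z1) (F o\<^sub>L inverse_blinfun (rpencil T0 z1 z) o\<^sub>L G) - id_blinfun"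
    have "M o\<^sub>L (N + id_blinfun) = id_blinfun"
      using perturbation_inverse[OF T0(1) F(1) G(1) L T_def z(2,1)] by (simp add: M_def N_def)
    then have "M (N x) + M x = x" for x
      by (metis blinfun.add_right blinfun_apply_blinfun_compose blinfun_apply_id_blinfun id_apply plus_blinfun.rep_eq)
    then have "M - id_blinfun = - (M o\<^sub>L N)"
      by (intro blinfun_eqI) (simp add: blinfun_ops eq_neg_iff_add_eq_0 algebra_simps)
    moreover have "clin M"
      unfolding M_def using cL' F(1) G(1) z(1)
      by (intro clin_add clin_scaleC clin_compose clin_minus clin_inverse_blinfun)
        (auto simp: regular_set_def L)
    ultimately show "approx_finite_rank (?L' + scaleC_blinfun (z - z1) ((?L' o\<^sub>L F)
        o\<^sub>L inverse_blinfun (rpencil T z1 z) o\<^sub>L - (G o\<^sub>L ?L')) - id_blinfun)"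
      using approx_finite_rank_minus[OF approx_finite_rank_compose_left[OF _ M0[OF z(2), folded N_def]]]
      by (simp add: M_def)
  qed
  have eq: "ess_spectrum H = ess_spectrum H0" using sub1 sub2 by blast
  then show ?thesis
    using multiplicity_relation[OF T0(2,1) graphT cT] by blast
qed

end
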